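(* Let $U\subset\mathbb{R}^n$ be a simply connected domain equipped with a projectively flat Finsler structure. Suppose that the corresponding Finsler reflection law is projective. Then, up to rescaling the metric by a constant factor, $U$ is isometric to a domain in an $n$-dimensional space form of constant curvature: either the Euclidean space $\mathbb{R}^n$, or the unit sphere $S^n$, or the hyperbolic space $\mathbb{H}^n$.
   Context: A Finsler structure on a manifold $M$ is a family of smooth strictly convex closed hypersurfaces $I_x\subset T_xM$ (indicatrices), centrally symmetric with respect to zero; the Finsler norm $L(x,\cdot)$ on $T_xM$ is the norm with unit sphere $I_x$. A Finsler geodesic is a curve $\gamma:[t_0,t_1]\to M$ minimizing $\int_{t_0}^{t_1}L(\gamma(t),\dot\gamma(t))\,dt$ among curves with fixed endpoints. A Finsler structure on a domain $U\subset\mathbb{R}^n$ is projectively flat if all its geodesics are (segments of) straight lines. Finsler reflection law. The Legendre transform $D:I_x\to T_x^*M\setminus\{0\}$ sends $v\in I_x$ to the covector $w=D(v)$ with $w(v)=1$ and $\ker w$ parallel to the tangent hyperplane $T_vI_x$. For a codimension one vector subspace $H\subset T_xM$, the Finsler reflection with respect to $H$ is the involution $I_x\to I_x$ fixing the points of $I_x\cap H$ and sending each $u\in I_x\setminus H$ to the unique $v\in I_x$, $v\neq u$, such that $D(u)-D(v)$ vanishes on $H$ (then $u,v$ lie on different sides of $H$). Equivalently, the tangent hyperplanes to $I_x$ at $u$ and at $v$ and the hyperplane $H$ are concurrent (either parallel or intersecting in a common codimension two affine subspace). Identifying vectors of $I_x$ with oriented lines through the origin of $T_xM$, it acts on oriented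 directions. The Finsler reflection law is projective if for every $x\in M$ and every codimension one vector subspace $H\subset T_xM$ there is a line $\mathcal N\subset T_xM$ through $0$ transversal to $H$ such that the Finsler reflection with respect to $H$ acts on oriented directions as the linear involution of $T_xM$ that is the identity on $H$ and $-\mathrm{id}$ on $\mathcal N$. *)

theory Defs
  imports "HOL-Analysis.Analysis"
begin

text \<open>Throughout, \<open>U\<close> is an open subset of a Euclidean space \<open>'a\<close>, and every tangent space
  \<open>T\<^sub>xU\<close> is identified with \<open>'a\<close>.\<close>

subsection \<open>Smooth maps\<close>

text \<open>\<open>C\<^sup>k\<close> on an open set, by recursion on directional derivatives.\<close>

primrec Ck_on :: "nat \<Rightarrow> 'a::euclidean_space set \<Rightarrow> ('a \<Rightarrow> 'b::euclidean_space) \<Rightarrow> bool" where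
  "Ck_on 0 S f \<longleftrightarrow> continuous_on S f"
| "Ck_on (Suc k) S f \<longleftrightarrow>
     (\<forall>x\<in>S. f differentiable (at x)) \<and> (\<forall>v. Ck_on k S (\<lambda>x. frechet_derivative f (at x) v))"

definition smooth_on :: "'a::euclidean_space set \<Rightarrow> ('a \<Rightarrow> 'b::euclidean_space) \<Rightarrow> bool" where
  "smooth_on S f \<longleftrightarrow> (\<forall>k. Ck_on k S f)"

subsection \<open>Finsler structures\<close>

definition strictly_convex_closed_hypersurface :: "'a::euclidean_space set \<Rightarrow> bool" where
  "strictly_convex_closed_hypersurface S \<longleftrightarrow>
     (\<exists>K. convex K \<and> compact K \<and> interior K \<noteq> {} \<and> S = frontier K) \<and>
     (\<forall>u\<in>S. \<forall>v\<in>S. u \<noteq> v \<longrightarrow> open_segment u v \<inter> S = {})"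

text \<open>The Finsler norm \<open>L(x,\<cdot>)\<close>: the norm on \<open>T\<^sub>xU\<close> whose unit sphere is the indicatrix \<open>I x\<close>.\<close>

definition finsler_norm :: "('a \<Rightarrow> 'a set) \<Rightarrow> 'a \<Rightarrow> 'a::euclidean_space \<Rightarrow> real" where
  "finsler_norm I x v = (if v = 0 then 0 else (THE r. r > 0 \<and> v /\<^sub>R r \<in> I x))"

text \<open>Smoothness of the hypersurfaces \<open>I x\<close> and of their dependence on \<open>x\<close> is expressed by
  smoothness of \<open>L\<close> off the zero section. Since \<open>L(x,\<cdot>)\<close> is positively homogeneous, \<open>1\<close> is a
  regular value of it, so that \<open>I x\<close> is indeed a smooth hypersurface.\<close>

definition finsler_structure :: "'a::euclidean_space set \<Rightarrow> ('a \<Rightarrow> 'a set) \<Rightarrow> bool" where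
  "finsler_structure U I \<longleftrightarrow>
     (\<forall>x\<in>U. strictly_convex_closed_hypersurface (I x) \<and> (\<forall>v\<in>I x. - v \<in> I x)) \<and>
     smooth_on (U \<times> (- {0})) (\<lambda>(x, v). finsler_norm I x v)"

subsection \<open>Geodesics and projective flatness\<close>

text \<open>Curves are \<open>C\<^sup>1\<close> maps. The velocity may vanish, so piecewise \<open>C\<^sup>1\<close> curves are covered
  up to reparametrization, which does not affect the length. (The library's
  \<open>piecewise_C1_differentiable_on\<close> puts no bound on the derivative near the exceptional points and
  hence admits curves of infinite length, whose \<open>integral\<close> would be \<open>0\<close>.)\<close>

definition curve_in :: "'a::euclidean_space set \<Rightarrow> real \<Rightarrow> real \<Rightarrow> (real \<Rightarrow> 'a) \<Rightarrow> bool" where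
  "curve_in U a b \<gamma> \<longleftrightarrow> \<gamma> C1_differentiable_on {a..b} \<and> \<gamma> ` {a..b} \<subseteq> U"

definition finsler_length ::
    "('a \<Rightarrow> 'a set) \<Rightarrow> real \<Rightarrow> real \<Rightarrow> (real \<Rightarrow> 'a::euclidean_space) \<Rightarrow> real" where
  "finsler_length I a b \<gamma> =
     integral {a..b} (\<lambda>t. finsler_norm I (\<gamma> t) (vector_derivative \<gamma> (at t)))"

definition finsler_geodesic :: "'a::euclidean_space set \<Rightarrow> ('a \<Rightarrow> 'a set) \<Rightarrow>
    real \<Rightarrow> real \<Rightarrow> (real \<Rightarrow> 'a) \<Rightarrow> bool" where
  "finsler_geodesic U I a b \<gamma> \<longleftrightarrow> a < b \<and> curve_in U a b \<gamma> \<and>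
     (\<forall>\<delta>. curve_in U a b \<delta> \<and> \<delta> a = \<gamma> a \<and> \<delta> b = \<gamma> b \<longrightarrow>
        finsler_length I a b \<gamma> \<le> finsler_length I a b \<delta>)"

definition projectively_flat :: "'a::euclidean_space set \<Rightarrow> ('a \<Rightarrow> 'a set) \<Rightarrow> bool" where
  "projectively_flat U I \<longleftrightarrow>
     (\<forall>a b \<gamma>. finsler_geodesic U I a b \<gamma> \<longrightarrow> (\<exists>p q. \<gamma> ` {a..b} = closed_segment p q))"

subsection \<open>The Finsler reflection law\<close>

text \<open>The direction of the tangent hyperplane of \<open>S\<close> at \<open>v\<close>, as a vector subspace: velocities at
  \<open>v\<close> of curves in \<open>S\<close>.\<close>

definition tangent_directions :: "'a::euclidean_space set \<Rightarrow> 'a \<Rightarrow> 'a set" where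
  "tangent_directions S v =
     {d. \<exists>\<gamma>::real \<Rightarrow> 'a. range \<gamma> \<subseteq> S \<and> \<gamma> 0 = v \<and> (\<gamma> has_vector_derivative d) (at 0)}"

definition legendre :: "('a \<Rightarrow> 'a set) \<Rightarrow> 'a \<Rightarrow> 'a \<Rightarrow> ('a::euclidean_space \<Rightarrow> real)" where
  "legendre I x v = (THE w. linear w \<and> w v = 1 \<and> {d. w d = 0} = tangent_directions (I x) v)"

definition finsler_reflection ::
    "('a \<Rightarrow> 'a set) \<Rightarrow> 'a \<Rightarrow> 'a set \<Rightarrow> 'a \<Rightarrow> 'a::euclidean_space" where
  "finsler_reflection I x H u =
     (if u \<in> H then u
      else (THE v. v \<in> I x \<and> v \<noteq> u \<and> (\<forall>h\<in>H. legendre I x u h - legendre I x v h = 0)))"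

text \<open>Oriented directions are rays, represented by their points on \<open>I x\<close>; hence the positive
  factor \<open>r\<close>. The linear map \<open>A\<close> is uniquely determined by \<open>H\<close> and \<open>N\<close>.\<close>

definition projective_reflection_law :: "'a::euclidean_space set \<Rightarrow> ('a \<Rightarrow> 'a set) \<Rightarrow> bool" where
  "projective_reflection_law U I \<longleftrightarrow>
     (\<forall>x\<in>U. \<forall>H. subspace H \<and> dim H + 1 = DIM('a) \<longrightarrow>
        (\<exists>N. subspace N \<and> dim N = 1 \<and> N \<inter> H = {0} \<and>
          (\<exists>A. linear A \<and> (\<forall>h\<in>H. A h = h) \<and> (\<forall>v\<in>N. A v = - v) \<and>
               (\<forall>u\<in>I x. \<exists>r>0. finsler_reflection I x H u = r *\<^sub>R A u))))"

subsection \<open>Space forms and isometries\<close>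

text \<open>Isometry of \<open>U\<close>, with norms \<open>L x\<close> on its tangent spaces, onto a domain of a submanifold
  \<open>M\<close> (with \<open>dim M = dim U\<close>) of a Euclidean space, with norms \<open>N p\<close> on the tangent spaces
  of \<open>M\<close>. For definite norms \<open>L x\<close>, preservation of norms makes \<open>\<phi>\<close> an immersion, so by the inverse function theorem
  the inverse of the bijection \<open>\<phi>\<close> is automatically smooth.\<close>

definition isometric_to_domain_in :: "'a::euclidean_space set \<Rightarrow> ('a \<Rightarrow> 'a \<Rightarrow> real) \<Rightarrow>
    'b::euclidean_space set \<Rightarrow> ('b \<Rightarrow> 'b \<Rightarrow> real) \<Rightarrow> bool" where
  "isometric_to_domain_in U L M N \<longleftrightarrow>
     (\<exists>D \<phi>. openin (top_of_set M) D \<and> connected D \<and> bij_betw \<phi> U D \<and> smooth_on U \<phi> \<and>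
        (\<forall>x\<in>U. \<forall>v. N (\<phi> x) (frechet_derivative \<phi> (at x) v) = L x v))"

text \<open>Hyperbolic space: the upper sheet of the hyperboloid in Minkowski space \<open>'a \<times> real\<close>, with the
  metric induced by the Lorentz form, which is positive definite on its tangent spaces.\<close>

definition hyperbolic_space :: "('a::euclidean_space \<times> real) set" where
  "hyperbolic_space = {(y, s). s > 0 \<and> y \<bullet> y - s\<^sup>2 = - 1}"

definition lorentz_norm :: "'a::euclidean_space \<times> real \<Rightarrow> real" where
  "lorentz_norm w = sqrt (fst w \<bullet> fst w - (snd w)\<^sup>2)"

end

theory Submission
  imports Defs
begin

text \<open>Fix a tangent space with norm \<open>N\<close>. If the reflection in a hyperplane \<open>H\<close> acts on directions as the
  linear involution \<open>A\<close>, then \<open>dN (A u) - dN u\<close> vanishes on \<open>H\<close>, and integration along \<open>H\<close> gives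
  \<open>N (A u) = N u\<close>. All these involutions preserve the inertia form of the dual unit ball, so they are
  orthogonal for it, and they include all orthogonal reflections. Hence \<open>N\<^sup>2\<close> is a multiple of the inertia
  form, and the Finsler structure is a Riemannian metric \<open>g\<close>.

  Nearby points are joined by a shortest path of the length metric, obtained by iterated midpoints. Since the distance is
  Euclidean up to an error of second order, the parallelogram law bounds the second differences of the
  path by \<open>O(h\<^sup>3\<^sup>/\<^sup>2)\<close>, so it is \<open>C\<^sup>1\<close> and therefore straight by projective flatness. So short
  straight segments are minimizing, and the first variation gives
  \<open>\<partial>\<^sub>h g(v,w) = 2 \<phi>(h) g(v,w) + \<phi>(v) g(h,w) + \<phi>(w) g(h,v)\<close> for a covector field \<open>\<phi>\<close>.

  With \<open>q = \<bar>det g\<bar>\<^sup>-\<^sup>1\<^sup>/\<^sup>(\<^sup>n\<^sup>+\<^sup>1\<^sup>)\<close>, the function \<open>x \<mapsto> g\<^sup>-\<^sup>1\<^sub>x(\<xi>,\<xi>) / q(x)\<close> has derivative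
  \<open>2 \<beta>\<^sub>x(\<xi>) \<xi>(h)\<close> in the direction \<open>h\<close>. It is therefore constant along \<open>ker \<xi>\<close>, hence so is \<open>\<beta>\<^sub>x(\<xi>)\<close>,
  and for \<open>n \<ge> 2\<close> this forces \<open>\<beta>\<close> to be affine, \<open>\<beta>\<^sub>x = \<beta>\<^sub>p + \<gamma> (x - p)\<close>. So \<open>g\<^sup>-\<^sup>1/q\<close> is an explicit quadratic polynomial in \<open>x\<close>.
  Completing the square, it is the metric of a sphere, of a Euclidean space or of a hyperbolic space in
  the coordinates of a central projection, according to the sign of \<open>\<gamma> - \<bar>\<beta>\<^sub>p\<bar>\<^sup>2\<close>.\<close>

subsection \<open>The indicatrix and its Legendre transform\<close>

text \<open>Projective flatness constrains the minimizers that exist but supplies none. No geodesic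
  equation is solved: minimizers are built from the distance alone, so their differentiability has
  to be earned before the hypothesis can be applied to them. The estimates are local, whereas
  competing curves range over all of \<open>U\<close>. A competitor may leave the ball on which
  \<open>L\<close> is comparable to the Euclidean norm, so its length is bounded below only up to
  its first exit. This is why the nested radii \<open>R\<close>, \<open>R/2\<close>,
  \<open>R/4\<close>, \<open>R/8\<close> occur. The exponent \<open>-1/(n+1)\<close> comes from a
  trace: contracting the connection formula gives the logarithm of \<open>det g\<close> the
  derivative \<open>2 (n + 1) \<phi>\<close>, so \<open>q\<close> has logarithmic derivative
  \<open>- 2 \<phi>\<close>, which is what cancels the conformal term in the derivative of the
  inverse metric. Dimension one is treated apart. There \<open>ker \<xi>\<close> is trivial for
  \<open>\<xi> \<noteq> 0\<close>, constancy along it says nothing, and arc length is the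
  isometry.\<close>

locale indicatrix =
  fixes S :: "'a::euclidean_space set" and N :: "'a \<Rightarrow> real"
  assumes hypersurface: "strictly_convex_closed_hypersurface S"
    and symmetric: "v \<in> S \<Longrightarrow> - v \<in> S"
    and N_eq: "N v = (if v = 0 then 0 else THE r. r > 0 \<and> v /\<^sub>R r \<in> S)"
begin

text \<open>The hypothesis only asserts that some convex body is bounded by \<open>S\<close>. By the
  Krein-Milman theorem for the frontier it is the convex hull, so it can be named, and it inherits
  the symmetry of \<open>S\<close> by linearity.\<close>

definition body :: "'a set" where "body = convex hull S"

lemma body: "convex body" "compact body" "interior body \<noteq> {}" "frontier body = S"
proof -
  obtain K where K: "convex K" "compact K" "interior K \<noteq> {}" "S = frontier K"
    using hypersurface unfolding strictly_convex_closed_hypersurface_def by blast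
  have "body = K"
    unfolding body_def using Krein_Milman_frontier[OF K(1,2)] K(4) by simp
  with K show "convex body" "compact body" "interior body \<noteq> {}" "frontier body = S" by auto
qed

lemma interior_notin_S: "v \<in> interior body \<Longrightarrow> v \<notin> S"
  by (metis DiffE body(4) frontier_def)

lemma uminus_body: "v \<in> body \<Longrightarrow> - v \<in> body"
proof -
  have "uminus ` S = S" using symmetric by (metis (no_types, opaque_lifting) imageI image_subsetI minus_minus subsetI subset_antisym)
  moreover have "uminus ` (convex hull S) = convex hull (uminus ` S)"
    by (rule convex_hull_linear_image) (simp add: linear_uminus)
  ultimately show "v \<in> body \<Longrightarrow> - v \<in> body" unfolding body_def by auto
qed

lemma zero_interior: "0 \<in> interior body"
proof -
  obtain z where z: "z \<in> interior body" using body(3) by auto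
  have "uminus ` body = body" using uminus_body by (metis (no_types, opaque_lifting) imageI image_subsetI minus_minus subsetI subset_antisym)
  then have "uminus ` interior body = interior body"
    by (metis interior_injective_linear_image linear_uminus inj_on_def neg_equal_iff_equal)
  then have "- z \<in> interior body" using z by auto
  then have "(1/2) *\<^sub>R z + (1/2) *\<^sub>R (- z) \<in> interior body"
    using z convex_interior[OF body(1)] by (intro convexD) auto
  then show ?thesis by simp
qed

lemma S_subset_body: "S \<subseteq> body"
  unfolding body_def by (rule hull_subset)

lemma zero_notin_S: "0 \<notin> S"
  using zero_interior interior_notin_S by blast

lemma shrink_interior: "v \<in> body \<Longrightarrow> 0 \<le> t \<Longrightarrow> t < 1 \<Longrightarrow> t *\<^sub>R v \<in> interior body"
  using mem_interior_closure_convex_shrink[OF body(1) zero_interior, of v "1 - t"]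
    closure_subset[of body] by (auto simp: algebra_simps)

text \<open>Of two points of \<open>S\<close> on one ray, the nearer would be a strict shrinking of
  the farther towards the interior point 0, hence interior.\<close>

lemma ray_unique:
  assumes "v /\<^sub>R r \<in> S" "v /\<^sub>R r' \<in> S" "r > 0" "r' > 0" shows "r = r'"
proof (rule ccontr)
  have *: False if "v /\<^sub>R r \<in> S" "v /\<^sub>R r' \<in> S" "0 < r" "r < r'" for r r'
  proof -
    have "(r / r') *\<^sub>R (v /\<^sub>R r) \<in> interior body"
      using that S_subset_body by (intro shrink_interior) auto
    moreover have "(r / r') *\<^sub>R (v /\<^sub>R r) = v /\<^sub>R r'" using that by (simp add: field_simps)
    ultimately show False using that interior_notin_S by metis
  qed
  assume "r \<noteq> r'" then show False using *[of r r'] *[of r' r] assms by linarith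
qed

lemma ray_exists:
  assumes "v \<noteq> 0" shows "\<exists>r>0. v /\<^sub>R r \<in> S"
proof -
  obtain d where "0 < d" "0 + d *\<^sub>R v \<in> frontier body"
    using ray_to_frontier[OF compact_imp_bounded[OF body(2)] zero_interior assms] by metis
  then show ?thesis using body(4) by (intro exI[of _ "inverse d"]) auto
qed

lemma N_pos: "v \<noteq> 0 \<Longrightarrow> N v > 0" and N_unit: "v \<noteq> 0 \<Longrightarrow> v /\<^sub>R N v \<in> S"
proof -
  have "N v > 0 \<and> v /\<^sub>R N v \<in> S" if "v \<noteq> 0"
  proof -
    have "\<exists>!r. r > 0 \<and> v /\<^sub>R r \<in> S" using ray_exists[OF that] ray_unique by blast
    from theI'[OF this] show ?thesis using that N_eq by simp
  qed
  then show "v \<noteq> 0 \<Longrightarrow> N v > 0" "v \<noteq> 0 \<Longrightarrow> v /\<^sub>R N v \<in> S" by auto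
qed

lemma N_zero [simp]: "N 0 = 0" by (simp add: N_eq[of 0])

lemma N_nonneg: "N v \<ge> 0" using N_pos[of v] by (cases "v = 0") auto

lemma N_eqI: "r > 0 \<Longrightarrow> v /\<^sub>R r \<in> S \<Longrightarrow> N v = r"
  using ray_unique[where v=v and r="N v" and r'=r] N_pos N_unit zero_notin_S by (cases "v = 0") auto

lemma mem_S_iff: "v \<in> S \<longleftrightarrow> N v = 1"
  using N_eqI[of 1 v] N_unit[of v] by (cases "v = 0") (auto simp: zero_notin_S)

lemma N_scale_pos: "c > 0 \<Longrightarrow> N (c *\<^sub>R v) = c * N v"
proof (cases "v = 0")
  case False
  assume c: "c > 0"
  then have e: "(c *\<^sub>R v) /\<^sub>R (c * N v) = v /\<^sub>R N v" by simp
  show ?thesis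
  proof (rule N_eqI)
    show "c * N v > 0" using c N_pos[OF False] by simp
    show "(c *\<^sub>R v) /\<^sub>R (c * N v) \<in> S" unfolding e by (rule N_unit[OF False])
  qed
qed auto

lemma N_minus: "N (- v) = N v"
proof (cases "v = 0")
  case False
  then show ?thesis using N_pos[OF False] symmetric[OF N_unit[OF False]] by (intro N_eqI) auto
qed auto

lemma N_scale: "N (c *\<^sub>R v) = \<bar>c\<bar> * N v"
  using N_scale_pos[of c v] N_scale_pos[of "-c" v] N_minus[of "c *\<^sub>R v"]
  by (cases "c > 0"; cases "c = 0") auto

lemma N_le_1: "v \<in> body \<Longrightarrow> N v \<le> 1"
proof (rule ccontr)
  assume v: "v \<in> body" and "\<not> N v \<le> 1"
  then have "(1 / N v) *\<^sub>R v \<in> interior body"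
    using N_nonneg by (intro shrink_interior) auto
  moreover have "v /\<^sub>R N v \<in> S" using \<open>\<not> N v \<le> 1\<close> by (intro N_unit) auto
  ultimately show False using interior_notin_S by (simp add: divide_inverse)
qed

lemma N_triangle: "N (u + v) \<le> N u + N v"
proof (cases "u = 0 \<or> v = 0")
  case False
  then have p: "N u > 0" "N v > 0" using N_pos by auto
  have "(N u / (N u + N v)) *\<^sub>R (u /\<^sub>R N u) + (N v / (N u + N v)) *\<^sub>R (v /\<^sub>R N v) \<in> body"
    using False p S_subset_body N_unit
    by (intro convexD[OF body(1)]) (auto simp: field_simps simp flip: add_divide_distrib)
  then have "(1 / (N u + N v)) *\<^sub>R (u + v) \<in> body"
    using p by (simp add: field_simps)
  from N_le_1[OF this] show ?thesis using p by (subst (asm) N_scale_pos) (auto simp: field_simps)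
qed auto

text \<open>Equality would put the midpoint of \<open>u\<close> and \<open>v\<close> on
  \<open>S\<close>, against strict convexity of the hypersurface.\<close>

lemma N_strict: "u \<in> S \<Longrightarrow> v \<in> S \<Longrightarrow> u \<noteq> v \<Longrightarrow> N (u + v) < 2"
proof -
  assume uv: "u \<in> S" "v \<in> S" "u \<noteq> v"
  have "N (u + v) \<noteq> 2"
  proof
    assume "N (u + v) = 2"
    then have "midpoint u v \<in> S" unfolding mem_S_iff midpoint_def by (simp add: N_scale)
    moreover have "midpoint u v \<in> open_segment u v" using uv(3) by simp
    ultimately show False
      using hypersurface uv unfolding strictly_convex_closed_hypersurface_def by blast
  qed
  with N_triangle[of u v] uv show ?thesis by (simp add: mem_S_iff)
qed

lemma compact_S: "compact S"
  using compact_frontier[OF body(2)] body(4) by simp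

end

locale smooth_indicatrix = indicatrix +
  assumes differentiable: "v \<noteq> 0 \<Longrightarrow> N differentiable (at v)"
begin

definition dN :: "'a \<Rightarrow> 'a \<Rightarrow> real" where "dN v = frechet_derivative N (at v)"

lemma has_dN: "v \<noteq> 0 \<Longrightarrow> (N has_derivative dN v) (at v)"
  unfolding dN_def using differentiable frechet_derivative_works by blast

lemma linear_dN: "v \<noteq> 0 \<Longrightarrow> linear (dN v)"
  using has_dN has_derivative_linear by blast

lemma has_dN_line:
  assumes "v + t *\<^sub>R h \<noteq> 0"
  shows "((\<lambda>t. N (v + t *\<^sub>R h)) has_real_derivative dN (v + t *\<^sub>R h) h) (at t)"
proof -
  have "((\<lambda>t. N (v + t *\<^sub>R h)) has_derivative (\<lambda>s. dN (v + t *\<^sub>R h) (s *\<^sub>R h))) (at t)"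
    using has_dN[OF assms] by (rule has_derivative_compose[rotated]) (auto intro!: derivative_eq_intros)
  moreover have "(\<lambda>s. dN (v + t *\<^sub>R h) (s *\<^sub>R h)) = (*) (dN (v + t *\<^sub>R h) h)"
    by (auto simp: fun_eq_iff linear_scale[OF linear_dN[OF assms]])
  ultimately show ?thesis by (simp add: has_field_derivative_def)
qed

lemma dN_self: "v \<noteq> 0 \<Longrightarrow> dN v v = N v"
proof -
  assume v: "v \<noteq> 0"
  have "((\<lambda>t. N (v + t *\<^sub>R v)) has_real_derivative dN v v) (at 0)"
    using has_dN_line[of v 0 v] v by simp
  moreover have "((\<lambda>t. N (v + t *\<^sub>R v)) has_real_derivative N v) (at 0)"
  proof (rule DERIV_cong[OF has_field_derivative_transform_within_open])
    show "((\<lambda>t. (1 + t) * N v) has_real_derivative N v) (at 0)"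
      by (auto intro!: derivative_eq_intros)
    show "open {-1<..<1::real}" by simp
    show "(1 + t) * N v = N (v + t *\<^sub>R v)" if "t \<in> {-1<..<1}" for t
      using N_scale_pos[of "1 + t" v] that by (simp add: algebra_simps)
  qed auto
  ultimately show ?thesis by (rule DERIV_unique)
qed

text \<open>Homogeneity of degree one makes the differential depend on the direction only; this
  absorbs the unknown positive factor in the reflection law.\<close>

lemma dN_scale:
  assumes "c > 0" "v \<noteq> 0" shows "dN (c *\<^sub>R v) = dN v"
proof -
  have "((\<lambda>x. N (c *\<^sub>R x)) has_derivative (\<lambda>h. dN (c *\<^sub>R v) (c *\<^sub>R h))) (at v)"
    using has_dN[of "c *\<^sub>R v"] assms
    by (intro has_derivative_compose[of "\<lambda>x. c *\<^sub>R x" _ _ _ N "dN (c *\<^sub>R v)"]) (auto intro!: derivative_eq_intros)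
  moreover have "((\<lambda>x. N (c *\<^sub>R x)) has_derivative (\<lambda>h. c * dN v h)) (at v)"
    using has_dN[of v] assms by (simp add: N_scale_pos has_derivative_mult_right)
  ultimately have "(\<lambda>h. dN (c *\<^sub>R v) (c *\<^sub>R h)) = (\<lambda>h. c * dN v h)" by (rule has_derivative_unique)
  then show ?thesis using linear_scale[OF linear_dN[of "c *\<^sub>R v"]] assms by (auto simp: fun_eq_iff)
qed

lemma dN_le:
  assumes v: "v \<noteq> 0" shows "dN v u \<le> N u"
proof -
  have *: "((\<lambda>t. N (v + t *\<^sub>R u)) has_real_derivative dN v u) (at 0)"
    using has_dN_line[of v 0 u] v by simp
  then have "((\<lambda>h. (N (v + h *\<^sub>R u) - N v) / h) \<longlongrightarrow> dN v u) (at_right 0)"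
    by (simp add: DERIV_def filterlim_at_split)
  moreover have "\<forall>\<^sub>F h in at_right 0. (N (v + h *\<^sub>R u) - N v) / h \<le> N u"
    unfolding eventually_at_filter
  proof (intro always_eventually allI impI)
    fix h :: real assume h: "h \<in> {0<..}"
    then have "N (v + h *\<^sub>R u) \<le> N v + h * N u" using N_triangle[of v "h *\<^sub>R u"] N_scale_pos[of h u] by auto
    then show "(N (v + h *\<^sub>R u) - N v) / h \<le> N u" using h by (auto simp: field_simps)
  qed
  ultimately show ?thesis by (rule tendsto_upperbound) simp
qed

text \<open>The tangent hyperplane at \<open>v\<close> touches \<open>S\<close> nowhere else: test
  \<open>dN v\<close> on \<open>u + v\<close> and use the strict triangle inequality.\<close>

lemma dN_less: "u \<in> S \<Longrightarrow> v \<in> S \<Longrightarrow> u \<noteq> v \<Longrightarrow> dN v u < 1"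
proof -
  assume uv: "u \<in> S" "v \<in> S" "u \<noteq> v"
  then have v: "v \<noteq> 0" using zero_notin_S by auto
  have "dN v (u + v) < 2" using dN_le[OF v, of "u + v"] N_strict[OF uv] by simp
  then show ?thesis using linear_add[OF linear_dN[OF v]] dN_self[OF v] uv by (simp add: mem_S_iff)
qed

text \<open>\<open>N - w\<close> attains its minimum 0 at \<open>v\<close>, so its differential
  vanishes there. This recognizes a covector as a Legendre transform from inequalities
  alone.\<close>

lemma support_eq_dN:
  assumes w: "linear w" "\<And>y. w y \<le> N y" and v: "v \<in> S" "w v = 1"
  shows "w = dN v"
proof -
  have v0: "v \<noteq> 0" using v zero_notin_S by auto
  have "((\<lambda>y. N y - w y) has_derivative (\<lambda>h. dN v h - w h)) (at v)"
    using has_dN[OF v0] linear_imp_has_derivative[OF w(1)] by (rule has_derivative_diff)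
  then have "(\<lambda>h. dN v h - w h) = (\<lambda>h. 0)"
    using w v by (intro differential_zero_maxmin[of v UNIV "\<lambda>y. N y - w y"]) (auto simp: mem_S_iff)
  then show ?thesis by (auto simp: fun_eq_iff)
qed

lemma tangent_directions_eq:
  assumes v: "v \<in> S" shows "tangent_directions S v = {d. dN v d = 0}"
proof (intro set_eqI iffI)
  have v0: "v \<noteq> 0" using v zero_notin_S by auto
  fix d
  {
    assume "d \<in> tangent_directions S v"
    then obtain c where c: "range c \<subseteq> S" "c 0 = v" "(c has_vector_derivative d) (at (0::real))"
      unfolding tangent_directions_def by blast
    have "((\<lambda>t. N (c t)) has_derivative (\<lambda>t. dN v (t *\<^sub>R d))) (at 0)"
      using c has_dN[OF v0] unfolding has_vector_derivative_def
      by (intro has_derivative_compose[of c _ _ _ N "dN v"]) auto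
    moreover have "(\<lambda>t. N (c t)) = (\<lambda>t. 1)" using c(1) mem_S_iff by (meson ext rangeI subsetD)
    ultimately have "(\<lambda>t. dN v (t *\<^sub>R d)) = (\<lambda>t. 0)"
      by (metis has_derivative_const has_derivative_unique)
    from fun_cong[OF this, of 1] show "d \<in> {d. dN v d = 0}" by simp
  }
  assume "d \<in> {d. dN v d = 0}"
  then have d: "dN v d = 0" by simp
  have nz: "v + t *\<^sub>R d \<noteq> 0" for t
  proof
    assume "v + t *\<^sub>R d = 0"
    then have "dN v (v + t *\<^sub>R d) = 0" using linear_0[OF linear_dN[OF v0]] by simp
    then show False
      using v d dN_self[OF v0] by (simp add: linear_add[OF linear_dN[OF v0]] linear_scale[OF linear_dN[OF v0]] mem_S_iff)
  qed
  \<comment> \<open>The witness is the line \<open>v + t d\<close> projected radially to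
    \<open>S\<close>. As \<open>N\<close> has derivative 0 along \<open>d\<close>, the normalizing
    factor does not change the velocity.\<close>
  have "((\<lambda>t. N (v + t *\<^sub>R d)) has_real_derivative 0) (at 0)"
    using has_dN_line[of v 0 d] v0 d by simp
  then have "((\<lambda>t. inverse (N (v + t *\<^sub>R d))) has_real_derivative 0) (at 0)"
    by (rule DERIV_cong[OF DERIV_inverse_fun]) (use N_pos[OF v0] in auto)
  moreover have "((\<lambda>t. v + t *\<^sub>R d) has_vector_derivative d) (at 0)"
    by (auto intro!: derivative_eq_intros)
  ultimately have "((\<lambda>t. (v + t *\<^sub>R d) /\<^sub>R N (v + t *\<^sub>R d)) has_vector_derivative d) (at 0)"
    using has_vector_derivative_scaleR[of "\<lambda>t. inverse (N (v + t *\<^sub>R d))" 0 0 UNIV "\<lambda>t. v + t *\<^sub>R d" d] v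
    by (simp add: mem_S_iff)
  moreover have "range (\<lambda>t. (v + t *\<^sub>R d) /\<^sub>R N (v + t *\<^sub>R d)) \<subseteq> S" using N_unit[OF nz] by auto
  ultimately show "d \<in> tangent_directions S v"
    unfolding tangent_directions_def using v
    by (intro CollectI exI[of _ "\<lambda>t. (v + t *\<^sub>R d) /\<^sub>R N (v + t *\<^sub>R d)"]) (auto simp: mem_S_iff)
qed

lemma dN_unique:
  assumes v: "v \<in> S" and w: "linear w" "w v = 1" "{d. w d = 0} = tangent_directions S v"
  shows "w = dN v"
proof
  fix h
  have v0: "v \<noteq> 0" using v zero_notin_S by auto
  have "dN v (h - dN v h *\<^sub>R v) = 0"
    using v dN_self[OF v0] by (simp add: linear_diff[OF linear_dN[OF v0]] linear_scale[OF linear_dN[OF v0]] mem_S_iff)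
  then have "w (h - dN v h *\<^sub>R v) = 0" using w(3) tangent_directions_eq[OF v] by auto
  then show "w h = dN v h" using w by (simp add: linear_diff linear_scale)
qed

end

section \<open>Existence and uniqueness of the reflected point\<close>

context smooth_indicatrix begin

lemma dN_inj: "u \<in> S \<Longrightarrow> v \<in> S \<Longrightarrow> dN u = dN v \<Longrightarrow> u = v"
  using dN_less[of u v] dN_self[of u] zero_notin_S by (metis less_irrefl mem_S_iff)

text \<open>On a line of covectors the middle one is a convex combination of the outer two. At
  \<open>v1\<close> it takes the value 1, while both outer ones are below 1 there.\<close>

lemma dN_collinear_False:
  assumes S: "v0 \<in> S" "v1 \<in> S" "v2 \<in> S" and ne: "v0 \<noteq> v1" "v2 \<noteq> v1"
    and eq: "\<And>y. dN v0 y = \<phi> y + s0 * (a \<bullet> y)" "\<And>y. dN v1 y = \<phi> y + s1 * (a \<bullet> y)"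
      "\<And>y. dN v2 y = \<phi> y + s2 * (a \<bullet> y)"
    and s: "s0 < s1" "s1 < s2"
  shows False
proof -
  have "(s2 - s1) * dN v0 v1 + (s1 - s0) * dN v2 v1 = (s2 - s0) * dN v1 v1"
    unfolding eq by (simp add: algebra_simps)
  moreover have "dN v1 v1 = 1" using S dN_self zero_notin_S by (metis mem_S_iff)
  moreover have "dN v0 v1 < 1" "dN v2 v1 < 1" using dN_less S ne by auto
  then have "(s2 - s1) * dN v0 v1 < (s2 - s1) * 1" "(s1 - s0) * dN v2 v1 < (s1 - s0) * 1"
    using s by auto
  ultimately show False by (simp add: algebra_simps)
qed

lemma linear_vanishing_on_hyperplane:
  fixes f :: "'a \<Rightarrow> real"
  assumes "linear f" "\<And>h. a \<bullet> h = 0 \<Longrightarrow> f h = 0" "a \<bullet> u \<noteq> 0"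
  shows "f y = (f u / (a \<bullet> u)) * (a \<bullet> y)"
proof -
  have "a \<bullet> (y - ((a \<bullet> y) / (a \<bullet> u)) *\<^sub>R u) = 0" using assms(3) by (simp add: inner_diff_right)
  from assms(2)[OF this] show ?thesis using assms(1) by (simp add: linear_diff linear_scale)
qed

text \<open>The second point is found on \<open>{y \<in> S. a \<bullet> y > 0}\<close> by minimizing the parameter \<open>s\<close> at which
  \<open>dN u + s a\<close> takes the value \<open>1\<close> at \<open>y\<close>.\<close>

lemma reflected_point_exists:
  assumes u: "u \<in> S" and a: "a \<bullet> u < 0"
  shows "\<exists>v\<in>S. v \<noteq> u \<and> (\<exists>s. \<forall>y. dN v y = dN u y + s * (a \<bullet> y))"
proof -
  have u0: "u \<noteq> 0" using u zero_notin_S by auto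
  note lin = linear_dN[OF u0]
  define r where "r y = (1 - dN u y) / (a \<bullet> y)" for y
  \<comment> \<open>The half \<open>a \<bullet> y > 0\<close> of \<open>S\<close> is not compact.
    \<open>C\<close> is its part with \<open>r y \<le> r (- u)\<close>, written without division so
    that it is closed. It avoids \<open>a \<bullet> y = 0\<close>, where the condition would force
    \<open>dN u y \<ge> 1\<close>, that is \<open>y = u\<close>.\<close>
  define C where "C = S \<inter> {y. 1 - dN u y \<le> r (- u) * (a \<bullet> y)}"
  have cont: "continuous_on X (dN u)" for X
    using lin by (simp add: linear_continuous_on linear_conv_bounded_linear)
  have "closed {y. 1 - dN u y \<le> r (- u) * (a \<bullet> y)}"
    by (intro closed_Collect_le continuous_intros cont)
  then have "compact C" unfolding C_def using compact_S by (rule compact_Int_closed[rotated])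
  have le1: "dN u y \<le> 1" if "y \<in> S" for y using dN_le[OF u0, of y] that by (simp add: mem_S_iff)
  have rpos: "r (- u) > 0"
    using a dN_self[OF u0] u by (simp add: r_def linear_neg[OF lin] mem_S_iff divide_pos_pos divide_pos_neg)
  have pos: "a \<bullet> y > 0" if "y \<in> C" for y
  proof -
    have "0 \<le> r (- u) * (a \<bullet> y)" using that le1[of y] unfolding C_def by auto
    then have "a \<bullet> y \<ge> 0" using rpos by (simp add: zero_le_mult_iff)
    moreover have "a \<bullet> y \<noteq> 0"
    proof
      assume 0: "a \<bullet> y = 0"
      then have "dN u y \<ge> 1" "y \<in> S" using that unfolding C_def by auto
      then have "y = u" using dN_less[of y u] u by fastforce
      then show False using 0 a by simp
    qed
    ultimately show ?thesis by simp
  qed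
  have mu: "- u \<in> C" using symmetric[OF u] a unfolding C_def r_def by (simp add: field_simps)
  have "continuous_on C r" unfolding r_def
    by (intro continuous_intros cont) (use pos in force)
  with \<open>compact C\<close> mu obtain v where v: "v \<in> C" "\<And>y. y \<in> C \<Longrightarrow> r v \<le> r y"
    using continuous_attains_inf[of C r] by auto
  have vS: "v \<in> S" "a \<bullet> v > 0" using v(1) pos unfolding C_def by auto
  have rv: "r v \<ge> 0" using le1[OF vS(1)] vS(2) unfolding r_def by simp
  \<comment> \<open>Minimality of \<open>r v\<close> keeps the covector \<open>dN u + r v a\<close>
    at most 1 on \<open>S\<close>, with value 1 at \<open>v\<close>; so it supports \<open>N\<close>
    at \<open>v\<close> and is the differential there.\<close>
  have "dN u y + r v * (a \<bullet> y) \<le> 1" if y: "y \<in> S" for y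
  proof (cases "a \<bullet> y > 0")
    case True
    have "r v \<le> r y"
    proof (cases "y \<in> C")
      case False
      then have "r (- u) * (a \<bullet> y) < 1 - dN u y" using y unfolding C_def by auto
      then have "r (- u) < r y" using True unfolding r_def by (simp add: field_simps)
      then show ?thesis using v(2)[OF mu] by simp
    qed (use v in auto)
    then have "r v * (a \<bullet> y) \<le> r y * (a \<bullet> y)" using True by simp
    moreover have "r y * (a \<bullet> y) = 1 - dN u y" using True by (simp add: r_def)
    ultimately show ?thesis by linarith
  next
    case False
    then have "r v * (a \<bullet> y) \<le> 0" using rv by (simp add: mult_nonneg_nonpos)
    then show ?thesis using le1[OF y] by simp
  qed note le = this
  define w where "w y = dN u y + r v * (a \<bullet> y)" for y
  have lw: "linear w" unfolding w_def
    by (intro linearI) (auto simp: linear_add[OF lin] linear_scale[OF lin] inner_add_right algebra_simps)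
  have "w y \<le> N y" for y
  proof (cases "y = 0")
    case False
    have "w (y /\<^sub>R N y) \<le> 1" using le[OF N_unit[OF False]] by (simp add: w_def)
    then show ?thesis using N_pos[OF False] by (simp add: linear_scale[OF lw] field_simps)
  qed (use linear_0[OF lw] in simp)
  moreover have "w v = 1" using vS(2) by (simp add: w_def r_def)
  ultimately have "w = dN v" using support_eq_dN[OF lw _ vS(1)] by simp
  then show ?thesis using vS a by (intro bexI[of _ v]) (auto simp: w_def fun_eq_iff intro!: exI[of _ "r v"])
qed

lemma reflected_point_exists':
  assumes u: "u \<in> S" and a: "a \<bullet> u \<noteq> 0"
  shows "\<exists>v\<in>S. v \<noteq> u \<and> (\<exists>s. \<forall>y. dN v y = dN u y + s * (a \<bullet> y))"
proof (cases "a \<bullet> u < 0")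
  case False
  then have "(- a) \<bullet> u < 0" using a by simp
  from reflected_point_exists[OF u this] obtain v s where
    "v \<in> S" "v \<noteq> u" "\<And>y. dN v y = dN u y + s * (- a \<bullet> y)" by blast
  then show ?thesis by (intro bexI[of _ v] conjI exI[of _ "-s"]) auto
qed (use reflected_point_exists[OF u] in auto)

text \<open>The covectors of \<open>u\<close>, \<open>v\<close>, \<open>v'\<close> lie on one line
  at the parameters 0, \<open>s\<close>, \<open>s'\<close>. If these are distinct, one lies between
  the other two; the six cases are the six orders.\<close>

lemma reflected_point_unique:
  assumes u: "u \<in> S" and v: "v \<in> S" "v \<noteq> u" "\<And>y. dN v y = dN u y + s * (a \<bullet> y)"
    and v': "v' \<in> S" "v' \<noteq> u" "\<And>y. dN v' y = dN u y + s' * (a \<bullet> y)"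
  shows "v' = v"
proof (rule ccontr)
  assume ne: "v' \<noteq> v"
  have s: "s \<noteq> 0" "s' \<noteq> 0" "s \<noteq> s'"
    using dN_inj[of v u] dN_inj[of v' u] dN_inj[of v v'] u v v' ne by (auto simp: fun_eq_iff)
  have u': "dN u y = dN u y + 0 * (a \<bullet> y)" for y by simp
  consider "0 < s" "s < s'" | "0 < s'" "s' < s" | "s < 0" "0 < s'" | "s' < 0" "0 < s"
    | "s < s'" "s' < 0" | "s' < s" "s < 0" using s by linarith
  then show False
  proof cases
    case 1 show ?thesis using dN_collinear_False[OF u v(1) v'(1) _ _ u' v(3) v'(3)] 1 v v' ne by blast
  next
    case 2 show ?thesis using dN_collinear_False[OF u v'(1) v(1) _ _ u' v'(3) v(3)] 2 v v' ne by blast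
  next
    case 3 show ?thesis using dN_collinear_False[OF v(1) u v'(1) _ _ v(3) u' v'(3)] 3 v v' ne by blast
  next
    case 4 show ?thesis using dN_collinear_False[OF v'(1) u v(1) _ _ v'(3) u' v(3)] 4 v v' ne by blast
  next
    case 5 show ?thesis using dN_collinear_False[OF v(1) v'(1) u _ _ v(3) v'(3) u'] 5 v v' ne by blast
  next
    case 6 show ?thesis using dN_collinear_False[OF v'(1) v(1) u _ _ v'(3) v(3) u'] 6 v v' ne by blast
  qed
qed

end

section \<open>Linear reflections that preserve the norm\<close>

definition linear_reflection :: "'a::euclidean_space \<Rightarrow> 'a \<Rightarrow> 'a \<Rightarrow> 'a" where
  "linear_reflection a n x = x - (2 * (a \<bullet> x) / (a \<bullet> n)) *\<^sub>R n"

lemma linear_reflection_unique: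
  fixes A :: "'a::euclidean_space \<Rightarrow> 'a"
  assumes A: "linear A" "\<And>h. a \<bullet> h = 0 \<Longrightarrow> A h = h" "A n = - n" and an: "a \<bullet> n \<noteq> 0"
  shows "A = linear_reflection a n"
proof
  fix x
  define t where "t = (a \<bullet> x) / (a \<bullet> n)"
  have "a \<bullet> (x - t *\<^sub>R n) = 0" using an by (simp add: t_def inner_diff_right)
  from A(2)[OF this] have "A x - t *\<^sub>R A n = x - t *\<^sub>R n"
    using A(1) by (simp add: linear_diff linear_scale)
  then have "A x = x - (2 * t) *\<^sub>R n" using A(3) by (simp add: algebra_simps scaleR_2[symmetric])
  then show "A x = linear_reflection a n x" by (simp add: linear_reflection_def t_def)
qed

lemma finsler_norm_reflection:
  fixes I :: "'a::euclidean_space \<Rightarrow> 'a set"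
  assumes ind: "smooth_indicatrix (I x) (finsler_norm I x)"
    and a: "a \<noteq> 0"
    and refl: "\<forall>H. subspace H \<and> dim H + 1 = DIM('a) \<longrightarrow>
        (\<exists>N. subspace N \<and> dim N = 1 \<and> N \<inter> H = {0} \<and>
          (\<exists>A. linear A \<and> (\<forall>h\<in>H. A h = h) \<and> (\<forall>v\<in>N. A v = - v) \<and>
               (\<forall>u\<in>I x. \<exists>r>0. finsler_reflection I x H u = r *\<^sub>R A u)))"
  shows "\<exists>n. a \<bullet> n \<noteq> 0 \<and> (\<forall>u. finsler_norm I x (linear_reflection a n u) = finsler_norm I x u)"
proof -
  interpret smooth_indicatrix "I x" "finsler_norm I x" by (rule ind)
  define H where "H = {x. a \<bullet> x = 0}"
  have "subspace H" "dim H + 1 = DIM('a)"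
    using a by (auto simp: H_def subspace_hyperplane dim_hyperplane)
  then obtain M where M: "subspace M" "dim M = 1" "M \<inter> H = {0}" and
    "\<exists>A. linear A \<and> (\<forall>h\<in>H. A h = h) \<and> (\<forall>v\<in>M. A v = - v) \<and>
      (\<forall>u\<in>I x. \<exists>r>0. finsler_reflection I x H u = r *\<^sub>R A u)"
    using refl[rule_format, of H] by auto
  then obtain A where
    A: "linear A" "\<And>h. h \<in> H \<Longrightarrow> A h = h" "\<And>v. v \<in> M \<Longrightarrow> A v = - v"
      "\<And>u. u \<in> I x \<Longrightarrow> \<exists>r>0. finsler_reflection I x H u = r *\<^sub>R A u"
    by auto
  have "M \<noteq> {0}" using M(2) by (metis dim_empty dim_span span_empty zero_neq_one)
  then obtain n where n: "n \<in> M" "n \<noteq> 0" using subspace_0[OF M(1)] by blast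
  then have an: "a \<bullet> n \<noteq> 0" using M(3) unfolding H_def by blast
  have leg: "legendre I x v = dN v" if "v \<in> I x" for v
    unfolding legendre_def
  proof (rule the_equality)
    have "v \<noteq> 0" using that zero_notin_S by auto
    then show "linear (dN v) \<and> dN v v = 1 \<and> {d. dN v d = 0} = tangent_directions (I x) v"
      using linear_dN dN_self tangent_directions_eq that by (auto simp: mem_S_iff)
  qed (use dN_unique that in auto)
  have key: "dN (A u) h = dN u h" "A u \<noteq> 0" if u: "a \<bullet> u \<noteq> 0" "a \<bullet> h = 0" for u h
  proof -
    have u0: "u \<noteq> 0" using u by auto
    define u' where "u' = u /\<^sub>R finsler_norm I x u"
    have u': "u' \<in> I x" "a \<bullet> u' \<noteq> 0" using N_unit[OF u0] N_pos[OF u0] u by (auto simp: u'_def)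
    have nz: "u' \<noteq> 0" using u' by auto
    \<comment> \<open>Covectors that agree on \<open>H\<close> differ by a multiple of
      \<open>a\<close>, so the description inside \<open>finsler_reflection\<close> matches the form
      for which existence and uniqueness are known.\<close>
    have char: "(\<forall>h\<in>H. legendre I x u' h - legendre I x v h = 0) \<longleftrightarrow> (\<exists>s. \<forall>y. dN v y = dN u' y + s * (a \<bullet> y))"
      if v: "v \<in> I x" for v
    proof
      have v0: "v \<noteq> 0" using v zero_notin_S by auto
      assume "\<forall>h\<in>H. legendre I x u' h - legendre I x v h = 0"
      then have "\<And>h. a \<bullet> h = 0 \<Longrightarrow> dN v h - dN u' h = 0" using leg[OF v] leg[OF u'(1)] by (simp add: H_def)
      then have "\<exists>s. \<forall>y. dN v y - dN u' y = s * (a \<bullet> y)"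
        using linear_vanishing_on_hyperplane[of "\<lambda>y. dN v y - dN u' y" a u'] u'(2)
          linear_compose_sub[OF linear_dN[OF v0] linear_dN[OF nz]] by blast
      then show "\<exists>s. \<forall>y. dN v y = dN u' y + s * (a \<bullet> y)" by (metis add.commute diff_add_cancel)
    next
      assume "\<exists>s. \<forall>y. dN v y = dN u' y + s * (a \<bullet> y)"
      then show "\<forall>h\<in>H. legendre I x u' h - legendre I x v h = 0"
        using leg[OF v] leg[OF u'(1)] by (auto simp: H_def)
    qed
    obtain v s where v: "v \<in> I x" "v \<noteq> u'" "\<And>y. dN v y = dN u' y + s * (a \<bullet> y)"
      using reflected_point_exists'[OF u'] by blast
    have "finsler_reflection I x H u' = (THE v. v \<in> I x \<and> v \<noteq> u' \<and> (\<forall>h\<in>H. legendre I x u' h - legendre I x v h = 0))"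
      using u' by (simp add: finsler_reflection_def H_def)
    also have "\<dots> = v"
      using v char reflected_point_unique[OF u'(1) v] by (intro the_equality) blast+
    finally obtain r where r: "r > 0" "v = r *\<^sub>R A u'" using A(4)[OF u'(1)] by metis
    have v0: "v \<noteq> 0" using v zero_notin_S by auto
    have Au: "v = (r / finsler_norm I x u) *\<^sub>R A u"
      using r A(1) by (simp add: u'_def linear_scale divide_inverse)
    then show "A u \<noteq> 0" using v0 by auto
    then have "dN v = dN (A u)" using Au r N_pos[OF u0] dN_scale[of "r / finsler_norm I x u" "A u"] by simp
    moreover have "dN u' = dN u" using u0 N_pos[OF u0] dN_scale[of "inverse (finsler_norm I x u)" u] by (simp add: u'_def)
    ultimately show "dN (A u) h = dN u h" using v(3)[of h] u by simp
  qed
  have AN: "finsler_norm I x (A u) = finsler_norm I x u" for u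
  proof (cases "a \<bullet> u = 0")
    case False
    \<comment> \<open>Split \<open>u = m + h\<close> with \<open>m\<close> parallel to
      \<open>n\<close> and \<open>h\<close> in \<open>H\<close>. At \<open>t = 0\<close> the two
      points are \<open>- m\<close> and \<open>m\<close>, where \<open>N\<close> agrees by central
      symmetry: this is the initial value for the integration along \<open>H\<close>.\<close>
    define m where "m = ((a \<bullet> u) / (a \<bullet> n)) *\<^sub>R n"
    define h where "h = u - m"
    have h: "a \<bullet> h = 0" using an by (simp add: h_def m_def inner_diff_right)
    have am: "a \<bullet> (m + t *\<^sub>R h) \<noteq> 0" for t using False an h by (simp add: m_def inner_add_right)
    have Am: "A m = - m" using A(3) n M(1) by (simp add: m_def subspace_scale)
    have Amt: "A (m + t *\<^sub>R h) = - m + t *\<^sub>R h" for t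
      using A(1) A(2)[of h] h Am by (simp add: linear_add linear_scale H_def)
    define D where "D t = finsler_norm I x (- m + t *\<^sub>R h) - finsler_norm I x (m + t *\<^sub>R h)" for t
    have "(D has_real_derivative 0) (at t)" for t
    proof -
      have "m + t *\<^sub>R h \<noteq> 0" using am[of t] by force
      moreover have "- m + t *\<^sub>R h \<noteq> 0" using key(2)[OF am[of t] h] Amt by metis
      ultimately have "(D has_real_derivative dN (- m + t *\<^sub>R h) h - dN (m + t *\<^sub>R h) h) (at t)"
        unfolding D_def by (intro DERIV_diff has_dN_line)
      then show ?thesis using key(1)[OF am[of t] h] Amt[of t] by simp
    qed
    then have "D 1 = D 0" using DERIV_const_ratio_const2 DERIV_isconst_all by blast
    then show ?thesis using N_minus[of m] Amt[of 1] by (simp add: D_def h_def)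
  qed (use A(2) in \<open>simp add: H_def\<close>)
  have "A = linear_reflection a n"
    using A n an by (intro linear_reflection_unique) (auto simp: H_def)
  with AN an show ?thesis by blast
qed

subsection \<open>Indicatrices with projective reflections are ellipsoids\<close>

lemma nn_integral_lborel_translate:
  fixes f :: "'a::euclidean_space \<Rightarrow> ennreal"
  assumes [measurable]: "f \<in> borel_measurable borel"
  shows "(\<integral>\<^sup>+x. f (x + c) \<partial>lborel) = (\<integral>\<^sup>+x. f x \<partial>lborel)"
proof -
  have "(\<integral>\<^sup>+x. f x \<partial>lborel) = (\<integral>\<^sup>+x. f x \<partial>distr lborel borel ((+) c))"
    by (simp add: lborel_distr_plus)
  also have "\<dots> = (\<integral>\<^sup>+x. f (c + x) \<partial>lborel)" by (rule nn_integral_distr) auto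
  finally show ?thesis by (simp add: add.commute)
qed

text \<open>The uniqueness argument for Haar measure, applied to Lebesgue measure and its image under \<open>A\<close>;
  \<open>C\<close> is chosen to have the same measure for both.\<close>

lemma lborel_distr_linear_involution:
  fixes A :: "'a::euclidean_space \<Rightarrow> 'a"
  assumes A: "linear A" "\<And>x. A (A x) = x"
  shows "distr lborel borel A = lborel"
proof (rule measure_eqI)
  have contA: "continuous_on X A" for X using A(1) by (simp add: linear_continuous_on linear_conv_bounded_linear)
  have mA [measurable]: "A \<in> borel_measurable borel"
    by (rule borel_measurable_continuous_onI[OF contA])
  fix E assume "E \<in> sets (distr lborel borel A)"
  then have [measurable]: "E \<in> sets borel" by simp
  \<comment> \<open>The preimage makes \<open>C\<close> invariant under \<open>A\<close>, the
    centred balls make it invariant under negation. The second symmetry turns \<open>y - A x\<close>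
    into \<open>A x - y\<close> once the order of integration is exchanged.\<close>
  define C where "C = ball 0 1 \<inter> A -` ball 0 1"
  have Copen: "open C" unfolding C_def by (intro open_Int open_ball open_vimage contA)
  then have [measurable]: "C \<in> sets borel" by simp
  have C_A: "A x \<in> C \<longleftrightarrow> x \<in> C" for x using A by (auto simp: C_def)
  have C_minus: "- x \<in> C \<longleftrightarrow> x \<in> C" for x using linear_neg[OF A(1)] by (auto simp: C_def)
  have trA: "(\<integral>\<^sup>+x. f (A x + y) \<partial>lborel) = (\<integral>\<^sup>+x. f (A x) \<partial>lborel)"
    if [measurable]: "f \<in> borel_measurable borel" for f :: "'a \<Rightarrow> ennreal" and y
    using nn_integral_lborel_translate[of "\<lambda>x. f (A x)" "A y"] A by (simp add: linear_add)
  define e where "e = emeasure lborel C"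
  have e: "e \<noteq> 0" "e < \<infinity>"
  proof -
    have "0 \<in> C" using linear_0[OF A(1)] by (simp add: C_def)
    then have "\<not> negligible C" using open_not_negligible[OF Copen] by auto
    then have "C \<notin> null_sets lborel" using negligible_iff_null_sets null_sets_completionI by blast
    then show "e \<noteq> 0" unfolding e_def by auto
    have "e \<le> emeasure lborel (ball (0::'a) 1)" unfolding e_def C_def by (intro emeasure_mono) auto
    also have "\<dots> < \<infinity>" using emeasure_lborel_ball_finite by simp
    finally show "e < \<infinity>" .
  qed
  have eC: "(\<integral>\<^sup>+x. indicator C (A x) \<partial>lborel) = e"
  proof -
    have "(\<integral>\<^sup>+x. indicator C (A x) \<partial>lborel) = (\<integral>\<^sup>+x. indicator C x \<partial>lborel)"
      using C_A by (intro nn_integral_cong) (auto simp: indicator_def)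
    then show ?thesis by (simp add: e_def)
  qed
  have eE: "emeasure (distr lborel borel A) E = (\<integral>\<^sup>+x. indicator E (A x) \<partial>lborel)"
    by (subst nn_integral_indicator[symmetric], simp, subst nn_integral_distr) auto
  have "emeasure (distr lborel borel A) E * e = (\<integral>\<^sup>+y. indicator C y * (\<integral>\<^sup>+x. indicator E (A x + y) \<partial>lborel) \<partial>lborel)"
    unfolding eE e_def by (subst trA) (auto simp: nn_integral_multc mult.commute)
  also have "\<dots> = (\<integral>\<^sup>+y. (\<integral>\<^sup>+x. indicator C y * indicator E (A x + y) \<partial>lborel) \<partial>lborel)"
    by (intro nn_integral_cong nn_integral_cmult[symmetric]) measurable
  also have "\<dots> = (\<integral>\<^sup>+x. (\<integral>\<^sup>+y. indicator C y * indicator E (A x + y) \<partial>lborel) \<partial>lborel)"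
    by (rule lborel_pair.Fubini') measurable
  also have "\<dots> = (\<integral>\<^sup>+x. (\<integral>\<^sup>+y. indicator C (y - A x) * indicator E y \<partial>lborel) \<partial>lborel)"
  proof (rule nn_integral_cong)
    fix x
    show "(\<integral>\<^sup>+y. indicator C y * indicator E (A x + y) \<partial>lborel) = (\<integral>\<^sup>+y. indicator C (y - A x) * indicator E y \<partial>lborel)"
      using nn_integral_lborel_translate[of "\<lambda>y. indicator C (y - A x) * indicator E y" "A x"]
      by (simp add: add.commute)
  qed
  also have "\<dots> = (\<integral>\<^sup>+y. (\<integral>\<^sup>+x. indicator C (y - A x) * indicator E y \<partial>lborel) \<partial>lborel)"
    by (rule lborel_pair.Fubini'[symmetric]) measurable
  also have "\<dots> = (\<integral>\<^sup>+y. (\<integral>\<^sup>+x. indicator C (A x + (- y)) \<partial>lborel) * indicator E y \<partial>lborel)"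
  proof (rule nn_integral_cong)
    fix y
    have "indicator C (y - A x) = (indicator C (A x + (- y)) :: ennreal)" for x
      using C_minus[of "y - A x"] by (auto simp: indicator_def)
    then show "(\<integral>\<^sup>+x. indicator C (y - A x) * indicator E y \<partial>lborel) = (\<integral>\<^sup>+x. indicator C (A x + (- y)) \<partial>lborel) * indicator E y"
      by (simp add: nn_integral_multc)
  qed
  also have "\<dots> = e * emeasure lborel E"
    by (subst trA) (auto simp: eC nn_integral_cmult)
  finally show "emeasure (distr lborel borel A) E = emeasure lborel E"
    using e ennreal_mult_cancel_left[of e "emeasure (distr lborel borel A) E" "emeasure lborel E"]
    by (auto simp: mult.commute)
qed simp

lemma linear_reflection_props:
  assumes "a \<bullet> n \<noteq> 0"
  shows "linear (linear_reflection a n)" "linear_reflection a n (linear_reflection a n x) = x"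
    "linear_reflection a n n = - n" "a \<bullet> h = 0 \<Longrightarrow> linear_reflection a n h = h"
    "linear_reflection a n x \<bullet> y = x \<bullet> linear_reflection n a y"
  using assms
  by (auto simp: linear_reflection_def inner_commute inner_diff_right inner_diff_left algebra_simps
      add_divide_distrib scaleR_2[symmetric] intro!: linearI simp flip: scaleR_add_left)

context indicatrix begin

lemma N_bounds: obtains m M where "m > 0" "M > 0" "\<And>v. m * norm v \<le> N v" "\<And>v. N v \<le> M * norm v"
proof -
  obtain b :: 'a where b: "b \<in> Basis" by fastforce
  then have ne: "S \<noteq> {}" using N_unit[of b] by (metis empty_iff nonzero_Basis)
  have c: "continuous_on S norm" by (intro continuous_intros)
  obtain p where p: "p \<in> S" "\<And>y. y \<in> S \<Longrightarrow> norm p \<le> norm y"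
    using continuous_attains_inf[OF compact_S ne c] by auto
  obtain r where r: "r \<in> S" "\<And>y. y \<in> S \<Longrightarrow> norm y \<le> norm r"
    using continuous_attains_sup[OF compact_S ne c] by auto
  have pr: "norm p > 0" "norm r > 0" using p(1) r(1) zero_notin_S by (metis zero_less_norm_iff)+
  show thesis
  proof (rule that[of "1 / norm r" "1 / norm p"])
    fix v
    show "1 / norm r * norm v \<le> N v"
    proof (cases "v = 0")
      case False
      from r(2)[OF N_unit[OF False]] show ?thesis using N_pos[OF False] pr by (simp add: field_simps)
    qed auto
    show "N v \<le> 1 / norm p * norm v"
    proof (cases "v = 0")
      case False
      from p(2)[OF N_unit[OF False]] show ?thesis using N_pos[OF False] pr by (simp add: field_simps)
    qed auto
  qed (use pr in auto)
qed

text \<open>The unit ball of the dual norm, with covectors represented through the Euclidean inner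
  product.\<close>

definition polar :: "'a set" where "polar = {\<xi>. \<forall>y. \<xi> \<bullet> y \<le> N y}"

text \<open>Second moments of the dual ball rather than of the body: averaging products of covectors
  gives a bilinear form on tangent vectors, whereas moments of the body would give one on
  covectors.\<close>

definition inertia :: "'a \<Rightarrow> 'a \<Rightarrow> real" where
  "inertia v w = (\<integral>\<xi>. indicator polar \<xi> *\<^sub>R ((\<xi> \<bullet> v) * (\<xi> \<bullet> w)) \<partial>lborel)"

lemma compact_polar: "compact polar"
proof -
  obtain m M where M: "M > 0" "\<And>v. N v \<le> M * norm v" using N_bounds by metis
  have "closed polar" unfolding polar_def by (intro closed_Collect_all closed_Collect_le continuous_intros)
  moreover have "norm \<xi> \<le> M" if "\<xi> \<in> polar" for \<xi>
  proof -
    have "norm \<xi> * norm \<xi> \<le> M * norm \<xi>"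
      using that M(2)[of \<xi>] unfolding polar_def by (auto simp: power2_norm_eq_inner[symmetric] power2_eq_square dest!: spec[of _ \<xi>])
    then show ?thesis using M(1) by (cases "\<xi> = 0") auto
  qed
  then have "bounded polar" by (auto simp: bounded_iff)
  ultimately show ?thesis by (simp add: compact_eq_bounded_closed)
qed

lemma inertia_integrable: "integrable lborel (\<lambda>\<xi>. indicator polar \<xi> *\<^sub>R ((\<xi> \<bullet> v) * (\<xi> \<bullet> w)))"
  by (rule borel_integrable_compact[OF compact_polar]) (intro continuous_intros)

lemma inertia_sym: "inertia v w = inertia w v"
  unfolding inertia_def by (simp add: mult.commute)

lemma inertia_linear: "linear (inertia v)"
proof (rule linearI)
  fix x y
  show "inertia v (x + y) = inertia v x + inertia v y" unfolding inertia_def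
    by (subst Bochner_Integration.integral_add[symmetric]) (auto intro!: inertia_integrable simp: inner_add_right algebra_simps simp del: real_scaleR_def simp flip: scaleR_add_right)
next
  fix c x
  have "(\<lambda>\<xi>. indicator polar \<xi> *\<^sub>R ((\<xi> \<bullet> v) * (\<xi> \<bullet> (c *\<^sub>R x)))) = (\<lambda>\<xi>. c * (indicator polar \<xi> *\<^sub>R ((\<xi> \<bullet> v) * (\<xi> \<bullet> x))))"
    by (auto simp: fun_eq_iff)
  then show "inertia v (c *\<^sub>R x) = c *\<^sub>R inertia v x" unfolding inertia_def by simp
qed

lemma inertia_bilinear: "bilinear inertia"
  using inertia_linear inertia_sym unfolding bilinear_def by (metis (no_types, lifting) ext)

text \<open>The dual ball contains a Euclidean ball of radius \<open>m\<close>. A vanishing integral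
  would turn the nonempty open part of that ball off the hyperplane
  \<open>\<xi> \<bullet> v = 0\<close> into a null set.\<close>

lemma inertia_pos: assumes "v \<noteq> 0" shows "inertia v v > 0"
proof -
  obtain m M where m: "m > 0" "\<And>v. m * norm v \<le> N v" using N_bounds by metis
  let ?f = "\<lambda>\<xi>. indicator polar \<xi> *\<^sub>R ((\<xi> \<bullet> v) * (\<xi> \<bullet> v))"
  have nonneg: "AE \<xi> in lborel. 0 \<le> ?f \<xi>" by (auto simp: indicator_def)
  then have "inertia v v \<ge> 0" unfolding inertia_def by (intro integral_nonneg_AE) 
  moreover have "inertia v v \<noteq> 0"
  proof
    assume "inertia v v = 0"
    then have "AE \<xi> in lborel. ?f \<xi> = 0"
      using integral_nonneg_eq_0_iff_AE[OF inertia_integrable nonneg] unfolding inertia_def by blast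
    moreover define W where "W = ball 0 m \<inter> {\<xi>. \<xi> \<bullet> v \<noteq> 0}"
    have "\<xi> \<in> polar" if "\<xi> \<in> W" for \<xi>
      unfolding polar_def
    proof (intro CollectI allI)
      fix y
      have "\<xi> \<bullet> y \<le> norm \<xi> * norm y" by (rule norm_cauchy_schwarz)
      also have "\<dots> \<le> m * norm y" using that by (intro mult_right_mono) (auto simp: W_def)
      finally show "\<xi> \<bullet> y \<le> N y" using m(2)[of y] by linarith
    qed
    ultimately have "AE \<xi> in lborel. \<xi> \<notin> W" by (auto simp: W_def indicator_def split: if_splits elim!: AE_mp)
    moreover have W: "open W" unfolding W_def
      by (intro open_Int open_ball open_Collect_neq continuous_intros)
    ultimately have "W \<in> null_sets lborel" using AE_iff_null_sets[of W lborel] by simp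
    then have "negligible W" using negligible_iff_null_sets null_sets_completionI by blast
    moreover have "(m / (2 * norm v)) *\<^sub>R v \<in> W" using assms m(1) by (simp add: W_def)
    ultimately show False using open_not_negligible[OF W] by blast
  qed
  ultimately show ?thesis by simp
qed

text \<open>Substitute the transpose: \<open>linear_reflection n a\<close> is adjoint to
  \<open>linear_reflection a n\<close>, hence preserves \<open>polar\<close>, and as a linear
  involution it preserves Lebesgue measure.\<close>

lemma inertia_invariant:
  assumes n: "a \<bullet> n \<noteq> 0" and inv: "\<And>u. N (linear_reflection a n u) = N u"
  shows "inertia (linear_reflection a n v) (linear_reflection a n w) = inertia v w"
proof -
  let ?A = "linear_reflection a n" and ?B = "linear_reflection n a"
  have n': "n \<bullet> a \<noteq> 0" using n by (simp add: inner_commute)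
  note A = linear_reflection_props[OF n] and B = linear_reflection_props[OF n']
  have polar_B: "?B \<xi> \<in> polar \<longleftrightarrow> \<xi> \<in> polar" for \<xi>
    unfolding polar_def mem_Collect_eq B(5) by (metis A(2) inv)
  have mB [measurable]: "?B \<in> borel_measurable borel"
    using B(1) by (intro borel_measurable_continuous_onI linear_continuous_on) (simp add: linear_conv_bounded_linear)
  have [measurable]: "polar \<in> sets borel" using compact_polar by (simp add: borel_compact)
  let ?f = "\<lambda>\<xi>. indicator polar \<xi> *\<^sub>R ((\<xi> \<bullet> v) * (\<xi> \<bullet> w))"
  have "inertia v w = (\<integral>\<xi>. ?f \<xi> \<partial>distr lborel borel ?B)"
    unfolding inertia_def using lborel_distr_linear_involution[OF B(1,2)] by simp
  also have "\<dots> = (\<integral>\<xi>. ?f (?B \<xi>) \<partial>lborel)"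
    by (intro integral_distr) measurable
  also have "\<dots> = inertia (?A v) (?A w)"
    unfolding inertia_def using polar_B by (simp add: B(5) indicator_def)
  finally show ?thesis ..
qed

text \<open>The reflections act transitively on the spheres of \<open>inertia\<close>: if
  \<open>u\<close> and \<open>v\<close> have equal inertia, the one in the orthogonal complement of
  \<open>u - v\<close> exchanges them. So \<open>N\<close> depends on \<open>inertia v v\<close>
  only, and homogeneity determines how.\<close>

lemma N_quadratic:
  assumes refl: "\<And>a. a \<noteq> 0 \<Longrightarrow> \<exists>n. a \<bullet> n \<noteq> 0 \<and> (\<forall>u. N (linear_reflection a n u) = N u)"
  shows "\<exists>c>0. \<forall>v. (N v)\<^sup>2 = c * inertia v v"
proof -
  note lin = inertia_linear and bil = inertia_bilinear
  have eq: "N u = N v" if uv: "inertia u u = inertia v v" for u v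
  proof (cases "u = v")
    case False
    define a where "a = (\<Sum>i\<in>Basis. inertia (u - v) i *\<^sub>R i)"
    have a: "a \<bullet> x = inertia (u - v) x" for x
    proof -
      have "inertia (u - v) x = inertia (u - v) (\<Sum>i\<in>Basis. (x \<bullet> i) *\<^sub>R i)" by (simp add: euclidean_representation)
      also have "\<dots> = a \<bullet> x"
        by (simp add: a_def linear_sum[OF lin] linear_scale[OF lin] inner_sum_left inner_commute[of x] mult.commute)
      finally show ?thesis ..
    qed
    have "a \<bullet> (u - v) \<noteq> 0" using False inertia_pos[of "u - v"] by (simp add: a)
    then have "a \<noteq> 0" by auto
    then obtain n where n: "a \<bullet> n \<noteq> 0" "\<And>u. N (linear_reflection a n u) = N u" using refl by blast
    let ?A = "linear_reflection a n"
    note A = linear_reflection_props[OF n(1)]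
    define t where "t = (a \<bullet> (u - v)) / (a \<bullet> n)"
    \<comment> \<open>The direction \<open>n\<close> is given by the law and not known to be
      orthogonal. Invariance makes \<open>n\<close> orthogonal to \<open>ker a\<close>, the choice
      of \<open>a\<close> does the same for \<open>u - v\<close>; hence \<open>h\<close>, a
      combination of both lying in \<open>ker a\<close>, is orthogonal to itself.\<close>
    define h where "h = (u - v) - t *\<^sub>R n"
    have h: "a \<bullet> h = 0" using n(1) by (simp add: h_def t_def inner_diff_right)
    have "inertia n h = inertia (?A n) (?A h)" using inertia_invariant[OF n] by simp
    also have "\<dots> = - inertia n h" using A(3) A(4)[OF h] by (simp add: bilinear_lneg[OF bil])
    finally have "inertia n h = 0" by simp
    moreover have "inertia (u - v) h = 0" using h a by simp
    ultimately have "inertia h h = 0"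
      by (simp add: h_def bilinear_lsub[OF bil] bilinear_lmul[OF bil])
    then have h0: "h = 0" using inertia_pos[of h] by fastforce
    then have uvn: "u - v = t *\<^sub>R n" by (simp add: h_def)
    have "a \<bullet> (u + v) = 0"
      using uv inertia_sym[of u v] by (simp add: a bilinear_lsub[OF bil] bilinear_radd[OF bil])
    then have 1: "?A (u + v) = u + v" by (rule A(4))
    have 2: "?A (u - v) = - (u - v)" unfolding uvn using A(1,3) by (simp add: linear_scale)
    have "?A (2 *\<^sub>R u) = ?A (u + v) + ?A (u - v)"
      by (subst linear_add[OF A(1), symmetric]) (simp add: scaleR_2)
    also have "\<dots> = 2 *\<^sub>R v" unfolding 1 2 by (simp add: scaleR_2)
    finally have "?A u = v" using A(1) by (simp add: linear_scale)
    then show ?thesis using n(2)[of u] by simp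
  qed auto
  obtain b :: 'a where b: "b \<in> Basis" by fastforce
  then have b0: "b \<noteq> 0" by auto
  define c where "c = (N b)\<^sup>2 / inertia b b"
  have "c > 0" using N_pos[OF b0] inertia_pos[OF b0] by (simp add: c_def)
  moreover have "(N v)\<^sup>2 = c * inertia v v" for v
  proof (cases "v = 0")
    case True then show ?thesis using linear_0[OF lin] by simp
  next
    case False
    define s where "s = sqrt (inertia b b / inertia v v)"
    have s: "s > 0" "s\<^sup>2 = inertia b b / inertia v v"
      using inertia_pos[OF False] inertia_pos[OF b0] by (auto simp: s_def)
    have "inertia (s *\<^sub>R v) (s *\<^sub>R v) = inertia b b"
      using s(2) inertia_pos[OF False]
      by (simp add: bilinear_lmul[OF bil] bilinear_rmul[OF bil] power2_eq_square field_simps)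
    from eq[OF this] have "(s * N v)\<^sup>2 = (N b)\<^sup>2" using s(1) by (simp add: N_scale)
    then have "s\<^sup>2 * (N v)\<^sup>2 = (N b)\<^sup>2" by (simp add: power_mult_distrib)
    then show ?thesis using s(2) inertia_pos[OF False] inertia_pos[OF b0] by (simp add: c_def field_simps)
  qed
  ultimately show ?thesis by blast
qed

end

subsection \<open>Riemannian metrics on an open set\<close>

text \<open>\<open>dg\<close> is assumed continuous for fixed vector arguments; expansion in a basis
  then yields continuity jointly in the point and all vectors.\<close>

locale metric_field =
  fixes U :: "'a::euclidean_space set" and g :: "'a \<Rightarrow> 'a \<Rightarrow> 'a \<Rightarrow> real"
    and dg :: "'a \<Rightarrow> 'a \<Rightarrow> 'a \<Rightarrow> 'a \<Rightarrow> real"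
  assumes open_U: "open U"
    and bilinear_g: "x \<in> U \<Longrightarrow> bilinear (g x)"
    and g_sym: "x \<in> U \<Longrightarrow> g x v w = g x w v"
    and g_pos: "x \<in> U \<Longrightarrow> v \<noteq> 0 \<Longrightarrow> 0 < g x v v"
    and g_deriv: "x \<in> U \<Longrightarrow> ((\<lambda>y. g y v w) has_derivative (\<lambda>h. dg x h v w)) (at x)"
    and dg_cont: "continuous_on U (\<lambda>x. dg x h v w)"
begin

lemma g_expand: "x \<in> U \<Longrightarrow> g x v w = (\<Sum>i\<in>Basis. \<Sum>j\<in>Basis. (v \<bullet> i) * (w \<bullet> j) * g x i j)"
proof -
  assume x: "x \<in> U"
  have "g x v w = g x (\<Sum>i\<in>Basis. (v \<bullet> i) *\<^sub>R i) (\<Sum>j\<in>Basis. (w \<bullet> j) *\<^sub>R j)" by (simp add: euclidean_representation)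
  also have "\<dots> = (\<Sum>i\<in>Basis. \<Sum>j\<in>Basis. g x ((v \<bullet> i) *\<^sub>R i) ((w \<bullet> j) *\<^sub>R j))"
    by (subst bilinear_sum[OF bilinear_g[OF x]]) (auto simp: sum.cartesian_product)
  finally show ?thesis
    by (simp add: bilinear_lmul[OF bilinear_g[OF x]] bilinear_rmul[OF bilinear_g[OF x]] mult_ac)
qed

lemma linear_dg: "x \<in> U \<Longrightarrow> linear (\<lambda>h. dg x h v w)"
  using g_deriv has_derivative_linear by blast

lemma dg_eqI:
  assumes "x \<in> U" "((\<lambda>y. g y v w) has_derivative D) (at x)"
  shows "dg x h v w = D h"
  using has_derivative_unique[OF g_deriv[OF assms(1)] assms(2)] by metis

lemma bilinear_dg: "x \<in> U \<Longrightarrow> bilinear (dg x h)"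
proof -
  assume x: "x \<in> U"
  have ev: "\<forall>\<^sub>F y in at x. y \<in> U" using open_U x by (rule eventually_at_in_open')
  have tr: "dg x h v w = D h" if "\<And>y. y \<in> U \<Longrightarrow> f y = g y v w" "(f has_derivative D) (at x)" for f D v w
    by (rule dg_eqI[OF x]) (rule has_derivative_transform_within_open[OF that(2) open_U x that(1)])
  show ?thesis unfolding bilinear_def
  proof (intro conjI allI linearI)
    fix v w w' c
    show "dg x h v (w + w') = dg x h v w + dg x h v w'"
      by (rule tr[of "\<lambda>y. g y v w + g y v w'"])
        (auto intro!: derivative_eq_intros g_deriv x simp: bilinear_radd[OF bilinear_g])
    show "dg x h (w + w') v = dg x h w v + dg x h w' v"
      by (rule tr[of "\<lambda>y. g y w v + g y w' v"])
        (auto intro!: derivative_eq_intros g_deriv x simp: bilinear_ladd[OF bilinear_g])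
    show "dg x h v (c *\<^sub>R w) = c *\<^sub>R dg x h v w"
      by (rule tr[of "\<lambda>y. c * g y v w"])
        (auto intro!: derivative_eq_intros g_deriv x simp: bilinear_rmul[OF bilinear_g])
    show "dg x h (c *\<^sub>R w) v = c *\<^sub>R dg x h w v"
      by (rule tr[of "\<lambda>y. c * g y w v"])
        (auto intro!: derivative_eq_intros g_deriv x simp: bilinear_lmul[OF bilinear_g])
  qed
qed

lemma dg_sym: "x \<in> U \<Longrightarrow> dg x h v w = dg x h w v"
  by (rule dg_eqI) (auto intro: has_derivative_transform_within_open[OF g_deriv[of x w v] open_U] simp: g_sym)

lemma dg_expand: "x \<in> U \<Longrightarrow> dg x h v w = (\<Sum>k\<in>Basis. \<Sum>i\<in>Basis. \<Sum>j\<in>Basis. (h \<bullet> k) * (v \<bullet> i) * (w \<bullet> j) * dg x k i j)"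
proof -
  assume x: "x \<in> U"
  have "dg x h v w = dg x (\<Sum>k\<in>Basis. (h \<bullet> k) *\<^sub>R k) v w" by (simp add: euclidean_representation)
  also have "\<dots> = (\<Sum>k\<in>Basis. (h \<bullet> k) * dg x k v w)"
    by (simp add: linear_sum[OF linear_dg[OF x]] linear_scale[OF linear_dg[OF x]])
  also have "\<dots> = (\<Sum>k\<in>Basis. (h \<bullet> k) * dg x k (\<Sum>i\<in>Basis. (v \<bullet> i) *\<^sub>R i) (\<Sum>j\<in>Basis. (w \<bullet> j) *\<^sub>R j))"
    by (simp add: euclidean_representation)
  also have "\<dots> = (\<Sum>k\<in>Basis. (h \<bullet> k) * (\<Sum>i\<in>Basis. \<Sum>j\<in>Basis. (v \<bullet> i) * (w \<bullet> j) * dg x k i j))"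
    by (simp add: bilinear_sum[OF bilinear_dg[OF x]] sum.cartesian_product[symmetric]
        bilinear_lmul[OF bilinear_dg[OF x]] bilinear_rmul[OF bilinear_dg[OF x]] mult_ac)
  finally show ?thesis by (simp add: sum_distrib_left mult_ac)
qed

lemma g_cont: "continuous_on U (\<lambda>x. g x v w)"
  by (intro continuous_at_imp_continuous_on ballI has_derivative_continuous[OF g_deriv])

lemma continuous_on_g [continuous_intros]:
  assumes "continuous_on X a" "continuous_on X b" "continuous_on X c" "\<And>s. s \<in> X \<Longrightarrow> a s \<in> U"
  shows "continuous_on X (\<lambda>s. g (a s) (b s) (c s))"
proof -
  have "continuous_on X (\<lambda>s. \<Sum>i\<in>Basis. \<Sum>j\<in>Basis. (b s \<bullet> i) * (c s \<bullet> j) * g (a s) i j)"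
    using assms by (intro continuous_intros continuous_on_compose2[OF g_cont]) auto
  then show ?thesis by (rule continuous_on_eq) (use assms(4) g_expand in auto)
qed

lemma continuous_on_dg [continuous_intros]:
  assumes "continuous_on X a" "continuous_on X b" "continuous_on X c" "continuous_on X e" "\<And>s. s \<in> X \<Longrightarrow> a s \<in> U"
  shows "continuous_on X (\<lambda>s. dg (a s) (b s) (c s) (e s))"
proof -
  have "continuous_on X (\<lambda>s. \<Sum>k\<in>Basis. \<Sum>i\<in>Basis. \<Sum>j\<in>Basis. (b s \<bullet> k) * (c s \<bullet> i) * (e s \<bullet> j) * dg (a s) k i j)"
    using assms by (intro continuous_intros continuous_on_compose2[OF dg_cont]) auto
  then show ?thesis by (rule continuous_on_eq) (use assms(5) dg_expand in auto)
qed

definition L :: "'a \<Rightarrow> 'a \<Rightarrow> real" where "L x v = sqrt (g x v v)"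

lemma g_nonneg: "x \<in> U \<Longrightarrow> 0 \<le> g x v v"
  using g_pos[of x v] bilinear_lzero[OF bilinear_g] by (cases "v = 0") (auto intro: less_imp_le)

lemma L_nonneg: "x \<in> U \<Longrightarrow> 0 \<le> L x v" by (simp add: L_def g_nonneg)

lemma L_pos: "x \<in> U \<Longrightarrow> v \<noteq> 0 \<Longrightarrow> 0 < L x v" by (simp add: L_def g_pos)

lemma L_sq: "x \<in> U \<Longrightarrow> (L x v)\<^sup>2 = g x v v" by (simp add: L_def g_nonneg)

lemma L_scale: "x \<in> U \<Longrightarrow> L x (c *\<^sub>R v) = \<bar>c\<bar> * L x v"
  by (simp add: L_def bilinear_lmul[OF bilinear_g] bilinear_rmul[OF bilinear_g] real_sqrt_mult
      flip: mult.assoc power2_eq_square)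

lemma L_zero: "x \<in> U \<Longrightarrow> L x 0 = 0" using L_scale[of x 0 0] by simp

lemma continuous_on_L [continuous_intros]:
  assumes "continuous_on X a" "continuous_on X b" "\<And>s. s \<in> X \<Longrightarrow> a s \<in> U"
  shows "continuous_on X (\<lambda>s. L (a s) (b s))"
  unfolding L_def by (intro continuous_intros assms)

lemma cauchy_schwarz: assumes x: "x \<in> U" shows "g x v w \<le> L x v * L x w"
proof (cases "v = 0 \<or> w = 0")
  case True
  then show ?thesis using x by (auto simp: bilinear_lzero[OF bilinear_g] bilinear_rzero[OF bilinear_g] L_zero)
next
  case False
  then have p: "L x v > 0" "L x w > 0" using L_pos x by auto
  note b = bilinear_g[OF x]
  have "0 \<le> g x (L x w *\<^sub>R v - L x v *\<^sub>R w) (L x w *\<^sub>R v - L x v *\<^sub>R w)" by (rule g_nonneg[OF x])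
  also have "\<dots> = L x w * L x w * g x v v + L x v * L x v * g x w w - 2 * (L x v * L x w) * g x v w"
    by (simp add: bilinear_lsub[OF b] bilinear_rsub[OF b] bilinear_lmul[OF b] bilinear_rmul[OF b] g_sym[OF x, of w v] algebra_simps)
  also have "\<dots> = L x w * L x w * (L x v)\<^sup>2 + L x v * L x v * (L x w)\<^sup>2 - 2 * (L x v * L x w) * g x v w"
    by (simp only: L_sq[OF x])
  finally have "2 * (L x v * L x w) * g x v w \<le> 2 * (L x v * L x w) * (L x v * L x w)"
    by (simp add: power2_eq_square algebra_simps)
  then show ?thesis using p by simp
qed

lemma parallelogram: "x \<in> U \<Longrightarrow> (L x (v - w))\<^sup>2 = 2 * (L x v)\<^sup>2 + 2 * (L x w)\<^sup>2 - (L x (v + w))\<^sup>2"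
  by (simp add: L_sq bilinear_ladd[OF bilinear_g] bilinear_radd[OF bilinear_g] bilinear_lsub[OF bilinear_g] bilinear_rsub[OF bilinear_g])

text \<open>Homogeneity in the vector arguments reduces every bound to unit vectors, hence to a
  continuous function on a compact set.\<close>

lemma local_bounds:
  assumes p: "p \<in> U"
  obtains R m M C where "R > 0" "m > 0" "M > 0" "C \<ge> 0" "cball p R \<subseteq> U"
    "\<And>x v. x \<in> cball p R \<Longrightarrow> m * norm v \<le> L x v"
    "\<And>x v. x \<in> cball p R \<Longrightarrow> L x v \<le> M * norm v"
    "\<And>x y v. x \<in> cball p R \<Longrightarrow> y \<in> cball p R \<Longrightarrow> \<bar>L x v - L y v\<bar> \<le> C * norm (x - y) * norm v"
proof -
  obtain R where R: "R > 0" "cball p R \<subseteq> U" using open_U p open_contains_cball by blast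
  obtain b :: 'a where b: "b \<in> Basis" by fastforce
  let ?K = "cball p R \<times> sphere (0::'a) 1"
  have K: "compact ?K" "?K \<noteq> {}" using R(1) b by (auto intro!: compact_Times exI[of _ b] exI[of _ p])
  have cL: "continuous_on ?K (\<lambda>z. L (fst z) (snd z))" using R(2) by (intro continuous_intros) auto
  obtain z0 where z0: "z0 \<in> ?K" "\<And>z. z \<in> ?K \<Longrightarrow> L (fst z0) (snd z0) \<le> L (fst z) (snd z)"
    using continuous_attains_inf[OF K cL] by auto
  obtain z1 where z1: "z1 \<in> ?K" "\<And>z. z \<in> ?K \<Longrightarrow> L (fst z) (snd z) \<le> L (fst z1) (snd z1)"
    using continuous_attains_sup[OF K cL] by auto
  define m where "m = L (fst z0) (snd z0)"
  define M where "M = L (fst z1) (snd z1)"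
  have m: "m > 0" "M > 0" unfolding m_def M_def using z0(1) z1(1) R(2) by (auto intro!: L_pos)
  have Lb: "m * norm v \<le> L x v \<and> L x v \<le> M * norm v" if x: "x \<in> cball p R" for x v
  proof (cases "v = 0")
    case False
    have "L x v = norm v * L x (v /\<^sub>R norm v)" using x R(2) False by (subst L_scale) auto
    moreover have "m \<le> L x (v /\<^sub>R norm v)" "L x (v /\<^sub>R norm v) \<le> M"
      using z0(2)[of "(x, v /\<^sub>R norm v)"] z1(2)[of "(x, v /\<^sub>R norm v)"] x False by (auto simp: m_def M_def)
    ultimately show ?thesis using False by (simp add: mult.commute)
  qed (use x R(2) L_zero in auto)
  let ?K' = "cball p R \<times> sphere (0::'a) 1 \<times> sphere (0::'a) 1"
  have "compact ?K'" by (intro compact_Times) auto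
  moreover have "continuous_on ?K' (\<lambda>z. dg (fst z) (fst (snd z)) (snd (snd z)) (snd (snd z)))"
    using R(2) by (intro continuous_intros) auto
  ultimately have "bounded ((\<lambda>z. dg (fst z) (fst (snd z)) (snd (snd z)) (snd (snd z))) ` ?K')"
    by (intro compact_imp_bounded compact_continuous_image)
  from this[unfolded bounded_pos image_iff] obtain Q where Q0: "Q > 0"
    and Q1: "\<And>y z. z \<in> ?K' \<Longrightarrow> y = dg (fst z) (fst (snd z)) (snd (snd z)) (snd (snd z)) \<Longrightarrow> norm y \<le> Q"
    by (elim exE conjE) (rule that, assumption, blast)
  have Q: "\<bar>dg (fst z) (fst (snd z)) (snd (snd z)) (snd (snd z))\<bar> \<le> Q" if "z \<in> ?K'" for z
    using Q1[OF that refl] by simp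
  have Qb: "\<bar>dg x h v v\<bar> \<le> (Q * (norm v)\<^sup>2) * norm h" if x: "x \<in> cball p R" for x h v
  proof (cases "h = 0 \<or> v = 0")
    case True
    then show ?thesis using x R(2) by (auto simp: linear_0[OF linear_dg] bilinear_lzero[OF bilinear_dg])
  next
    case False
    have xU: "x \<in> U" using x R(2) by auto
    note l = linear_scale[OF linear_dg[OF xU]] bilinear_lmul[OF bilinear_dg[OF xU]] bilinear_rmul[OF bilinear_dg[OF xU]]
    have "dg x h v v = dg x (norm h *\<^sub>R (h /\<^sub>R norm h)) (norm v *\<^sub>R (v /\<^sub>R norm v)) (norm v *\<^sub>R (v /\<^sub>R norm v))"
      using False by simp
    also have "\<dots> = (norm v)\<^sup>2 * norm h * dg x (h /\<^sub>R norm h) (v /\<^sub>R norm v) (v /\<^sub>R norm v)"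
      unfolding l by (simp add: power2_eq_square)
    finally have "\<bar>dg x h v v\<bar> = (norm v)\<^sup>2 * norm h * \<bar>dg x (h /\<^sub>R norm h) (v /\<^sub>R norm v) (v /\<^sub>R norm v)\<bar>"
      by (simp add: abs_mult)
    also have "\<dots> \<le> (norm v)\<^sup>2 * norm h * Q"
      using Q[of "(x, h /\<^sub>R norm h, v /\<^sub>R norm v)"] x False by (intro mult_left_mono) auto
    finally show ?thesis by (simp add: mult_ac)
  qed
  \<comment> \<open>\<open>L\<close> is a square root, so the bound is proved for \<open>g\<close>,
    the square of \<open>L\<close>, and divided by \<open>L x v + L y v\<close>, which is at least
    \<open>2 * m * norm v\<close>.\<close>
  have lip: "\<bar>L x v - L y v\<bar> \<le> Q / (2 * m) * norm (x - y) * norm v"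
    if xy: "x \<in> cball p R" "y \<in> cball p R" for x y v
  proof -
    have U: "x \<in> U" "y \<in> U" using xy R(2) by auto
    show ?thesis
    proof (cases "v = 0")
      case False
      have "norm (g x v v - g y v v) \<le> (Q * (norm v)\<^sup>2) * norm (x - y)"
      proof (rule differentiable_bound[where f' = "\<lambda>z h. dg z h v v" and S = "cball p R"])
        fix z assume z: "z \<in> cball p R"
        then show "((\<lambda>x. g x v v) has_derivative (\<lambda>h. dg z h v v)) (at z within cball p R)"
          using g_deriv R(2) has_derivative_at_withinI by blast
        show "onorm (\<lambda>h. dg z h v v) \<le> Q * (norm v)\<^sup>2"
          by (rule onorm_le) (use Qb[OF z] in simp)
      qed (use xy in auto)
      moreover have "g x v v - g y v v = (L x v - L y v) * (L x v + L y v)"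
        by (simp add: L_sq[OF U(1), symmetric] L_sq[OF U(2), symmetric] power2_eq_square algebra_simps)
      ultimately have "\<bar>L x v - L y v\<bar> * (L x v + L y v) \<le> (Q * (norm v)\<^sup>2) * norm (x - y)"
        using L_nonneg[OF U(1), of v] L_nonneg[OF U(2), of v] by (simp add: abs_mult)
      moreover have "\<bar>L x v - L y v\<bar> * (2 * m * norm v) \<le> \<bar>L x v - L y v\<bar> * (L x v + L y v)"
        using Lb[OF xy(1), of v] Lb[OF xy(2), of v] by (intro mult_left_mono) auto
      ultimately have "\<bar>L x v - L y v\<bar> * (2 * m * norm v) \<le> (Q * (norm v)\<^sup>2) * norm (x - y)" by linarith
      then show ?thesis using False m by (simp add: field_simps power2_eq_square)
    qed (simp add: L_zero U)
  qed
  show thesis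
    by (rule that[of R m M "Q / (2 * m)"]) (use R m Lb lip Q0 in auto)
qed

end

text \<open>A \<open>C\<^sup>1\<close> function that is constant outside \<open>[0,1]\<close>: substituting it into a curve makes the
  velocity vanish at the ends, so that curves can be concatenated within the class of \<open>C\<^sup>1\<close> curves.\<close>

definition step :: "real \<Rightarrow> real" where
  "step t = (max 0 t)\<^sup>2 / ((max 0 t)\<^sup>2 + (max 0 (1 - t))\<^sup>2)"

definition step' :: "real \<Rightarrow> real" where
  "step' t = 2 * max 0 t * max 0 (1 - t) * (max 0 t + max 0 (1 - t)) / ((max 0 t)\<^sup>2 + (max 0 (1 - t))\<^sup>2)\<^sup>2"

text \<open>The square makes the truncation differentiable at 0, where the difference quotient is
  bounded by \<open>\<bar>h\<bar>\<close>.\<close>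

lemma DERIV_max_sq: "((\<lambda>t. (max 0 t)\<^sup>2) has_real_derivative 2 * max 0 t) (at (t::real))"
proof -
  consider "t > 0" | "t < 0" | "t = 0" by linarith
  then show ?thesis
  proof cases
    case 1
    have "((\<lambda>t. t\<^sup>2) has_real_derivative 2 * max 0 t) (at t)" using 1 by (auto intro!: derivative_eq_intros)
    then show ?thesis
      by (rule has_field_derivative_transform_within_open[where S = "{0<..}"]) (use 1 in auto)
  next
    case 2
    have "((\<lambda>t. 0) has_real_derivative 2 * max 0 t) (at t)" using 2 by (auto intro!: derivative_eq_intros)
    then show ?thesis
      by (rule has_field_derivative_transform_within_open[where S = "{..<0}"]) (use 2 in auto)
  next
    case 3
    have "((\<lambda>h. (max 0 h)\<^sup>2 / h) \<longlongrightarrow> 0) (at (0::real))"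
    proof (rule Lim_null_comparison[where g = "\<lambda>h. \<bar>h\<bar>"])
      show "\<forall>\<^sub>F h in at (0::real). norm ((max 0 h)\<^sup>2 / h) \<le> \<bar>h\<bar>"
        by (rule always_eventually) (auto simp: max_def power2_eq_square)
    qed (auto intro!: tendsto_eq_intros)
    then show ?thesis using 3 by (simp add: DERIV_def)
  qed
qed

lemma step_denom_pos: "(max 0 t)\<^sup>2 + (max 0 (1 - t))\<^sup>2 > (0::real)"
  by (cases "t > 0") (auto intro: add_pos_nonneg add_nonneg_pos simp: max_def)

lemma DERIV_step: "(step has_real_derivative step' t) (at t)"
proof -
  define p where "p t = (max 0 t)\<^sup>2" for t :: real
  have p: "(p has_real_derivative 2 * max 0 t) (at t)" for t
    unfolding p_def by (rule DERIV_max_sq)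
  have q: "((\<lambda>t. p (1 - t)) has_real_derivative (2 * max 0 (1 - t)) * (-1)) (at t)"
    by (rule DERIV_chain2[OF p]) (auto intro!: derivative_eq_intros)
  have "((\<lambda>t. p t / (p t + p (1 - t))) has_real_derivative
     ((2 * max 0 t) * (p t + p (1 - t)) - p t * (2 * max 0 t + (2 * max 0 (1 - t)) * (-1))) / ((p t + p (1 - t)) * (p t + p (1 - t)))) (at t)"
    using step_denom_pos[of t] by (intro DERIV_divide DERIV_add p q) (auto simp: p_def)
  moreover have "((2 * max 0 t) * (p t + p (1 - t)) - p t * (2 * max 0 t + (2 * max 0 (1 - t)) * (-1))) / ((p t + p (1 - t)) * (p t + p (1 - t))) = step' t"
    unfolding step'_def p_def power2_eq_square[of "max 0 t ^ 2 + _"] by (simp add: algebra_simps power2_eq_square)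
  moreover have "step = (\<lambda>t. p t / (p t + p (1 - t)))" by (auto simp: step_def p_def)
  ultimately show ?thesis by simp
qed

lemma step'_nonneg: "step' t \<ge> 0"
  unfolding step'_def by (intro divide_nonneg_nonneg mult_nonneg_nonneg) auto

lemma step'_cont: "continuous_on X step'"
  unfolding step'_def
  by (intro continuous_intros) (metis step_denom_pos less_irrefl power_eq_0_iff)

lemma step_le_0: "t \<le> 0 \<Longrightarrow> step t = 0" and step_ge_1: "t \<ge> 1 \<Longrightarrow> step t = 1"
  by (auto simp: step_def max_def)

lemma step_range: "step t \<in> {0..1}"
  using step_denom_pos[of t] by (auto simp: step_def divide_simps)

section \<open>Concatenation of curves and the length distance\<close>

context metric_field begin

text \<open>Curves are defined on the whole line and rest outside \<open>[0,1]\<close>. Endpoints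
  thus have two-sided derivatives, necessarily zero, and curves can be joined without matching
  velocities.\<close>

definition curve_from_to :: "'a \<Rightarrow> 'a \<Rightarrow> (real \<Rightarrow> 'a) \<Rightarrow> (real \<Rightarrow> 'a) \<Rightarrow> bool" where
  "curve_from_to x y \<gamma> \<gamma>' \<longleftrightarrow> (\<forall>t. (\<gamma> has_vector_derivative \<gamma>' t) (at t)) \<and> continuous_on UNIV \<gamma>' \<and>
     range \<gamma> \<subseteq> U \<and> (\<forall>t\<le>0. \<gamma> t = x) \<and> (\<forall>t\<ge>1. \<gamma> t = y)"

definition len :: "(real \<Rightarrow> 'a) \<Rightarrow> (real \<Rightarrow> 'a) \<Rightarrow> real" where
  "len \<gamma> \<gamma>' = integral {0..1} (\<lambda>t. L (\<gamma> t) (\<gamma>' t))"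

text \<open>Composing with \<open>step\<close> brings the curve to rest at both ends. The
  substitution is monotone, so homogeneity of \<open>L\<close> preserves the length.\<close>

lemma reparametrize:
  assumes ab: "a \<le> b" and \<delta>: "\<And>t. t \<in> {a..b} \<Longrightarrow> (\<delta> has_vector_derivative \<delta>' t) (at t)"
    "continuous_on {a..b} \<delta>'" "\<And>t. t \<in> {a..b} \<Longrightarrow> \<delta> t \<in> U"
  shows "\<exists>\<gamma> \<gamma>'. curve_from_to (\<delta> a) (\<delta> b) \<gamma> \<gamma>' \<and> len \<gamma> \<gamma>' = integral {a..b} (\<lambda>t. L (\<delta> t) (\<delta>' t)) \<and> range \<gamma> \<subseteq> \<delta> ` {a..b}"
proof -
  define \<sigma> where "\<sigma> t = a + (b - a) * step t" for t
  define \<sigma>' where "\<sigma>' t = (b - a) * step' t" for t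
  have \<sigma>: "\<sigma> t \<in> {a..b}" for t
  proof -
    have "0 \<le> (b - a) * step t" "(b - a) * step t \<le> (b - a) * 1"
      using step_range[of t] ab by (auto intro!: mult_left_mono mult_nonneg_nonneg simp del: mult_1_right)
    then show ?thesis by (simp add: \<sigma>_def)
  qed
  have d\<sigma>: "(\<sigma> has_real_derivative \<sigma>' t) (at t)" for t
    unfolding \<sigma>_def \<sigma>'_def by (auto intro!: derivative_eq_intros DERIV_step)
  have c\<sigma>: "continuous_on X \<sigma>" for X
    using d\<sigma> DERIV_continuous_on by (metis has_field_derivative_at_within)
  have \<sigma>'0: "\<sigma>' t \<ge> 0" for t using ab step'_nonneg[of t] by (simp add: \<sigma>'_def)
  have "curve_from_to (\<delta> a) (\<delta> b) (\<lambda>t. \<delta> (\<sigma> t)) (\<lambda>t. \<sigma>' t *\<^sub>R \<delta>' (\<sigma> t))"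
    unfolding curve_from_to_def
  proof (intro conjI allI impI)
    show "((\<lambda>t. \<delta> (\<sigma> t)) has_vector_derivative \<sigma>' t *\<^sub>R \<delta>' (\<sigma> t)) (at t)" for t
      using vector_diff_chain_at[OF d\<sigma>[of t, unfolded has_real_derivative_iff_has_vector_derivative] \<delta>(1)[OF \<sigma>]]
      by (simp add: o_def)
    show "continuous_on UNIV (\<lambda>t. \<sigma>' t *\<^sub>R \<delta>' (\<sigma> t))"
      unfolding \<sigma>'_def
      by (intro continuous_intros step'_cont continuous_on_compose2[OF \<delta>(2) c\<sigma>]) (use \<sigma> in auto)
  qed (use \<sigma> \<delta>(3) in \<open>auto simp: \<sigma>_def step_le_0 step_ge_1\<close>)
  moreover have "len (\<lambda>t. \<delta> (\<sigma> t)) (\<lambda>t. \<sigma>' t *\<^sub>R \<delta>' (\<sigma> t)) = integral {a..b} (\<lambda>t. L (\<delta> t) (\<delta>' t))"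
  proof -
    have "continuous_on {a..b} \<delta>"
      by (rule continuous_on_vector_derivative[of _ \<delta> \<delta>']) (rule has_vector_derivative_at_within[OF \<delta>(1)])
    then have c: "continuous_on {a..b} (\<lambda>t. L (\<delta> t) (\<delta>' t))"
      by (rule continuous_on_L[OF _ \<delta>(2,3)])
    have "((\<lambda>t. \<sigma>' t *\<^sub>R L (\<delta> (\<sigma> t)) (\<delta>' (\<sigma> t))) has_integral integral {\<sigma> 0..\<sigma> 1} (\<lambda>t. L (\<delta> t) (\<delta>' t))) {0..1}"
      by (rule has_integral_substitution[of 0 1 \<sigma> a b "\<lambda>t. L (\<delta> t) (\<delta>' t)"])
        (use \<sigma> c ab in \<open>auto simp: \<sigma>_def step_le_0 step_ge_1 intro!: has_field_derivative_at_within[OF d\<sigma>]\<close>)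
    moreover have "\<sigma>' t *\<^sub>R L (\<delta> (\<sigma> t)) (\<delta>' (\<sigma> t)) = L (\<delta> (\<sigma> t)) (\<sigma>' t *\<^sub>R \<delta>' (\<sigma> t))" for t
      using L_scale[OF \<delta>(3)[OF \<sigma>], of t "\<sigma>' t"] \<sigma>'0[of t] by simp
    ultimately show ?thesis unfolding len_def by (simp add: integral_unique \<sigma>_def step_le_0 step_ge_1)
  qed
  ultimately show ?thesis using \<sigma> by blast
qed

lemma curve_cont: "curve_from_to x y \<gamma> \<gamma>' \<Longrightarrow> continuous_on X \<gamma>"
  unfolding curve_from_to_def by (meson continuous_on_vector_derivative has_vector_derivative_at_within)

lemma curve_L_cont: "curve_from_to x y \<gamma> \<gamma>' \<Longrightarrow> continuous_on X (\<lambda>t. L (\<gamma> t) (\<gamma>' t))"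
proof -
  assume c: "curve_from_to x y \<gamma> \<gamma>'"
  then have "continuous_on X \<gamma>'" unfolding curve_from_to_def using continuous_on_subset by blast
  then show ?thesis using c curve_cont[OF c] by (intro continuous_intros) (auto simp: curve_from_to_def)
qed

lemma len_nonneg: "curve_from_to x y \<gamma> \<gamma>' \<Longrightarrow> 0 \<le> len \<gamma> \<gamma>'"
  unfolding len_def
proof (rule integral_nonneg)
  assume c: "curve_from_to x y \<gamma> \<gamma>'"
  show "(\<lambda>t. L (\<gamma> t) (\<gamma>' t)) integrable_on {0..1}"
    by (rule integrable_continuous_real[OF curve_L_cont[OF c]])
  show "0 \<le> L (\<gamma> t) (\<gamma>' t)" for t by (rule L_nonneg) (use c in \<open>auto simp: curve_from_to_def\<close>)
qed

lemma concatenate: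
  assumes c: "curve_from_to x y \<gamma> \<gamma>'" "curve_from_to y z \<eta> \<eta>'"
  shows "\<exists>\<zeta> \<zeta>'. curve_from_to x z \<zeta> \<zeta>' \<and> len \<zeta> \<zeta>' = len \<gamma> \<gamma>' + len \<eta> \<eta>'"
proof -
  note c1 = c(1)[unfolded curve_from_to_def] and c2 = c(2)[unfolded curve_from_to_def]
  \<comment> \<open>Until time 1 the second curve still rests at \<open>y\<close>, afterwards the
    first one does. A sum therefore replaces a definition by cases, and differentiability at the
    junction is automatic.\<close>
  define \<delta> where "\<delta> t = \<gamma> t + \<eta> (t - 1) - y" for t
  define \<delta>' where "\<delta>' t = \<gamma>' t + \<eta>' (t - 1)" for t
  have const: "\<gamma>' t = 0" if "t \<ge> 1" for t
  proof -
    have "(\<gamma> has_vector_derivative \<gamma>' t) (at t within {t..})"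
      using c1 has_vector_derivative_at_within by blast
    moreover have "(\<gamma> has_vector_derivative 0) (at t within {t..})"
      by (rule has_vector_derivative_transform[of t _ _ "\<lambda>_. y"]) (use c1 that in auto)
    ultimately show ?thesis
      using vector_derivative_unique_within[of t "{t..}"] by (simp add: at_within_Ici_at_right)
  qed
  have const2: "\<eta>' t = 0" if "t \<le> 0" for t
  proof -
    have "(\<eta> has_vector_derivative \<eta>' t) (at t within {..t})"
      using c2 has_vector_derivative_at_within by blast
    moreover have "(\<eta> has_vector_derivative 0) (at t within {..t})"
      by (rule has_vector_derivative_transform[of t _ _ "\<lambda>_. y"]) (use c2 that in auto)
    ultimately show ?thesis
      using vector_derivative_unique_within[of t "{..t}"] by (simp add: at_within_Iic_at_left)
  qed
  have e: "\<delta> t = \<gamma> t" "\<delta>' t = \<gamma>' t" if "t \<le> 1" for t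
    using c2 const2[of "t - 1"] that by (auto simp: \<delta>_def \<delta>'_def)
  have e2: "\<delta> t = \<eta> (t - 1)" "\<delta>' t = \<eta>' (t - 1)" if "t \<ge> 1" for t
    using c1 const[of t] that by (auto simp: \<delta>_def \<delta>'_def)
  have \<delta>U: "\<delta> t \<in> U" for t using e(1)[of t] e2(1)[of t] c1 c2 by (cases "t \<le> 1") auto
  have d: "(\<delta> has_vector_derivative \<delta>' t) (at t)" for t
  proof -
    have "((\<lambda>t. \<eta> (t - 1)) has_vector_derivative 1 *\<^sub>R \<eta>' (t - 1)) (at t)"
      by (rule vector_diff_chain_at[of "\<lambda>t. t - 1" 1 t \<eta> "\<eta>' (t - 1)", unfolded o_def])
        (use c2 in \<open>auto intro!: derivative_eq_intros\<close>)
    then show ?thesis unfolding \<delta>_def \<delta>'_def using c1 by (auto intro!: derivative_eq_intros)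
  qed
  have cont': "continuous_on X \<delta>'" for X
  proof -
    have "continuous_on X (\<lambda>t. \<eta>' (t - 1))"
      by (rule continuous_on_compose2[of UNIV \<eta>']) (use c2 in \<open>auto intro!: continuous_intros\<close>)
    moreover have "continuous_on X \<gamma>'" using c1 continuous_on_subset by blast
    ultimately show ?thesis unfolding \<delta>'_def by (intro continuous_on_add)
  qed
  have cL: "continuous_on X (\<lambda>t. L (\<delta> t) (\<delta>' t))" for X
  proof (rule continuous_on_L[OF _ cont' \<delta>U])
    show "continuous_on X \<delta>"
      by (rule continuous_on_vector_derivative[of _ \<delta> \<delta>']) (rule has_vector_derivative_at_within[OF d])
  qed
  obtain \<zeta> \<zeta>' where \<zeta>: "curve_from_to (\<delta> 0) (\<delta> 2) \<zeta> \<zeta>'" "len \<zeta> \<zeta>' = integral {0..2} (\<lambda>t. L (\<delta> t) (\<delta>' t))"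
    using reparametrize[of 0 2 \<delta> \<delta>'] d cont' \<delta>U by auto
  have "integral {0..2} (\<lambda>t. L (\<delta> t) (\<delta>' t)) = integral {0..1} (\<lambda>t. L (\<delta> t) (\<delta>' t)) + integral {1..2} (\<lambda>t. L (\<delta> t) (\<delta>' t))"
    by (rule Henstock_Kurzweil_Integration.integral_combine[symmetric]) (auto intro: integrable_continuous_real cL)
  also have "integral {0..1} (\<lambda>t. L (\<delta> t) (\<delta>' t)) = len \<gamma> \<gamma>'"
    unfolding len_def by (rule Henstock_Kurzweil_Integration.integral_cong) (use e in auto)
  also have "integral {1..2} (\<lambda>t. L (\<delta> t) (\<delta>' t)) = integral {0..1} (\<lambda>t. L (\<delta> (t + 1)) (\<delta>' (t + 1)))"
    using integral_shift[of 0 1 1 "\<lambda>t. L (\<delta> t) (\<delta>' t)"] cL by (simp add: o_def)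
  also have "\<dots> = len \<eta> \<eta>'"
    unfolding len_def by (rule Henstock_Kurzweil_Integration.integral_cong) (use e2 in auto)
  finally have "len \<zeta> \<zeta>' = len \<gamma> \<gamma>' + len \<eta> \<eta>'" using \<zeta> by simp
  moreover have "\<delta> 0 = x" "\<delta> 2 = z" using e[of 0] e2[of 2] c1 c2 by auto
  ultimately show ?thesis using \<zeta>(1) by metis
qed

lemma subcurve:
  assumes c: "curve_from_to x y \<gamma> \<gamma>'" and ab: "a \<le> b"
  shows "\<exists>\<zeta> \<zeta>'. curve_from_to (\<gamma> a) (\<gamma> b) \<zeta> \<zeta>' \<and> len \<zeta> \<zeta>' = integral {a..b} (\<lambda>t. L (\<gamma> t) (\<gamma>' t))"
proof -
  note c' = c[unfolded curve_from_to_def]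
  have "continuous_on {a..b} \<gamma>'" using c' continuous_on_subset by blast
  moreover have "\<gamma> t \<in> U" for t using c' by auto
  ultimately show ?thesis using reparametrize[OF ab, of \<gamma> \<gamma>'] c' by meson
qed

definition d :: "'a \<Rightarrow> 'a \<Rightarrow> real" where
  "d x y = Inf {l. \<exists>\<gamma> \<gamma>'. curve_from_to x y \<gamma> \<gamma>' \<and> l = len \<gamma> \<gamma>'}"

lemma d_le: "curve_from_to x y \<gamma> \<gamma>' \<Longrightarrow> d x y \<le> len \<gamma> \<gamma>'"
  unfolding d_def by (rule cInf_lower) (auto intro!: bdd_belowI[of _ 0] len_nonneg)

text \<open>The infimum in \<open>d\<close> is informative only over a nonempty set of lengths;
  lower bounds and the triangle inequality carry this condition.\<close>

definition joined :: "'a \<Rightarrow> 'a \<Rightarrow> bool" where "joined x y \<longleftrightarrow> (\<exists>\<gamma> \<gamma>'. curve_from_to x y \<gamma> \<gamma>')"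

lemma d_geI: "joined x y \<Longrightarrow> (\<And>\<gamma> \<gamma>'. curve_from_to x y \<gamma> \<gamma>' \<Longrightarrow> c \<le> len \<gamma> \<gamma>') \<Longrightarrow> c \<le> d x y"
  unfolding d_def joined_def by (rule cInf_greatest) auto

lemma d_nonneg: "joined x y \<Longrightarrow> 0 \<le> d x y" by (rule d_geI) (auto intro: len_nonneg)

lemma d_approx: assumes "joined x y" "e > 0" obtains \<gamma> \<gamma>' where "curve_from_to x y \<gamma> \<gamma>'" "len \<gamma> \<gamma>' < d x y + e"
  using d_geI[OF assms(1), of "d x y + e"] assms(2) that by (metis add_le_same_cancel1 not_less)

lemma d_triangle:
  assumes "joined x y" "joined y z" shows "d x z \<le> d x y + d y z"
proof (rule field_le_epsilon)
  fix e :: real assume e: "e > 0"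
  obtain \<gamma> \<gamma>' \<eta> \<eta>' where c: "curve_from_to x y \<gamma> \<gamma>'" "len \<gamma> \<gamma>' < d x y + e/2"
    "curve_from_to y z \<eta> \<eta>'" "len \<eta> \<eta>' < d y z + e/2"
    using d_approx[OF assms(1), of "e/2"] d_approx[OF assms(2), of "e/2"] e by (metis half_gt_zero)
  obtain \<zeta> \<zeta>' where "curve_from_to x z \<zeta> \<zeta>'" "len \<zeta> \<zeta>' = len \<gamma> \<gamma>' + len \<eta> \<eta>'"
    using concatenate[OF c(1,3)] by blast
  then show "d x z \<le> d x y + d y z + e" using d_le c by fastforce
qed

lemma segment_curve:
  assumes "closed_segment x y \<subseteq> U"
  shows "\<exists>\<gamma> \<gamma>'. curve_from_to x y \<gamma> \<gamma>' \<and> len \<gamma> \<gamma>' = integral {0..1} (\<lambda>t. L (x + t *\<^sub>R (y - x)) (y - x))"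
proof -
  have "x + t *\<^sub>R (y - x) \<in> U" if "t \<in> {0..1}" for t
  proof -
    have "x + t *\<^sub>R (y - x) = (1 - t) *\<^sub>R x + t *\<^sub>R y" by (simp add: algebra_simps)
    then have "x + t *\<^sub>R (y - x) \<in> closed_segment x y" using that by (auto simp: closed_segment_def)
    then show ?thesis using assms by blast
  qed
  moreover have "((\<lambda>t. x + t *\<^sub>R (y - x)) has_vector_derivative y - x) (at t)" for t
    by (auto intro!: derivative_eq_intros)
  ultimately obtain \<gamma> \<gamma>' where "curve_from_to (x + 0 *\<^sub>R (y - x)) (x + 1 *\<^sub>R (y - x)) \<gamma> \<gamma>'"
    "len \<gamma> \<gamma>' = integral {0..1} (\<lambda>t. L (x + t *\<^sub>R (y - x)) (y - x))"
    using reparametrize[of 0 1 "\<lambda>t. x + t *\<^sub>R (y - x)" "\<lambda>t. y - x"] by (metis continuous_on_const zero_le_one)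
  then show ?thesis by auto
qed

lemma joined_segment: "closed_segment x y \<subseteq> U \<Longrightarrow> joined x y"
  using segment_curve unfolding joined_def by blast

end

subsection \<open>The distance function and the existence of geodesics\<close>

text \<open>The constants of \<open>local_bounds\<close> at one centre. Points are later taken in
  smaller balls, which leaves room for curves inside \<open>cball p R\<close>.\<close>

locale metric_ball = metric_field +
  fixes p :: 'a and R m M C :: real
  assumes R_pos: "R > 0" and m_pos: "m > 0" and M_pos: "M > 0" and C_nonneg: "C \<ge> 0"
    and ball_subset: "cball p R \<subseteq> U"
    and L_lower: "x \<in> cball p R \<Longrightarrow> m * norm v \<le> L x v"
    and L_upper: "x \<in> cball p R \<Longrightarrow> L x v \<le> M * norm v"
    and L_lipschitz: "x \<in> cball p R \<Longrightarrow> y \<in> cball p R \<Longrightarrow> \<bar>L x v - L y v\<bar> \<le> C * norm (x - y) * norm v"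
begin

lemma in_U: "x \<in> cball p R \<Longrightarrow> x \<in> U" using ball_subset by blast

lemma cball_mono: "x \<in> cball p r \<Longrightarrow> r \<le> r' \<Longrightarrow> x \<in> cball p r'" by auto

lemma cball_add: "x \<in> cball p r \<Longrightarrow> norm (y - x) \<le> s \<Longrightarrow> r + s \<le> r' \<Longrightarrow> y \<in> cball p r'"
  using dist_triangle[of p y x] by (auto simp: dist_norm norm_minus_commute)

lemma segment_ball: "x \<in> cball p R \<Longrightarrow> y \<in> cball p R \<Longrightarrow> closed_segment x y \<subseteq> cball p R"
  by (intro closed_segment_subset convex_cball)

lemma line_ball: "x \<in> cball p R \<Longrightarrow> y \<in> cball p R \<Longrightarrow> t \<in> {0..1} \<Longrightarrow> x + t *\<^sub>R (y - x) \<in> cball p R"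
proof -
  assume a: "x \<in> cball p R" "y \<in> cball p R" "t \<in> {0..1}"
  have "x + t *\<^sub>R (y - x) = (1 - t) *\<^sub>R x + t *\<^sub>R y" by (simp add: algebra_simps)
  then show ?thesis using a convexD_alt[OF convex_cball a(1,2), of t] by simp
qed

lemma joined_ball: "x \<in> cball p R \<Longrightarrow> y \<in> cball p R \<Longrightarrow> joined x y"
  using joined_segment segment_ball ball_subset by (meson order_trans)

lemma d_le_bound:
  assumes xy: "x \<in> cball p R" "y \<in> cball p R" and b: "\<And>t. t \<in> {0..1} \<Longrightarrow> L (x + t *\<^sub>R (y - x)) (y - x) \<le> b"
  shows "d x y \<le> b"
proof -
  obtain \<gamma> \<gamma>' where c: "curve_from_to x y \<gamma> \<gamma>'" "len \<gamma> \<gamma>' = integral {0..1} (\<lambda>t. L (x + t *\<^sub>R (y - x)) (y - x))"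
    using segment_curve segment_ball[OF xy] ball_subset by (meson order_trans)
  have "integral {0..1} (\<lambda>t. L (x + t *\<^sub>R (y - x)) (y - x)) \<le> integral {0..1::real} (\<lambda>t. b)"
  proof (rule integral_le)
    show "(\<lambda>t. L (x + t *\<^sub>R (y - x)) (y - x)) integrable_on {0..1}"
      by (rule integrable_continuous_real) (intro continuous_on_L continuous_intros in_U line_ball xy)
  qed (use b in auto)
  then show ?thesis using d_le[OF c(1)] c(2) by simp
qed

lemma d_upper: "x \<in> cball p R \<Longrightarrow> y \<in> cball p R \<Longrightarrow> d x y \<le> M * norm (y - x)"
  by (rule d_le_bound) (auto intro!: L_upper line_ball simp del: mem_cball)

lemma d_refl: "x \<in> cball p R \<Longrightarrow> d x x = 0"
  using d_upper[of x x] d_nonneg[OF joined_ball[of x x]] by simp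

text \<open>The segment is a competitor, and freezing \<open>L\<close> at \<open>x\<close> along it
  changes the integrand by at most \<open>C\<close> times the squared length of the segment.\<close>

lemma d_upper_quadratic:
  assumes xy: "x \<in> cball p R" "y \<in> cball p R"
  shows "d x y \<le> L x (y - x) + C * (norm (y - x))\<^sup>2"
proof (rule d_le_bound[OF xy])
  fix t :: real assume t: "t \<in> {0..1}"
  have "\<bar>L (x + t *\<^sub>R (y - x)) (y - x) - L x (y - x)\<bar> \<le> C * norm (x + t *\<^sub>R (y - x) - x) * norm (y - x)"
    by (rule L_lipschitz[OF line_ball[OF xy t] xy(1)])
  also have "\<dots> \<le> C * norm (y - x) * norm (y - x)"
    using t C_nonneg by (intro mult_right_mono mult_left_mono) (auto intro: mult_left_le_one_le)
  finally show "L (x + t *\<^sub>R (y - x)) (y - x) \<le> L x (y - x) + C * (norm (y - x))\<^sup>2"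
    by (simp add: power2_eq_square)
qed

lemma curve_integrable: "curve_from_to x y \<gamma> \<gamma>' \<Longrightarrow> (\<lambda>t. L (\<gamma> t) (\<gamma>' t)) integrable_on {a..b}"
  by (rule integrable_continuous_real) (rule curve_L_cont)

lemma curve_in_U: "curve_from_to x y \<gamma> \<gamma>' \<Longrightarrow> \<gamma> t \<in> U"
  unfolding curve_from_to_def by auto

lemma curve_FTC: "curve_from_to x y \<gamma> \<gamma>' \<Longrightarrow> a \<le> b \<Longrightarrow> (\<gamma>' has_integral (\<gamma> b - \<gamma> a)) {a..b}"
  unfolding curve_from_to_def by (intro fundamental_theorem_of_calculus) (auto intro: has_vector_derivative_at_within)

lemma partial_len_le:
  assumes c: "curve_from_to x y \<gamma> \<gamma>'" and t: "0 \<le> a" "b \<le> 1"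
  shows "integral {a..b} (\<lambda>t. L (\<gamma> t) (\<gamma>' t)) \<le> len \<gamma> \<gamma>'"
  unfolding len_def using t curve_integrable[OF c] L_nonneg[OF curve_in_U[OF c]]
  by (intro integral_subset_le) auto

text \<open>The lower bound on \<open>L\<close> holds inside the ball only, so the curve is measured
  up to its first exit time \<open>t1\<close>; the remainder can only add length.\<close>

lemma exit_len:
  assumes c: "curve_from_to x y \<gamma> \<gamma>'" and x: "x \<in> cball p (R/2)" and \<sigma>: "0 < \<sigma>" "\<sigma> \<le> R/2"
    and t: "t \<in> {0..1}" "\<sigma> \<le> norm (\<gamma> t - x)"
  shows "m * \<sigma> \<le> len \<gamma> \<gamma>'"
proof -
  define E where "E = {0..1} \<inter> {t. \<sigma> \<le> norm (\<gamma> t - x)}"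
  have "closed {t. \<sigma> \<le> norm (\<gamma> t - x)}"
    by (intro closed_Collect_le continuous_intros curve_cont[OF c])
  then have "compact E" unfolding E_def by (intro compact_Int_closed) auto
  moreover have "t \<in> E" using t by (auto simp: E_def)
  ultimately obtain t1 where t1: "t1 \<in> E" "\<And>t. t \<in> E \<Longrightarrow> t1 \<le> t"
    using compact_attains_inf[of E] by auto
  have less: "norm (\<gamma> t - x) < \<sigma>" if "t \<in> {0..<t1}" for t
    using t1(2)[of t] t1(1) that by (force simp: E_def)
  have \<gamma>0: "\<gamma> 0 = x" using c by (auto simp: curve_from_to_def)
  have t1': "t1 \<in> {0..1}" "\<sigma> \<le> norm (\<gamma> t1 - x)" using t1(1) by (auto simp: E_def)
  have le: "norm (\<gamma> t - x) \<le> \<sigma>" if "t \<in> {0..t1}" for t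
  proof (cases "t1 = 0")
    case True then show ?thesis using that \<gamma>0 \<sigma> by simp
  next
    case False
    then have "{0..t1} = closure {0..<t1}" using t1' by (simp add: closure_atLeastLessThan)
    then have "t \<in> closure {0..<t1}" using that by simp
    moreover have "closed {t. norm (\<gamma> t - x) \<le> \<sigma>}"
      by (intro closed_Collect_le continuous_intros curve_cont[OF c])
    moreover have "{0..<t1} \<subseteq> {t. norm (\<gamma> t - x) \<le> \<sigma>}" using less by fastforce
    ultimately show ?thesis using closure_minimal by blast
  qed
  have "\<sigma> \<le> norm (\<gamma> t1 - \<gamma> 0)" using t1' \<gamma>0 by simp
  also have "m * norm (\<gamma> t1 - \<gamma> 0) \<le> integral {0..t1} (\<lambda>t. L (\<gamma> t) (\<gamma>' t))"
  proof -
    have F: "(\<gamma>' has_integral (\<gamma> t1 - \<gamma> 0)) {0..t1}" using curve_FTC[OF c] t1' by simp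
    have "norm (integral {0..t1} (\<lambda>t. m *\<^sub>R \<gamma>' t)) \<le> integral {0..t1} (\<lambda>t. L (\<gamma> t) (\<gamma>' t))"
    proof (rule integral_norm_bound_integral)
      show "(\<lambda>t. m *\<^sub>R \<gamma>' t) integrable_on {0..t1}" using F by (intro integrable_cmul) auto
      show "norm (m *\<^sub>R \<gamma>' t) \<le> L (\<gamma> t) (\<gamma>' t)" if "t \<in> {0..t1}" for t
        using L_lower[of "\<gamma> t" "\<gamma>' t"] cball_add[OF x le[OF that], of R] \<sigma> m_pos by simp
    qed (rule curve_integrable[OF c])
    then show ?thesis using integral_unique[OF F] m_pos by simp
  qed
  also have "\<dots> \<le> len \<gamma> \<gamma>'" by (rule partial_len_le[OF c]) (use t1' in auto)
  finally show ?thesis using m_pos by (simp add: mult_left_mono)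
qed

text \<open>A curve to a distant point may leave the ball, and then only the cost of its exit is
  known; hence the minimum with \<open>R/2\<close>.\<close>

lemma d_lower:
  assumes x: "x \<in> cball p (R/2)" and j: "joined x y"
  shows "m * min (norm (y - x)) (R/2) \<le> d x y"
proof (rule d_geI[OF j])
  fix \<gamma> \<gamma>' assume c: "curve_from_to x y \<gamma> \<gamma>'"
  then have "\<gamma> 1 = y" by (auto simp: curve_from_to_def)
  show "m * min (norm (y - x)) (R/2) \<le> len \<gamma> \<gamma>'"
  proof (cases "y = x")
    case True then show ?thesis using len_nonneg[OF c] R_pos by (simp add: min_def)
  next
    case False
    show ?thesis
      by (rule exit_len[OF c x, of _ 1]) (use False R_pos \<open>\<gamma> 1 = y\<close> in auto)
  qed
qed

lemma d_lower':
  assumes x: "x \<in> cball p (R/2)" and j: "joined x y" and l: "d x y < m * (R/2)"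
  shows "m * norm (y - x) \<le> d x y"
  using d_lower[OF x j] l by (cases "norm (y - x) \<le> R/2") (auto simp: min_def split: if_splits)

lemma stays:
  assumes c: "curve_from_to x y \<gamma> \<gamma>'" and x: "x \<in> cball p (R/2)" and \<sigma>: "0 < \<sigma>" "\<sigma> \<le> R/2"
    and l: "len \<gamma> \<gamma>' < m * \<sigma>" and t: "t \<in> {0..1}"
  shows "norm (\<gamma> t - x) < \<sigma>"
  using exit_len[OF c x \<sigma> t] l by linarith

lemma d_lower_quadratic:
  assumes x: "x \<in> cball p (R/2)" and y: "y \<in> cball p R" and s: "3 * M * norm (y - x) \<le> m * (R/2)"
  shows "L x (y - x) \<le> d x y + 6 * C * M\<^sup>2 / m\<^sup>2 * (norm (y - x))\<^sup>2"
proof (cases "y = x")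
  case True
  have "x \<in> cball p R" using cball_mono[OF x] R_pos by simp
  then show ?thesis using True d_refl[of x] L_zero[OF in_U] by simp
next
  case False
  have xR: "x \<in> cball p R" using cball_mono[OF x] R_pos by simp
  have xU: "x \<in> U" by (rule in_U[OF xR])
  define w where "w = y - x"
  have w: "norm w > 0" using False by (simp add: w_def)
  define \<sigma> where "\<sigma> = 3 * M * norm w / m"
  have \<sigma>: "0 < \<sigma>" "\<sigma> \<le> R/2" "m * \<sigma> = 3 * M * norm w"
    using w M_pos m_pos s by (auto simp: \<sigma>_def w_def field_simps)
  have "L x w - 6 * C * M\<^sup>2 / m\<^sup>2 * (norm w)\<^sup>2 \<le> d x y"
  proof (rule field_le_epsilon)
    fix e :: real assume e: "e > 0"
    obtain \<gamma> \<gamma>' where c: "curve_from_to x y \<gamma> \<gamma>'" "len \<gamma> \<gamma>' < d x y + min e (M * norm w)"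
      using d_approx[OF joined_ball[OF xR y], of "min e (M * norm w)"] e w M_pos by auto
    have l2: "len \<gamma> \<gamma>' \<le> 2 * M * norm w" using d_upper[OF xR y] c(2) by (auto simp: w_def)
    also have "\<dots> < m * \<sigma>" using \<sigma> w M_pos by simp
    finally have st: "norm (\<gamma> t - x) < \<sigma>" if "t \<in> {0..1}" for t using stays[OF c(1) x \<sigma>(1,2) _ that] by simp
    have Lt: "L x (\<gamma>' t) \<le> (1 + C * \<sigma> / m) * L (\<gamma> t) (\<gamma>' t)" if t: "t \<in> {0..1}" for t
    proof -
      have B: "\<gamma> t \<in> cball p R" using cball_add[OF x less_imp_le[OF st[OF t]], of R] \<sigma>(2) by simp
      have "L x (\<gamma>' t) \<le> L (\<gamma> t) (\<gamma>' t) + C * norm (x - \<gamma> t) * norm (\<gamma>' t)"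
        using L_lipschitz[OF xR B, of "\<gamma>' t"] by linarith
      also have "C * norm (x - \<gamma> t) * norm (\<gamma>' t) \<le> C * \<sigma> * norm (\<gamma>' t)"
        using st[OF t] C_nonneg by (intro mult_right_mono mult_left_mono) (auto simp: norm_minus_commute)
      also have "\<dots> \<le> C * \<sigma> * (L (\<gamma> t) (\<gamma>' t) / m)"
        using L_lower[OF B, of "\<gamma>' t"] C_nonneg \<sigma>(1) m_pos by (intro mult_left_mono) (auto simp: field_simps)
      finally show ?thesis by (simp add: algebra_simps)
    qed
    have F: "(\<gamma>' has_integral w) {0..1}"
      using curve_FTC[OF c(1), of 0 1] c(1) by (simp add: curve_from_to_def w_def)
    have lin: "bounded_linear (g x w)"
      using bilinear_g[OF xU] by (simp add: bilinear_def linear_conv_bounded_linear)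
    have Lxc: "(\<lambda>t. L x (\<gamma>' t)) integrable_on {0..1}"
    proof (rule integrable_continuous_real[OF continuous_on_L])
      show "continuous_on {0..1} \<gamma>'" using c(1) continuous_on_subset by (auto simp: curve_from_to_def)
    qed (use xU in auto)
    have "((\<lambda>t. g x w (\<gamma>' t)) has_integral g x w w) {0..1}"
      using has_integral_linear[OF F lin] by (simp add: o_def)
    moreover have "((\<lambda>t. L x w * L x (\<gamma>' t)) has_integral L x w * integral {0..1} (\<lambda>t. L x (\<gamma>' t))) {0..1}"
      using Lxc by (intro has_integral_mult_right integrable_integral)
    ultimately have "g x w w \<le> L x w * integral {0..1} (\<lambda>t. L x (\<gamma>' t))"
      by (rule has_integral_le) (rule cauchy_schwarz[OF xU])
    then have "L x w * L x w \<le> L x w * integral {0..1} (\<lambda>t. L x (\<gamma>' t))"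
      by (simp add: L_sq[OF xU, symmetric] power2_eq_square)
    moreover have "L x w > 0" using L_pos[OF xU] w by simp
    ultimately have "L x w \<le> integral {0..1} (\<lambda>t. L x (\<gamma>' t))" by simp
    also have "\<dots> \<le> integral {0..1} (\<lambda>t. (1 + C * \<sigma> / m) * L (\<gamma> t) (\<gamma>' t))"
      using Lt curve_integrable[OF c(1)] by (intro integral_le Lxc) (auto intro: integrable_on_mult_right)
    also have "\<dots> = (1 + C * \<sigma> / m) * len \<gamma> \<gamma>'" unfolding len_def by (rule integral_mult_right)
    also have "\<dots> = len \<gamma> \<gamma>' + C * \<sigma> / m * len \<gamma> \<gamma>'" by (simp add: algebra_simps)
    also have "C * \<sigma> / m * len \<gamma> \<gamma>' \<le> C * \<sigma> / m * (2 * M * norm w)"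
      using l2 C_nonneg \<sigma>(1) m_pos by (intro mult_left_mono) auto
    also have "\<dots> = 6 * C * M\<^sup>2 / m\<^sup>2 * (norm w)\<^sup>2"
      by (simp add: \<sigma>_def power2_eq_square field_simps)
    finally show "L x w - 6 * C * M\<^sup>2 / m\<^sup>2 * (norm w)\<^sup>2 \<le> d x y + e" using c(2) by linarith
  qed
  then show ?thesis by (simp add: w_def)
qed

lemma d_lipschitz:
  assumes "a \<in> cball p R" "b \<in> cball p R" "a' \<in> cball p R" "b' \<in> cball p R"
  shows "\<bar>d a b - d a' b'\<bar> \<le> M * norm (a - a') + M * norm (b - b')"
proof -
  note j = joined_ball
  have *: "d a b \<le> d a' b' + M * norm (a - a') + M * norm (b - b')"
    if "a \<in> cball p R" "b \<in> cball p R" "a' \<in> cball p R" "b' \<in> cball p R" for a b a' b'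
    using d_triangle[OF j[OF that(1,3)] j[OF that(3,2)]] d_triangle[OF j[OF that(3,4)] j[OF that(4,2)]]
      d_upper[OF that(1,3)] d_upper[OF that(4,2)] by (simp add: norm_minus_commute)
  show ?thesis using *[OF assms] *[OF assms(3,4,1,2)] by (simp add: norm_minus_commute abs_le_iff)
qed

lemma tendsto_d:
  assumes "\<And>n. X n \<in> cball p R" "\<And>n. Y n \<in> cball p R" "X \<longlonglongrightarrow> a" "Y \<longlonglongrightarrow> b"
  shows "(\<lambda>n. d (X n) (Y n)) \<longlonglongrightarrow> d a b"
proof -
  have ab: "a \<in> cball p R" "b \<in> cball p R"
    using assms closed_sequentially[OF closed_cball] by metis+
  have "(\<lambda>n. M * norm (X n - a) + M * norm (Y n - b)) \<longlonglongrightarrow> M * norm (a - a) + M * norm (b - b)"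
    by (intro tendsto_intros assms)
  then have lim: "(\<lambda>n. M * norm (X n - a) + M * norm (Y n - b)) \<longlonglongrightarrow> 0" by simp
  have "\<forall>\<^sub>F n in sequentially. norm (d (X n) (Y n) - d a b) \<le> M * norm (X n - a) + M * norm (Y n - b)"
    by (rule always_eventually) (simp only: real_norm_def d_lipschitz[OF assms(1,2) ab] simp_thms)
  from Lim_null_comparison[OF this lim] show ?thesis by (simp add: LIM_zero_iff)
qed

lemma continuous_d:
  assumes "continuous_on X a" "continuous_on X b" "\<And>s. s \<in> X \<Longrightarrow> a s \<in> cball p R" "\<And>s. s \<in> X \<Longrightarrow> b s \<in> cball p R"
  shows "continuous_on X (\<lambda>s. d (a s) (b s))"
  unfolding continuous_on_def
proof
  fix s assume s: "s \<in> X"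
  have "((\<lambda>x. M * norm (a x - a s) + M * norm (b x - b s)) \<longlongrightarrow> M * norm (a s - a s) + M * norm (b s - b s)) (at s within X)"
    using assms(1,2) s by (intro tendsto_intros) (auto simp: continuous_on_def)
  then have lim: "((\<lambda>x. M * norm (a x - a s) + M * norm (b x - b s)) \<longlongrightarrow> 0) (at s within X)" by simp
  have "\<forall>\<^sub>F x in at s within X. norm (d (a x) (b x) - d (a s) (b s)) \<le> M * norm (a x - a s) + M * norm (b x - b s)"
    unfolding eventually_at_filter real_norm_def
    by (intro always_eventually allI impI d_lipschitz assms(3,4) s)
  from Lim_null_comparison[OF this lim] show "((\<lambda>x. d (a x) (b x)) \<longlongrightarrow> d (a s) (b s)) (at s within X)" by (simp add: LIM_zero_iff)
qed

text \<open>The halfway point of a curve that is too long by less than \<open>e\<close> is a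
  midpoint up to \<open>e / 2\<close>. Minimizing the larger of the two distances over a compact
  ball therefore produces an exact one.\<close>

lemma midpoint_exists:
  assumes z: "z1 \<in> cball p (R/4)" "z2 \<in> cball p (R/4)" and l: "d z1 z2 < m * (R/4)"
  shows "\<exists>z\<in>cball p (R/2). d z1 z \<le> d z1 z2 / 2 \<and> d z z2 \<le> d z1 z2 / 2"
proof -
  have zR: "z1 \<in> cball p R" "z2 \<in> cball p R" "z1 \<in> cball p (R/2)" using z R_pos by auto
  define F where "F z = max (d z1 z) (d z z2)" for z
  have "continuous_on (cball p (R/2)) F"
    unfolding F_def using zR R_pos by (intro continuous_on_max continuous_d continuous_intros) auto
  moreover have "cball p (R/2) \<noteq> {}" using R_pos by auto
  ultimately obtain z where zz: "z \<in> cball p (R/2)" "\<And>y. y \<in> cball p (R/2) \<Longrightarrow> F z \<le> F y"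
    using continuous_attains_inf[OF compact_cball] by metis
  have "2 * F z \<le> d z1 z2"
  proof (rule field_le_epsilon)
    fix e :: real assume e: "e > 0"
    \<comment> \<open>The second term keeps the curve shorter than \<open>m * (R/4)\<close>, so its
      halfway point is within \<open>R/4\<close> of \<open>z1\<close> and competes in the
      minimization of \<open>F\<close>.\<close>
    define e' where "e' = min e (m * (R/4) - d z1 z2)"
    have e': "e' > 0" using e l by (simp add: e'_def)
    obtain \<gamma> \<gamma>' where c: "curve_from_to z1 z2 \<gamma> \<gamma>'" "len \<gamma> \<gamma>' < d z1 z2 + e'"
      using d_approx[OF joined_ball[OF zR(1,2)] e'] by blast
    have l: "len \<gamma> \<gamma>' < m * (R/4)" using c(2) by (simp add: e'_def)
    define I where "I s = integral {0..s} (\<lambda>t. L (\<gamma> t) (\<gamma>' t))" for s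
    have "continuous_on {0..1} I" unfolding I_def
      by (rule indefinite_integral_continuous_1[OF curve_integrable[OF c(1)]])
    moreover have "I 0 = 0" "I 1 = len \<gamma> \<gamma>'" by (auto simp: I_def len_def)
    ultimately obtain s where s: "s \<in> {0..1}" "I s = len \<gamma> \<gamma>' / 2"
      using IVT'[of I 0 "len \<gamma> \<gamma>' / 2" 1] len_nonneg[OF c(1)] by auto
    have "I s + integral {s..1} (\<lambda>t. L (\<gamma> t) (\<gamma>' t)) = len \<gamma> \<gamma>'"
      unfolding I_def len_def using s by (intro Henstock_Kurzweil_Integration.integral_combine curve_integrable[OF c(1)]) auto
    then have s2: "integral {s..1} (\<lambda>t. L (\<gamma> t) (\<gamma>' t)) = len \<gamma> \<gamma>' / 2" using s by simp
    have ends: "\<gamma> 0 = z1" "\<gamma> 1 = z2" using c(1) by (auto simp: curve_from_to_def)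
    have "norm (\<gamma> s - z1) < R/4" by (rule stays[OF c(1) zR(3) _ _ l s(1)]) (use R_pos in auto)
    then have "\<gamma> s \<in> cball p (R/2)" by (intro cball_add[OF z(1), of _ "R/4"]) auto
    then have "F z \<le> F (\<gamma> s)" by (rule zz(2))
    moreover have "d z1 (\<gamma> s) \<le> len \<gamma> \<gamma>' / 2"
      using subcurve[OF c(1), of 0 s] s d_le ends unfolding I_def by fastforce
    moreover have "d (\<gamma> s) z2 \<le> len \<gamma> \<gamma>' / 2"
      using subcurve[OF c(1), of s 1] s s2 d_le ends by fastforce
    ultimately have "2 * F z \<le> len \<gamma> \<gamma>'" by (auto simp: F_def max_def split: if_splits)
    then show "2 * F z \<le> d z1 z2 + e" using c(2) by (simp add: e'_def)
  qed
  then show ?thesis using zz(1) by (intro bexI[of _ z]) (auto simp: F_def)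
qed

end

section \<open>Shortest paths as limits of iterated midpoints\<close>

lemma convergent_geometric:
  fixes X :: "nat \<Rightarrow> 'a::banach"
  assumes "\<And>n. norm (X (Suc n) - X n) \<le> c * r ^ n" "0 \<le> r" "r < 1"
  shows "convergent X"
proof -
  have "summable (\<lambda>n. c * r ^ n)" using assms(2,3) by (intro summable_mult summable_geometric) auto
  then have "summable (\<lambda>n. X (Suc n) - X n)" by (rule summable_comparison_test'[of _ 0]) (use assms(1) in auto)
  then have "convergent (\<lambda>n. \<Sum>i<n. X (Suc i) - X i)" by (simp add: summable_iff_convergent)
  then have "convergent (\<lambda>n. X n - X 0)" by (simp add: sum_lessThan_telescope)
  then show ?thesis using convergent_diff_const_right_iff[of X "X 0"] by simp
qed

lemma floor_dyadic_tendsto: "(\<lambda>n. real_of_int \<lfloor>2 ^ n * t\<rfloor> / 2 ^ n) \<longlonglongrightarrow> t"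
proof -
  have "(\<lambda>n. (1/2::real) ^ n) \<longlonglongrightarrow> 0" by (rule LIMSEQ_realpow_zero) auto
  moreover have "\<forall>\<^sub>F n in sequentially. norm (real_of_int \<lfloor>2 ^ n * t\<rfloor> / 2 ^ n - t) \<le> (1/2) ^ n"
  proof (intro always_eventually allI)
    fix n :: nat
    have "real_of_int \<lfloor>2 ^ n * t\<rfloor> / 2 ^ n - t = (real_of_int \<lfloor>2 ^ n * t\<rfloor> - 2 ^ n * t) / 2 ^ n"
      by (simp add: field_simps)
    moreover have "\<bar>real_of_int \<lfloor>2 ^ n * t\<rfloor> - 2 ^ n * t\<bar> \<le> 1" by linarith
    ultimately show "norm (real_of_int \<lfloor>2 ^ n * t\<rfloor> / 2 ^ n - t) \<le> (1/2) ^ n"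
      by (simp add: power_one_over abs_divide divide_right_mono)
  qed
  ultimately have "(\<lambda>n. real_of_int \<lfloor>2 ^ n * t\<rfloor> / 2 ^ n - t) \<longlonglongrightarrow> 0"
    by (rule Lim_null_comparison[rotated])
  then show ?thesis by (simp add: LIM_zero_iff)
qed

context metric_ball begin

definition mid :: "'a \<Rightarrow> 'a \<Rightarrow> 'a" where
  "mid z1 z2 = (SOME z. z \<in> cball p (R/2) \<and> d z1 z \<le> d z1 z2 / 2 \<and> d z z2 \<le> d z1 z2 / 2)"

lemma mid:
  assumes "z1 \<in> cball p (R/4)" "z2 \<in> cball p (R/4)" "d z1 z2 < m * (R/4)"
  shows "mid z1 z2 \<in> cball p (R/2)" "d z1 (mid z1 z2) \<le> d z1 z2 / 2" "d (mid z1 z2) z2 \<le> d z1 z2 / 2"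
proof -
  have "mid z1 z2 \<in> cball p (R/2) \<and> d z1 (mid z1 z2) \<le> d z1 z2 / 2 \<and> d (mid z1 z2) z2 \<le> d z1 z2 / 2"
    unfolding mid_def by (rule someI_ex) (use midpoint_exists[OF assms] in blast)
  then show "mid z1 z2 \<in> cball p (R/2)" "d z1 (mid z1 z2) \<le> d z1 z2 / 2" "d (mid z1 z2) z2 \<le> d z1 z2 / 2" by auto
qed

text \<open>\<open>node x y n k\<close> stands for the point at time \<open>k / 2 ^ n\<close>; even
  indices repeat the coarser level. Only \<open>k \<le> 2 ^ n\<close> has a meaning.\<close>

primrec node :: "'a \<Rightarrow> 'a \<Rightarrow> nat \<Rightarrow> nat \<Rightarrow> 'a" where
  "node x y 0 k = (if k = 0 then x else y)"
| "node x y (Suc n) k = (if even k then node x y n (k div 2) else mid (node x y n (k div 2)) (node x y n (Suc (k div 2))))"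

context
  fixes x y :: 'a
  assumes xy: "x \<in> cball p (R/8)" "y \<in> cball p (R/8)" and dxy: "d x y < m * (R/8)"
begin

text \<open>The bound on the distance from \<open>x\<close> is what keeps the induction alive.
  \<open>mid\<close> is only known to lie in \<open>cball p (R/2)\<close>, but a distance of at most
  \<open>d x y < m * (R/8)\<close> from \<open>x\<close> puts it within \<open>R/8\<close> of
  \<open>x\<close>, hence in \<open>cball p (R/4)\<close>, where bisection can continue.\<close>

lemma node_invariants:
  "node x y n 0 = x \<and> node x y n (2 ^ n) = y \<and>
   (\<forall>k\<le>2^n. node x y n k \<in> cball p (R/4) \<and> d x (node x y n k) \<le> k * d x y / 2 ^ n) \<and>
   (\<forall>k<2^n. d (node x y n k) (node x y n (Suc k)) \<le> d x y / 2 ^ n)"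
proof (induction n)
  case 0
  have "x \<in> cball p R" using xy R_pos by auto
  then show ?case using xy R_pos d_refl[of x] by (auto simp: le_Suc_eq)
next
  case (Suc n)
  let ?f = "node x y n"
  have D0: "0 \<le> d x y" by (rule d_nonneg[OF joined_ball]) (use xy R_pos in auto)
  have xR: "x \<in> cball p R" "x \<in> cball p (R/2)" using xy R_pos by auto
  have f: "?f 0 = x" "?f (2 ^ n) = y" "\<And>k. k \<le> 2^n \<Longrightarrow> ?f k \<in> cball p (R/4)"
    "\<And>k. k \<le> 2^n \<Longrightarrow> d x (?f k) \<le> k * d x y / 2 ^ n" "\<And>k. k < 2^n \<Longrightarrow> d (?f k) (?f (Suc k)) \<le> d x y / 2 ^ n"
    using Suc by auto
  have odd: "mid (?f j) (?f (Suc j)) \<in> cball p (R/4) \<and> d x (mid (?f j) (?f (Suc j))) \<le> real (2 * j + 1) * d x y / 2 ^ Suc n \<and>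
     d (?f j) (mid (?f j) (?f (Suc j))) \<le> d x y / 2 ^ Suc n \<and> d (mid (?f j) (?f (Suc j))) (?f (Suc j)) \<le> d x y / 2 ^ Suc n"
    if j: "j < 2 ^ n" for j
  proof -
    let ?z = "mid (?f j) (?f (Suc j))"
    have fb: "?f j \<in> cball p (R/4)" "?f (Suc j) \<in> cball p (R/4)" using f(3) j by auto
    have "d (?f j) (?f (Suc j)) \<le> d x y / 2 ^ n" by (rule f(5)[OF j])
    also have "\<dots> \<le> d x y / 1" using D0 by (intro divide_left_mono) auto
    also have "d x y / 1 < m * (R/4)" using dxy mult_strict_left_mono[of "R/8" "R/4" m] m_pos R_pos by linarith
    finally have lt: "d (?f j) (?f (Suc j)) < m * (R/4)" .
    note z = mid[OF fb lt]
    have zR: "?z \<in> cball p R" using cball_mono[OF z(1)] R_pos by simp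
    have fR: "?f j \<in> cball p R" using cball_mono[OF fb(1)] R_pos by simp
    have h: "d (?f j) ?z \<le> d x y / 2 ^ Suc n" "d ?z (?f (Suc j)) \<le> d x y / 2 ^ Suc n"
    proof -
      have "d (?f j) (?f (Suc j)) / 2 \<le> d x y / 2 ^ n / 2" using f(5)[OF j] by (rule divide_right_mono) simp
      also have "\<dots> = d x y / 2 ^ Suc n" by simp
      finally show "d (?f j) ?z \<le> d x y / 2 ^ Suc n" "d ?z (?f (Suc j)) \<le> d x y / 2 ^ Suc n"
        using z(2,3) by (blast intro: order.trans)+
    qed
    have "d x ?z \<le> d x (?f j) + d (?f j) ?z" by (rule d_triangle) (intro joined_ball xR fR zR)+
    also have "\<dots> \<le> j * d x y / 2 ^ n + d x y / 2 ^ Suc n" using f(4)[of j] h j by (intro add_mono) auto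
    also have "\<dots> = (2 * j + 1) * d x y / 2 ^ Suc n" by (simp add: field_simps)
    finally have dz: "d x ?z \<le> real (2 * j + 1) * d x y / 2 ^ Suc n" .
    have "real (2 * j + 1) \<le> real (2 ^ Suc n)" using j unfolding of_nat_le_iff by simp
    then have "real (2 * j + 1) * d x y \<le> real (2 ^ Suc n) * d x y" by (rule mult_right_mono[OF _ D0])
    then have "real (2 * j + 1) * d x y / 2 ^ Suc n \<le> d x y"
      by (subst pos_divide_le_eq) (auto simp: mult.commute)
    with dz have dz': "d x ?z \<le> d x y" by (rule order.trans)
    have mR: "m * (R/8) < m * (R/2)" using m_pos R_pos by simp
    have "m * norm (?z - x) \<le> d x ?z"
      by (rule d_lower'[OF xR(2) joined_ball[OF xR(1) zR]]) (use dz' dxy mR in linarith)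
    also have "\<dots> < m * (R/8)" using dz' dxy by simp
    finally have "norm (?z - x) \<le> R/8" using m_pos by simp
    then have "?z \<in> cball p (R/4)" by (intro cball_add[OF xy(1), of _ "R/8"]) auto
    with h dz show ?thesis by blast
  qed
  show ?case
  proof (intro conjI allI impI)
    show "node x y (Suc n) 0 = x" "node x y (Suc n) (2 ^ Suc n) = y" using f by auto
    fix k :: nat
    {
      assume k: "k \<le> 2 ^ Suc n"
      show "node x y (Suc n) k \<in> cball p (R/4)"
        using k f(3)[of "k div 2"] odd[of "k div 2"] by (cases "even k") (auto elim!: oddE)
      show "d x (node x y (Suc n) k) \<le> k * d x y / 2 ^ Suc n"
      proof (cases "even k")
        case True
        then obtain j where "k = 2 * j" by (elim evenE)
        then show ?thesis using f(4)[of j] k by (simp add: field_simps)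
      next
        case False
        then obtain j where "k = 2 * j + 1" by (elim oddE)
        then show ?thesis using odd[of j] k by (simp add: algebra_simps)
      qed
    }
    assume k: "k < 2 ^ Suc n"
    show "d (node x y (Suc n) k) (node x y (Suc n) (Suc k)) \<le> d x y / 2 ^ Suc n"
    proof (cases "even k")
      case True
      then obtain j where "k = 2 * j" by (elim evenE)
      then show ?thesis using odd[of j] k by simp
    next
      case False
      then obtain j where "k = 2 * j + 1" by (elim oddE)
      then show ?thesis using odd[of j] k by simp
    qed
  qed
qed

lemma node_ball: "k \<le> 2 ^ n \<Longrightarrow> node x y n k \<in> cball p (R/4)" using node_invariants by blast

lemma node_R: "k \<le> 2 ^ n \<Longrightarrow> node x y n k \<in> cball p R"
  by (rule cball_mono[OF node_ball]) (use R_pos in auto)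

text \<open>Neighbouring distances add up to the upper bound. Any loss in it would, along the chain
  from \<open>x\<close> through both nodes to \<open>y\<close>, make \<open>d x y\<close> smaller
  than itself.\<close>

lemma node_dist:
  assumes "i \<le> j" "j \<le> 2 ^ n" shows "d (node x y n i) (node x y n j) = (real j - real i) * d x y / 2 ^ n"
proof -
  have le: "d (node x y n i) (node x y n j) \<le> (real j - real i) * d x y / 2 ^ n" if "i \<le> j" "j \<le> 2 ^ n" for i j
    using that
  proof (induction j rule: dec_induct)
    case base then show ?case using d_refl node_R by simp
  next
    case (step j)
    have "d (node x y n i) (node x y n (Suc j)) \<le> d (node x y n i) (node x y n j) + d (node x y n j) (node x y n (Suc j))"
      by (rule d_triangle) (use step in \<open>auto intro!: joined_ball node_R simp del: mem_cball\<close>)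
    also have "\<dots> \<le> (real j - real i) * d x y / 2 ^ n + d x y / 2 ^ n"
      using step node_invariants[of n] by (intro add_mono) auto
    also have "\<dots> = (real (Suc j) - real i) * d x y / 2 ^ n"
      by (simp add: add_divide_distrib[symmetric] algebra_simps)
    finally show ?case .
  qed
  have j: "joined (node x y n a) (node x y n b)" if "a \<le> 2 ^ n" "b \<le> 2 ^ n" for a b
    using that by (intro joined_ball node_R)
  let ?f = "node x y n"
  have i: "i \<le> 2 ^ n" using assms by simp
  have ends: "?f 0 = x" "?f (2 ^ n) = y" using node_invariants[of n] by auto
  have 1: "d x y \<le> d x (?f i) + d (?f i) y" using d_triangle[OF j[of 0 i] j[of i "2 ^ n"]] i ends by simp
  have 2: "d (?f i) y \<le> d (?f i) (?f j) + d (?f j) y" using d_triangle[OF j[of i j] j[of j "2 ^ n"]] i assms ends by simp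
  have 3: "d x (?f i) \<le> real i * d x y / 2 ^ n" using le[of 0 i] i ends by simp
  have "d (?f j) y \<le> (real (2 ^ n) - real j) * d x y / 2 ^ n" using le[of j "2 ^ n"] assms ends by simp
  also have "\<dots> = d x y - real j * d x y / 2 ^ n" by (simp add: left_diff_distrib diff_divide_distrib)
  finally have 4: "d (?f j) y \<le> d x y - real j * d x y / 2 ^ n" .
  have 5: "(real j - real i) * d x y / 2 ^ n = real j * d x y / 2 ^ n - real i * d x y / 2 ^ n"
    by (simp add: left_diff_distrib diff_divide_distrib)
  show ?thesis
  proof (rule order.antisym[OF le[OF assms]])
    show "(real j - real i) * d x y / 2 ^ n \<le> d (?f i) (?f j)" unfolding 5 using 1 2 3 4 by argo
  qed
qed

lemma geodesic_exists:
  "\<exists>\<gamma>. \<gamma> 0 = x \<and> \<gamma> 1 = y \<and> (\<forall>t\<in>{0..1}. \<gamma> t \<in> cball p (R/4)) \<and>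
     (\<forall>s t. 0 \<le> s \<longrightarrow> s \<le> t \<longrightarrow> t \<le> 1 \<longrightarrow> d (\<gamma> s) (\<gamma> t) = (t - s) * d x y)"
proof -
  \<comment> \<open>Rounding down makes halving compatible:
    \<open>k (Suc n) t div 2 = k n t\<close>. Successive approximations at time \<open>t\<close>
    thus coincide or are neighbours on the finer level, at distance
    \<open>d x y / 2 ^ Suc n\<close>, so they converge at every real time and not only at dyadic
    ones.\<close>
  define k where "k n t = nat \<lfloor>2 ^ n * t\<rfloor>" for n :: nat and t :: real
  define X where "X t n = node x y n (k n t)" for t n
  define \<gamma> where "\<gamma> t = lim (X t)" for t
  have D0: "0 \<le> d x y" by (rule d_nonneg[OF joined_ball]) (use xy R_pos in auto)
  have k_le: "k n t \<le> 2 ^ n" if "t \<in> {0..1}" for n t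
  proof -
    have "2 ^ n * t \<le> real_of_int (2 ^ n)" using that by simp
    then have "\<lfloor>2 ^ n * t\<rfloor> \<le> 2 ^ n" by linarith
    then show ?thesis unfolding k_def by (simp add: nat_le_iff)
  qed
  have k_Suc: "k (Suc n) t div 2 = k n t" if "t \<in> {0..1}" for n t
  proof -
    have "\<lfloor>2 ^ Suc n * t\<rfloor> div 2 = \<lfloor>2 ^ Suc n * t / 2\<rfloor>"
      using floor_divide_real_eq_div[of 2 "2 ^ Suc n * t"] by simp
    then have "\<lfloor>2 ^ Suc n * t\<rfloor> div 2 = \<lfloor>2 ^ n * t\<rfloor>" by (simp add: mult.assoc)
    then show ?thesis unfolding k_def using that by (metis nat_div_as_int nat_int nat_numeral_as_int nat_div_distrib' zero_le_numeral)
  qed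
  have XR: "X t n \<in> cball p (R/4)" "X t n \<in> cball p R" "X t n \<in> cball p (R/2)" if "t \<in> {0..1}" for t n
  proof -
    show X: "X t n \<in> cball p (R/4)" unfolding X_def by (rule node_ball[OF k_le[OF that]])
    show "X t n \<in> cball p R" "X t n \<in> cball p (R/2)"
      by (rule cball_mono[OF X], use R_pos in simp)+
  qed
  have step: "norm (X t (Suc n) - X t n) \<le> (d x y / m) * (1/2) ^ n" if t: "t \<in> {0..1}" for t n
  proof (cases "even (k (Suc n) t)")
    case True
    then have "X t (Suc n) = X t n" using k_Suc[OF t] by (simp add: X_def)
    then show ?thesis using D0 m_pos by simp
  next
    case False
    have kk: "k n t < 2 ^ n"
    proof (rule ccontr)
      assume "\<not> ?thesis"
      then have "k n t = 2 ^ n" using k_le[OF t, of n] by simp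
      then have "k (Suc n) t = 2 * 2 ^ n + 1" using False k_Suc[OF t, of n] by (metis odd_two_times_div_two_succ)
      then show False using k_le[OF t, of "Suc n"] by simp
    qed
    define j where "j = k (Suc n) t"
    have j: "j \<le> 2 ^ Suc n" "j = Suc (2 * k n t)"
      using k_le[OF t, of "Suc n"] odd_two_times_div_two_succ[OF False] k_Suc[OF t, of n] unfolding j_def by auto
    have eq: "X t n = node x y (Suc n) (2 * k n t)" by (simp add: X_def)
    have "d (X t n) (X t (Suc n)) = d x y / 2 ^ Suc n"
      using node_dist[of "2 * k n t" j "Suc n"] j unfolding eq by (simp add: X_def j_def[symmetric])
    also have "\<dots> \<le> d x y / 1" using D0 one_le_power[of "2::real" "Suc n"] by (intro divide_left_mono) auto
    finally have "d (X t n) (X t (Suc n)) \<le> d x y" by simp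
    moreover have "m * (R/8) < m * (R/2)" using m_pos R_pos by simp
    ultimately have "d (X t n) (X t (Suc n)) < m * (R/2)" using dxy by linarith
    from d_lower'[OF XR(3)[OF t] joined_ball[OF XR(2)[OF t] XR(2)[OF t]] this]
    have "m * norm (X t (Suc n) - X t n) \<le> d x y / 2 ^ Suc n"
      using \<open>d (X t n) (X t (Suc n)) = d x y / 2 ^ Suc n\<close> by simp
    also have "\<dots> \<le> d x y * (1/2) ^ n" using D0 by (simp add: field_simps)
    finally show ?thesis using m_pos by (simp add: field_simps)
  qed
  have lim: "X t \<longlonglongrightarrow> \<gamma> t" if "t \<in> {0..1}" for t
    unfolding \<gamma>_def using convergent_geometric[OF step[OF that]] by (simp add: convergent_LIMSEQ_iff)
  have "X 0 = (\<lambda>n. x)" "X 1 = (\<lambda>n. y)"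
    using node_invariants by (auto simp: X_def k_def fun_eq_iff nat_power_eq)
  then have "\<gamma> 0 = x" "\<gamma> 1 = y" by (simp_all add: \<gamma>_def)
  moreover have "\<gamma> t \<in> cball p (R/4)" if "t \<in> {0..1}" for t
    using closed_sequentially[OF closed_cball _ lim[OF that]] XR(1)[OF that] by blast
  moreover have "d (\<gamma> s) (\<gamma> t) = (t - s) * d x y" if st: "0 \<le> s" "s \<le> t" "t \<le> 1" for s t
  proof -
    have s: "s \<in> {0..1}" and t: "t \<in> {0..1}" using st by auto
    have "(\<lambda>n. d (X s n) (X t n)) \<longlonglongrightarrow> d (\<gamma> s) (\<gamma> t)"
      by (rule tendsto_d[OF XR(2)[OF s] XR(2)[OF t] lim[OF s] lim[OF t]])
    moreover have "(\<lambda>n. d (X s n) (X t n)) \<longlonglongrightarrow> (t - s) * d x y"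
    proof -
      have "d (X s n) (X t n) = (real_of_int \<lfloor>2 ^ n * t\<rfloor> / 2 ^ n - real_of_int \<lfloor>2 ^ n * s\<rfloor> / 2 ^ n) * d x y" for n
      proof -
        have "k n s \<le> k n t" using st unfolding k_def by (intro nat_mono floor_mono mult_left_mono) auto
        moreover have "real (k n r) = real_of_int \<lfloor>2 ^ n * r\<rfloor>" if "0 \<le> r" for r using that by (simp add: k_def)
        ultimately show ?thesis
          using node_dist[of "k n s" "k n t" n] k_le[OF t] st by (simp add: X_def diff_divide_distrib[symmetric])
      qed
      then show ?thesis by (simp only:) (intro tendsto_intros floor_dyadic_tendsto)
    qed
    ultimately show ?thesis by (rule LIMSEQ_unique)
  qed
  ultimately show ?thesis by blast
qed

end

end

subsection \<open>Regularity of geodesics\<close>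

text \<open>The difference quotients at the scales \<open>2\<^sup>-\<^sup>n\<close> form a uniformly Cauchy sequence, and they are the
  derivatives of the averages \<open>2\<^sup>n (F (s + 2\<^sup>-\<^sup>n) - F s)\<close>, where \<open>F\<close> is a primitive of \<open>\<gamma>\<close>.\<close>

lemma C1_of_second_differences:
  fixes \<gamma> :: "real \<Rightarrow> 'a::euclidean_space"
  assumes cont: "continuous_on {0..1} \<gamma>" and b: "0 < b" "b < 1"
    and diff2: "\<And>s h. 0 \<le> s \<Longrightarrow> 0 < h \<Longrightarrow> s + 2 * h \<le> 1 \<Longrightarrow>
      (norm (\<gamma> (s + 2 * h) - 2 *\<^sub>R \<gamma> (s + h) + \<gamma> s))\<^sup>2 \<le> \<kappa> * h ^ 3"
  shows "\<exists>\<gamma>'. continuous_on {0..b} \<gamma>' \<and> (\<forall>t\<in>{0..b}. (\<gamma> has_vector_derivative \<gamma>' t) (at t within {0..b}))"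
proof -
  have "(\<lambda>n. (1/2::real) ^ n) \<longlonglongrightarrow> 0" by (rule LIMSEQ_realpow_zero) auto
  then have "\<forall>\<^sub>F n in sequentially. (1/2::real) ^ n < 1 - b" using b by (simp add: order_tendsto_iff)
  then obtain n0 where n0: "(1/2::real) ^ n0 < 1 - b" by (auto simp: eventually_sequentially)
  \<comment> \<open>Forward quotients at \<open>s \<le> b\<close> need
    \<open>s + h n \<le> 1\<close>; the offset \<open>n0\<close> provides this and is the reason for
    stopping at \<open>b < 1\<close>.\<close>
  define h where "h n = (1/2::real) ^ (n0 + n)" for n
  have h: "h n > 0" "b + h n \<le> 1" "h n = 2 * h (Suc n)" for n
  proof -
    have "h n \<le> (1/2) ^ n0" unfolding h_def by (intro power_decreasing) auto
    then show "b + h n \<le> 1" using n0 by simp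
  qed (auto simp: h_def)
  define q where "q n s = (\<gamma> (s + h n) - \<gamma> s) /\<^sub>R h n" for n s
  have \<kappa>: "\<kappa> \<ge> 0"
  proof -
    have "0 \<le> \<kappa> * (1/2) ^ 3" by (rule order.trans[OF zero_le_power2 diff2[of 0 "1/2"]]) auto
    then show ?thesis by (simp add: power3_eq_cube zero_le_mult_iff)
  qed
  \<comment> \<open>Consecutive quotients differ by a second difference divided by twice the step.
    The former is of order 3/2 in the step, so the quotient is of order 1/2, which is summable over
    dyadic steps.\<close>
  have qd: "norm (q (Suc n) s - q n s) \<le> sqrt \<kappa> * sqrt (1/2) ^ n" if s: "s \<in> {0..b}" for n s
  proof -
    let ?k = "h (Suc n)" and ?D = "\<gamma> (s + 2 * h (Suc n)) - 2 *\<^sub>R \<gamma> (s + h (Suc n)) + \<gamma> s"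
    have k: "?k > 0" by (rule h)
    define i where "i = 1 / (2 * ?k)"
    have i: "inverse ?k = i + i" "inverse (2 * ?k) = i" by (auto simp: i_def inverse_eq_divide)
    have "q (Suc n) s - q n s = (- i) *\<^sub>R ?D"
      unfolding q_def h(3)[of n] i scaleR_2 scaleR_add_left scaleR_diff_right scaleR_add_right scaleR_minus_left
      by simp
    then have "q (Suc n) s - q n s = (- 1 / (2 * ?k)) *\<^sub>R ?D" by (simp add: i_def)
    then have "norm (q (Suc n) s - q n s) = norm ?D / (2 * ?k)" using k by simp
    moreover have "(norm ?D)\<^sup>2 \<le> \<kappa> * ?k ^ 3"
      using s h(2)[of n] h(3)[of n] k by (intro diff2) auto
    then have "norm ?D \<le> sqrt (\<kappa> * ?k ^ 3)" by (simp add: real_le_rsqrt)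
    moreover have "sqrt (\<kappa> * ?k ^ 3) = sqrt \<kappa> * (?k * sqrt ?k)"
      using k by (simp add: real_sqrt_mult power3_eq_cube)
    ultimately have nD: "norm ?D \<le> sqrt \<kappa> * (?k * sqrt ?k)"
      and nq: "norm (q (Suc n) s - q n s) = norm ?D / (2 * ?k)" by auto
    have "norm (q (Suc n) s - q n s) \<le> sqrt \<kappa> * (?k * sqrt ?k) / (2 * ?k)"
      unfolding nq using k by (intro divide_right_mono nD) simp
    also have "\<dots> = sqrt \<kappa> * sqrt ?k / 2" using k by simp
    also have "\<dots> \<le> sqrt \<kappa> * sqrt ?k" using \<kappa> k by simp
    also have "sqrt ?k \<le> sqrt (1/2) ^ n"
    proof -
      have "?k \<le> (1/2) ^ n" unfolding h_def by (intro power_decreasing) auto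
      then show ?thesis by (metis real_sqrt_le_iff real_sqrt_power)
    qed
    finally show ?thesis using \<kappa> by (simp add: mult_left_mono)
  qed
  have sum: "summable (\<lambda>n. sqrt \<kappa> * sqrt (1/2) ^ n)"
    by (intro summable_mult summable_geometric) (simp add: real_sqrt_less_iff[of "1/2" 1, simplified])
  obtain \<gamma>' where unif: "uniform_limit {0..b} q \<gamma>' sequentially"
  proof -
    have "uniform_limit {0..b} (\<lambda>n s. \<Sum>i<n. q (Suc i) s - q i s) (\<lambda>s. \<Sum>i. q (Suc i) s - q i s) sequentially"
      by (rule Weierstrass_m_test[OF _ sum]) (use qd in auto)
    then have "uniform_limit {0..b} (\<lambda>n s. q n s - q 0 s) (\<lambda>s. \<Sum>i. q (Suc i) s - q i s) sequentially"
      by (simp only: sum_lessThan_telescope[of "\<lambda>i. q i s" n for s n])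
    then have "uniform_limit {0..b} (\<lambda>n s. (q n s - q 0 s) + q 0 s) (\<lambda>s. (\<Sum>i. q (Suc i) s - q i s) + q 0 s) sequentially"
      by (intro uniform_limit_add uniform_limit_const)
    then show thesis using that by simp
  qed
  have cq: "continuous_on {0..b} (q n)" for n
    unfolding q_def using b h(1,2)[of n]
    by (intro continuous_intros continuous_on_compose2[OF cont]) auto
  have c\<gamma>': "continuous_on {0..b} \<gamma>'"
    by (rule uniform_limit_theorem[OF _ unif]) (auto intro!: always_eventually cq)
  define F where "F s = integral {0..s} \<gamma>" for s
  have F: "(F has_vector_derivative \<gamma> s) (at s within {0..1})" if "s \<in> {0..1}" for s
    unfolding F_def by (rule integral_has_vector_derivative[OF cont that])
  have Fb: "(F has_vector_derivative \<gamma> s) (at s within {0..b})" if "s \<in> {0..b}" for s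
    by (rule has_vector_derivative_within_subset[OF F]) (use that b in auto)
  have Fs: "((\<lambda>s. F (s + h n)) has_vector_derivative \<gamma> (s + h n)) (at s within {0..b})" if "s \<in> {0..b}" for s n
  proof -
    have "((\<lambda>s. s + h n) has_vector_derivative 1) (at s within {0..b})"
      by (auto intro!: derivative_eq_intros)
    moreover have "(F has_vector_derivative \<gamma> (s + h n)) (at (s + h n) within (\<lambda>s. s + h n) ` {0..b})"
      by (rule has_vector_derivative_within_subset[OF F]) (use that h(1,2)[of n] in auto)
    ultimately show ?thesis using vector_diff_chain_within[of "\<lambda>s. s + h n" 1 s "{0..b}" F] by (simp add: o_def)
  qed
  define G where "G n s = (F (s + h n) - F s) /\<^sub>R h n" for n s
  have G: "(G n has_vector_derivative q n s) (at s within {0..b})" if "s \<in> {0..b}" for n s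
    unfolding G_def q_def using Fs[OF that, of n] Fb[OF that] by (auto intro!: derivative_eq_intros)
  have G_lim: "(\<lambda>n. G n s) \<longlonglongrightarrow> \<gamma> s" if s: "s \<in> {0..b}" for s
  proof -
    have "((\<lambda>y. norm ((F y - F s) - (y - s) *\<^sub>R \<gamma> s) / norm (y - s)) \<longlongrightarrow> 0) (at s within {0..1})"
      using F[of s] s b by (simp add: has_vector_derivative_def has_derivative_iff_norm)
    moreover have "filterlim (\<lambda>n. s + h n) (at s within {0..1}) sequentially"
    proof (rule filterlim_at_withinI)
      show "\<forall>\<^sub>F n in sequentially. s + h n \<in> {0..1} - {s}"
      proof (rule always_eventually, rule allI)
        show "s + h n \<in> {0..1} - {s}" for n using s h(1,2)[of n] by auto
      qed
      have "(\<lambda>n. s + (1/2) ^ n0 * (1/2::real) ^ n) \<longlonglongrightarrow> s + (1/2) ^ n0 * 0"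
        by (intro tendsto_intros LIMSEQ_realpow_zero) auto
      then show "(\<lambda>n. s + h n) \<longlonglongrightarrow> s" by (simp add: h_def power_add)
    qed
    ultimately have lim: "(\<lambda>n. norm ((F (s + h n) - F s) - h n *\<^sub>R \<gamma> s) / norm (h n)) \<longlonglongrightarrow> 0"
      using filterlim_compose[of "\<lambda>y. norm ((F y - F s) - (y - s) *\<^sub>R \<gamma> s) / norm (y - s)" _ _ "\<lambda>n. s + h n"] by fastforce
    have "norm (G n s - \<gamma> s) = norm ((F (s + h n) - F s) - h n *\<^sub>R \<gamma> s) / norm (h n)" for n
    proof -
      have "G n s - \<gamma> s = ((F (s + h n) - F s) - h n *\<^sub>R \<gamma> s) /\<^sub>R h n"
        using h(1)[of n] by (simp add: G_def scaleR_diff_right)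
      then show ?thesis by (simp add: divide_inverse_commute)
    qed
    with lim have "(\<lambda>n. norm (G n s - \<gamma> s)) \<longlonglongrightarrow> 0" by presburger
    then have "(\<lambda>n. G n s - \<gamma> s) \<longlonglongrightarrow> 0" by (rule tendsto_norm_zero_cancel)
    then show ?thesis by (simp add: LIM_zero_iff)
  qed
  have "\<exists>g. \<forall>s\<in>{0..b}. (\<lambda>n. G n s) \<longlonglongrightarrow> g s \<and> (g has_derivative (\<lambda>t. t *\<^sub>R \<gamma>' s)) (at s within {0..b})"
  proof (rule has_derivative_sequence[where S = "{0..b}" and f' = "\<lambda>n s t. t *\<^sub>R q n s" and ?x0.0 = 0 and l = "\<gamma> 0"])
    show "(G n has_derivative (\<lambda>t. t *\<^sub>R q n s)) (at s within {0..b})" if "s \<in> {0..b}" for n s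
      using G[OF that] by (simp add: has_vector_derivative_def)
    fix e :: real assume "e > 0"
    with unif have "\<forall>\<^sub>F n in sequentially. \<forall>s\<in>{0..b}. dist (q n s) (\<gamma>' s) < e" by (rule uniform_limitD)
    then show "\<forall>\<^sub>F n in sequentially. \<forall>s\<in>{0..b}. \<forall>t. norm (t *\<^sub>R q n s - t *\<^sub>R \<gamma>' s) \<le> e * norm t"
    proof (rule eventually_mono, intro ballI allI)
      fix n s t assume "\<forall>s\<in>{0..b}. dist (q n s) (\<gamma>' s) < e" "s \<in> {0..b}"
      then have "norm (q n s - \<gamma>' s) \<le> e" by (auto simp: dist_norm intro: less_imp_le)
      then have "\<bar>t\<bar> * norm (q n s - \<gamma>' s) \<le> \<bar>t\<bar> * e" by (rule mult_left_mono) simp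
      then show "norm (t *\<^sub>R q n s - t *\<^sub>R \<gamma>' s) \<le> e * norm t"
        by (simp add: scaleR_diff_right[symmetric] mult.commute)
    qed
  next
    show "0 \<in> {0..b}" "(\<lambda>n. G n 0) \<longlonglongrightarrow> \<gamma> 0" using G_lim b by auto
  qed auto
  then obtain g where g: "\<And>s. s \<in> {0..b} \<Longrightarrow> (\<lambda>n. G n s) \<longlonglongrightarrow> g s"
    "\<And>s. s \<in> {0..b} \<Longrightarrow> (g has_vector_derivative \<gamma>' s) (at s within {0..b})"
    unfolding has_vector_derivative_def by blast
  have "g s = \<gamma> s" if "s \<in> {0..b}" for s using LIMSEQ_unique[OF g(1)[OF that] G_lim[OF that]] .
  then have "(\<gamma> has_vector_derivative \<gamma>' s) (at s within {0..b})" if "s \<in> {0..b}" for s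
    using has_vector_derivative_transform[of s "{0..b}" \<gamma> g] g(2) that by metis
  with c\<gamma>' show ?thesis by blast
qed

section \<open>Minimizing paths are straight\<close>

context metric_field begin

text \<open>Projective flatness expressed by \<open>L\<close> and explicit derivatives, so that the
  Riemannian analysis does not refer to indicatrices.\<close>

definition minimizers_straight :: bool where
  "minimizers_straight \<longleftrightarrow> (\<forall>a b \<gamma> \<gamma>'. a < b \<longrightarrow>
     (\<forall>t\<in>{a..b}. (\<gamma> has_vector_derivative \<gamma>' t) (at t)) \<longrightarrow> continuous_on {a..b} \<gamma>' \<longrightarrow> \<gamma> ` {a..b} \<subseteq> U \<longrightarrow>
     (\<forall>\<delta> \<delta>'. (\<forall>t\<in>{a..b}. (\<delta> has_vector_derivative \<delta>' t) (at t)) \<longrightarrow> continuous_on {a..b} \<delta>' \<longrightarrow> \<delta> ` {a..b} \<subseteq> U \<longrightarrow>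
        \<delta> a = \<gamma> a \<longrightarrow> \<delta> b = \<gamma> b \<longrightarrow> integral {a..b} (\<lambda>t. L (\<gamma> t) (\<gamma>' t)) \<le> integral {a..b} (\<lambda>t. L (\<delta> t) (\<delta>' t))) \<longrightarrow>
     (\<exists>q r. \<gamma> ` {a..b} = closed_segment q r))"

lemma d_le_C1_curve:
  assumes "a \<le> b" "\<And>t. t \<in> {a..b} \<Longrightarrow> (\<delta> has_vector_derivative \<delta>' t) (at t)"
    "continuous_on {a..b} \<delta>'" "\<delta> ` {a..b} \<subseteq> U"
  shows "d (\<delta> a) (\<delta> b) \<le> integral {a..b} (\<lambda>t. L (\<delta> t) (\<delta>' t))"
proof -
  have "\<And>t. t \<in> {a..b} \<Longrightarrow> \<delta> t \<in> U" using assms(4) by blast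
  from reparametrize[OF assms(1-3) this] show ?thesis using d_le by metis
qed

end

context metric_ball begin

text \<open>The first smallness condition makes \<open>d_lower'\<close> applicable along
  \<open>\<gamma>\<close>; the second bounds its increments so that \<open>d_lower_quadratic\<close>
  applies to every pair of its points.\<close>

context
  fixes x y :: 'a and \<gamma> :: "real \<Rightarrow> 'a"
  assumes small: "d x y < m * (R/8)" "6 * M * d x y \<le> m\<^sup>2 * R"
    and \<gamma>_ends: "\<gamma> 0 = x" "\<gamma> 1 = y"
    and \<gamma>_ball_all: "\<forall>t\<in>{0..1}. \<gamma> t \<in> cball p (R/4)"
    and \<gamma>_d_all: "\<forall>s t. 0 \<le> s \<longrightarrow> s \<le> t \<longrightarrow> t \<le> 1 \<longrightarrow> d (\<gamma> s) (\<gamma> t) = (t - s) * d x y"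
begin

private lemmas \<gamma>_ball = bspec[OF \<gamma>_ball_all]
private lemmas \<gamma>_d = \<gamma>_d_all[rule_format]

lemma \<gamma>_balls: "t \<in> {0..1} \<Longrightarrow> \<gamma> t \<in> cball p (R/2)" "t \<in> {0..1} \<Longrightarrow> \<gamma> t \<in> cball p R"
  by (rule cball_mono[OF \<gamma>_ball], assumption, use R_pos in simp)+

lemma D_nonneg: "0 \<le> d x y"
  using d_nonneg[OF joined_ball[OF \<gamma>_balls(2)[of 0] \<gamma>_balls(2)[of 1]]] \<gamma>_ends by simp

lemma \<gamma>_lipschitz:
  assumes "0 \<le> s" "s \<le> t" "t \<le> 1" shows "norm (\<gamma> t - \<gamma> s) \<le> d x y / m * (t - s)"
proof -
  have s: "s \<in> {0..1}" and t: "t \<in> {0..1}" using assms by auto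
  have "(t - s) * d x y \<le> 1 * d x y" using assms D_nonneg by (intro mult_right_mono) auto
  also have "1 * d x y < m * (R/2)" using small(1) m_pos R_pos mult_strict_left_mono[of "R/8" "R/2" m] by linarith
  finally have "d (\<gamma> s) (\<gamma> t) < m * (R/2)" using \<gamma>_d[OF assms] by simp
  from d_lower'[OF \<gamma>_balls(1)[OF s] joined_ball[OF \<gamma>_balls(2)[OF s] \<gamma>_balls(2)[OF t]] this]
  have "m * norm (\<gamma> t - \<gamma> s) \<le> (t - s) * d x y" using \<gamma>_d[OF assms] by simp
  then show ?thesis using m_pos by (simp add: field_simps)
qed

lemma \<gamma>_cont: "continuous_on {0..1} \<gamma>"
proof (rule lipschitz_on_continuous_on)
  show "(d x y / m)-lipschitz_on {0..1} \<gamma>"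
  proof (rule lipschitz_onI)
    fix s t :: real assume "s \<in> {0..1}" "t \<in> {0..1}"
    then show "dist (\<gamma> s) (\<gamma> t) \<le> d x y / m * dist s t"
      using \<gamma>_lipschitz[of s t] \<gamma>_lipschitz[of t s]
      by (cases "s \<le> t") (auto simp: dist_norm norm_minus_commute)
  qed (use D_nonneg m_pos in auto)
qed

lemma \<gamma>_quadratic:
  obtains K where "K \<ge> 0" "\<And>s t. 0 \<le> s \<Longrightarrow> s \<le> t \<Longrightarrow> t \<le> 1 \<Longrightarrow> \<bar>L (\<gamma> s) (\<gamma> t - \<gamma> s) - (t - s) * d x y\<bar> \<le> K * (t - s)\<^sup>2"
proof -
  define Q where "Q = C + 6 * C * M\<^sup>2 / m\<^sup>2"
  have Q: "Q \<ge> 0" "C \<le> Q" "6 * C * M\<^sup>2 / m\<^sup>2 \<le> Q" using C_nonneg by (auto simp: Q_def)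
  show thesis
  proof (rule that[of "Q * (d x y / m)\<^sup>2"])
    show "0 \<le> Q * (d x y / m)\<^sup>2" using Q by simp
    fix s t :: real assume st: "0 \<le> s" "s \<le> t" "t \<le> 1"
    then have s: "s \<in> {0..1}" and t: "t \<in> {0..1}" by auto
    let ?n = "norm (\<gamma> t - \<gamma> s)"
    have n: "?n \<le> d x y / m * (t - s)" by (rule \<gamma>_lipschitz[OF st])
    also have "\<dots> \<le> d x y / m * 1" using st D_nonneg m_pos by (intro mult_left_mono) auto
    finally have "3 * M * ?n \<le> 3 * M * (d x y / m * 1)" by (rule mult_left_mono) (use M_pos in simp)
    also have "\<dots> \<le> m * (R/2)" using small(2) m_pos by (simp add: field_simps power2_eq_square)
    finally have "L (\<gamma> s) (\<gamma> t - \<gamma> s) \<le> d (\<gamma> s) (\<gamma> t) + 6 * C * M\<^sup>2 / m\<^sup>2 * ?n\<^sup>2"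
      by (rule d_lower_quadratic[OF \<gamma>_balls(1)[OF s] \<gamma>_balls(2)[OF t]])
    moreover have "d (\<gamma> s) (\<gamma> t) \<le> L (\<gamma> s) (\<gamma> t - \<gamma> s) + C * ?n\<^sup>2"
      by (rule d_upper_quadratic[OF \<gamma>_balls(2)[OF s] \<gamma>_balls(2)[OF t]])
    moreover have "6 * C * M\<^sup>2 / m\<^sup>2 * ?n\<^sup>2 \<le> Q * ?n\<^sup>2" "C * ?n\<^sup>2 \<le> Q * ?n\<^sup>2"
      by (intro mult_right_mono Q zero_le_power2)+
    moreover have "?n\<^sup>2 \<le> (d x y / m * (t - s))\<^sup>2" using n by (intro power_mono) auto
    then have "Q * ?n\<^sup>2 \<le> Q * (d x y / m * (t - s))\<^sup>2" using Q(1) by (rule mult_left_mono)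
    moreover have "Q * (d x y / m * (t - s))\<^sup>2 = Q * (d x y / m)\<^sup>2 * (t - s)\<^sup>2" by (simp only: power_mult_distrib mult.assoc)
    ultimately show "\<bar>L (\<gamma> s) (\<gamma> t - \<gamma> s) - (t - s) * d x y\<bar> \<le> Q * (d x y / m)\<^sup>2 * (t - s)\<^sup>2"
      unfolding \<gamma>_d[OF st] by linarith
  qed
qed

text \<open>Measured in the norm at \<open>\<gamma> s\<close>, consecutive increments
  \<open>A\<close> and \<open>B\<close> have length at most \<open>h * D\<close> and their sum at
  least \<open>2 * h * D\<close>, up to errors quadratic in \<open>h\<close>. In the parallelogram
  law the leading terms cancel, which leaves order \<open>h ^ 3\<close>.\<close>

lemma \<gamma>_second_differences:
  "\<exists>\<kappa>. \<forall>s h. 0 \<le> s \<longrightarrow> 0 < h \<longrightarrow> s + 2 * h \<le> 1 \<longrightarrow> (norm (\<gamma> (s + 2 * h) - 2 *\<^sub>R \<gamma> (s + h) + \<gamma> s))\<^sup>2 \<le> \<kappa> * h ^ 3"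
proof -
  obtain K where K: "K \<ge> 0" "\<And>s t. 0 \<le> s \<Longrightarrow> s \<le> t \<Longrightarrow> t \<le> 1 \<Longrightarrow> \<bar>L (\<gamma> s) (\<gamma> t - \<gamma> s) - (t - s) * d x y\<bar> \<le> K * (t - s)\<^sup>2"
    using \<gamma>_quadratic by blast
  define D where "D = d x y"
  have D0: "D \<ge> 0" using D_nonneg by (simp add: D_def)
  define k where "k = 4 * K + C * (D / m)\<^sup>2"
  have k0: "k \<ge> 0" using K(1) C_nonneg by (simp add: k_def)
  show ?thesis
  proof (intro exI allI impI)
    fix s h :: real assume sh: "0 \<le> s" "0 < h" "s + 2 * h \<le> 1"
    have s: "s \<in> {0..1}" "s + h \<in> {0..1}" using sh by auto
    have sU: "\<gamma> s \<in> U" by (rule in_U[OF \<gamma>_balls(2)[OF s(1)]])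
    define A where "A = \<gamma> (s + h) - \<gamma> s"
    define B where "B = \<gamma> (s + 2 * h) - \<gamma> (s + h)"
    have AB: "B + A = \<gamma> (s + 2 * h) - \<gamma> s" "B - A = \<gamma> (s + 2 * h) - 2 *\<^sub>R \<gamma> (s + h) + \<gamma> s"
      by (simp_all add: A_def B_def scaleR_2)
    have nA: "norm A \<le> D / m * h" and nB: "norm B \<le> D / m * h"
      using \<gamma>_lipschitz[of s "s + h"] \<gamma>_lipschitz[of "s + h" "s + 2 * h"] sh by (auto simp: A_def B_def D_def)
    have Ks: "K * h\<^sup>2 \<le> k * h\<^sup>2" "K * h\<^sup>2 + C * (D / m)\<^sup>2 * h\<^sup>2 \<le> k * h\<^sup>2" "K * (2 * h)\<^sup>2 \<le> k * h\<^sup>2"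
    proof -
      have "0 \<le> K * h\<^sup>2" "0 \<le> C * (D / m)\<^sup>2 * h\<^sup>2" using K(1) C_nonneg by auto
      moreover have "k * h\<^sup>2 = 4 * (K * h\<^sup>2) + C * (D / m)\<^sup>2 * h\<^sup>2" "K * (2 * h)\<^sup>2 = 4 * (K * h\<^sup>2)"
        by (auto simp: k_def algebra_simps)
      ultimately show "K * h\<^sup>2 \<le> k * h\<^sup>2" "K * h\<^sup>2 + C * (D / m)\<^sup>2 * h\<^sup>2 \<le> k * h\<^sup>2" "K * (2 * h)\<^sup>2 \<le> k * h\<^sup>2"
        by linarith+
    qed
    have LA: "L (\<gamma> s) A \<le> h * D + k * h\<^sup>2"
    proof -
      have "\<bar>L (\<gamma> s) A - h * D\<bar> \<le> K * h\<^sup>2" using K(2)[of s "s + h"] sh by (simp add: A_def D_def)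
      then show ?thesis using Ks(1) by linarith
    qed
    have LAB: "2 * h * D - k * h\<^sup>2 \<le> L (\<gamma> s) (B + A)"
    proof -
      have "\<bar>L (\<gamma> s) (B + A) - 2 * h * D\<bar> \<le> K * (2 * h)\<^sup>2" using K(2)[of s "s + 2 * h"] sh unfolding AB by (simp add: D_def)
      then show ?thesis using Ks(3) by linarith
    qed
    have "L (\<gamma> s) B \<le> L (\<gamma> (s + h)) B + C * norm (\<gamma> s - \<gamma> (s + h)) * norm B"
      using L_lipschitz[OF \<gamma>_balls(2)[OF s(1)] \<gamma>_balls(2)[OF s(2)], of B] by linarith
    also have "C * norm (\<gamma> s - \<gamma> (s + h)) * norm B \<le> C * (D / m * h) * (D / m * h)"
      using nA nB C_nonneg D0 m_pos sh by (intro mult_mono) (auto simp: A_def norm_minus_commute)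
    also have "\<dots> = C * (D / m)\<^sup>2 * h\<^sup>2" by (simp add: power2_eq_square)
    also have "L (\<gamma> (s + h)) B \<le> h * D + K * h\<^sup>2"
    proof -
      have "\<bar>L (\<gamma> (s + h)) B - h * D\<bar> \<le> K * h\<^sup>2" using K(2)[of "s + h" "s + 2 * h"] sh by (simp add: B_def D_def)
      then show ?thesis by linarith
    qed
    finally have LB: "L (\<gamma> s) B \<le> h * D + k * h\<^sup>2" using Ks(2) by simp
    have "(L (\<gamma> s) A)\<^sup>2 \<le> (h * D + k * h\<^sup>2)\<^sup>2" "(L (\<gamma> s) B)\<^sup>2 \<le> (h * D + k * h\<^sup>2)\<^sup>2"
      using LA LB by (auto intro!: power_mono L_nonneg[OF sU])
    \<comment> \<open>The lower bound for \<open>L (\<gamma> s) (B + A)\<close> may be negative and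
      cannot be squared. The tangent inequality \<open>X * X \<ge> 2 * c * X - c * c\<close> with
      \<open>c = 2 * h * D\<close> takes its place.\<close>
    moreover have "4 * h\<^sup>2 * D\<^sup>2 - 4 * h ^ 3 * D * k \<le> (L (\<gamma> s) (B + A))\<^sup>2"
    proof -
      have "0 \<le> (L (\<gamma> s) (B + A) - 2 * h * D)\<^sup>2" by simp
      then have "4 * h * D * L (\<gamma> s) (B + A) - 4 * h\<^sup>2 * D\<^sup>2 \<le> (L (\<gamma> s) (B + A))\<^sup>2"
        by (simp add: power2_eq_square algebra_simps)
      moreover have "4 * h * D * (2 * h * D - k * h\<^sup>2) \<le> 4 * h * D * L (\<gamma> s) (B + A)"
        using LAB sh D0 by (intro mult_left_mono) auto
      ultimately show ?thesis by (simp add: power2_eq_square power3_eq_cube algebra_simps)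
    qed
    ultimately have "(L (\<gamma> s) (B - A))\<^sup>2 \<le> 4 * (h * D + k * h\<^sup>2)\<^sup>2 - (4 * h\<^sup>2 * D\<^sup>2 - 4 * h ^ 3 * D * k)"
      using parallelogram[OF sU, of B A] by linarith
    also have "\<dots> = 12 * D * k * h ^ 3 + 4 * k\<^sup>2 * h * h ^ 3"
      by (simp add: power2_eq_square power3_eq_cube algebra_simps)
    also have "\<dots> \<le> 12 * D * k * h ^ 3 + 4 * k\<^sup>2 * 1 * h ^ 3"
      using sh by (intro add_left_mono mult_right_mono mult_left_mono) auto
    finally have 1: "(L (\<gamma> s) (B - A))\<^sup>2 \<le> (12 * D * k + 4 * k\<^sup>2) * h ^ 3" by (simp add: algebra_simps)
    have "(m * norm (B - A))\<^sup>2 \<le> (L (\<gamma> s) (B - A))\<^sup>2"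
      using m_pos by (intro power_mono L_lower \<gamma>_balls s) auto
    with 1 have "m\<^sup>2 * (norm (B - A))\<^sup>2 \<le> (12 * D * k + 4 * k\<^sup>2) * h ^ 3" by (simp add: power_mult_distrib)
    then show "(norm (\<gamma> (s + 2 * h) - 2 *\<^sub>R \<gamma> (s + h) + \<gamma> s))\<^sup>2 \<le> (12 * D * k + 4 * k\<^sup>2) / m\<^sup>2 * h ^ 3"
      unfolding AB(2)[symmetric] using m_pos by (simp add: field_simps)
  qed
qed

text \<open>On the open interval derivatives become two-sided. The speed is constant because an
  increment over time \<open>e\<close> has frozen length \<open>e * d x y\<close> up to a quadratic
  error, and dividing by \<open>e\<close> passes to the limit.\<close>

lemma \<gamma>_C1:
  assumes b: "0 < b" "b < 1"
  obtains \<gamma>' where "continuous_on {0<..<b} \<gamma>'" "\<And>t. t \<in> {0<..<b} \<Longrightarrow> (\<gamma> has_vector_derivative \<gamma>' t) (at t)"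
    "\<And>t. t \<in> {0<..<b} \<Longrightarrow> L (\<gamma> t) (\<gamma>' t) = d x y"
proof -
  obtain \<kappa> where \<kappa>: "\<And>s h. 0 \<le> s \<Longrightarrow> 0 < h \<Longrightarrow> s + 2 * h \<le> 1 \<Longrightarrow> (norm (\<gamma> (s + 2 * h) - 2 *\<^sub>R \<gamma> (s + h) + \<gamma> s))\<^sup>2 \<le> \<kappa> * h ^ 3"
    using \<gamma>_second_differences by blast
  obtain \<gamma>' where g: "continuous_on {0..b} \<gamma>'" "\<And>t. t \<in> {0..b} \<Longrightarrow> (\<gamma> has_vector_derivative \<gamma>' t) (at t within {0..b})"
    using C1_of_second_differences[OF \<gamma>_cont b \<kappa>] by blast
  have der: "(\<gamma> has_vector_derivative \<gamma>' t) (at t)" if t: "t \<in> {0<..<b}" for t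
  proof -
    have "(\<gamma> has_vector_derivative \<gamma>' t) (at t within {0<..<b})"
      by (rule has_vector_derivative_within_subset[OF g(2)]) (use t in auto)
    then show ?thesis using at_within_open[OF t] by simp
  qed
  obtain K where K: "K \<ge> 0" "\<And>s t. 0 \<le> s \<Longrightarrow> s \<le> t \<Longrightarrow> t \<le> 1 \<Longrightarrow> \<bar>L (\<gamma> s) (\<gamma> t - \<gamma> s) - (t - s) * d x y\<bar> \<le> K * (t - s)\<^sup>2"
    using \<gamma>_quadratic by blast
  have "L (\<gamma> t) (\<gamma>' t) = d x y" if t: "t \<in> {0<..<b}" for t
  proof -
    have tU: "\<gamma> t \<in> U" by (rule in_U[OF \<gamma>_balls(2)]) (use t b in auto)
    define e where "e n = (1 - t) / real (n + 1)" for n :: nat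
    have e: "e n > 0" "t + e n \<le> 1" for n
    proof -
      show "e n > 0" using t b by (simp add: e_def)
      have "e n \<le> (1 - t) / 1" unfolding e_def using t b by (intro divide_left_mono) auto
      then show "t + e n \<le> 1" by simp
    qed
    have e0: "e \<longlonglongrightarrow> 0"
      unfolding e_def using tendsto_mult[OF tendsto_const[of "1 - t"] LIMSEQ_inverse_real_of_nat]
      by (simp add: divide_inverse add.commute)
    have "((\<lambda>s. norm ((\<gamma> s - \<gamma> t) - (s - t) *\<^sub>R \<gamma>' t) / norm (s - t)) \<longlongrightarrow> 0) (at t)"
      using der[OF t] by (simp add: has_vector_derivative_def has_derivative_iff_norm)
    moreover have "filterlim (\<lambda>n. t + e n) (at t) sequentially"
    proof (rule filterlim_atI)
      show "(\<lambda>n. t + e n) \<longlonglongrightarrow> t" using tendsto_add[OF tendsto_const[of t] e0] by simp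
      show "\<forall>\<^sub>F n in sequentially. t + e n \<noteq> t" using e(1) by (auto intro!: always_eventually simp: less_imp_neq[symmetric])
    qed
    ultimately have "(\<lambda>n. norm ((\<gamma> (t + e n) - \<gamma> t) - (t + e n - t) *\<^sub>R \<gamma>' t) / norm (t + e n - t)) \<longlonglongrightarrow> 0"
      by (rule filterlim_compose)
    moreover have "norm ((\<gamma> (t + e n) - \<gamma> t) - (t + e n - t) *\<^sub>R \<gamma>' t) / norm (t + e n - t) = norm ((\<gamma> (t + e n) - \<gamma> t) /\<^sub>R e n - \<gamma>' t)" for n
    proof -
      have "(\<gamma> (t + e n) - \<gamma> t) /\<^sub>R e n - \<gamma>' t = ((\<gamma> (t + e n) - \<gamma> t) - e n *\<^sub>R \<gamma>' t) /\<^sub>R e n"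
        using e(1)[of n] by (simp add: scaleR_diff_right)
      then show ?thesis using e(1)[of n] by (simp add: divide_inverse_commute)
    qed
    ultimately have "(\<lambda>n. norm ((\<gamma> (t + e n) - \<gamma> t) /\<^sub>R e n - \<gamma>' t)) \<longlonglongrightarrow> 0" by (simp only:)
    then have lim: "(\<lambda>n. (\<gamma> (t + e n) - \<gamma> t) /\<^sub>R e n) \<longlonglongrightarrow> \<gamma>' t"
      by (rule LIM_zero_cancel[OF tendsto_norm_zero_cancel])
    have "continuous_on UNIV (L (\<gamma> t))" by (intro continuous_on_L continuous_intros) (rule tU)
    from continuous_on_tendsto_compose[OF this lim]
    have "(\<lambda>n. L (\<gamma> t) ((\<gamma> (t + e n) - \<gamma> t) /\<^sub>R e n)) \<longlonglongrightarrow> L (\<gamma> t) (\<gamma>' t)" by simp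
    moreover have "(\<lambda>n. L (\<gamma> t) ((\<gamma> (t + e n) - \<gamma> t) /\<^sub>R e n)) \<longlonglongrightarrow> d x y"
    proof -
      have "norm (L (\<gamma> t) ((\<gamma> (t + e n) - \<gamma> t) /\<^sub>R e n) - d x y) \<le> K * e n" for n
      proof -
        have "L (\<gamma> t) ((\<gamma> (t + e n) - \<gamma> t) /\<^sub>R e n) = L (\<gamma> t) (\<gamma> (t + e n) - \<gamma> t) / e n"
          using L_scale[OF tU, of "inverse (e n)"] e(1)[of n] by (simp add: divide_inverse_commute)
        then have "L (\<gamma> t) ((\<gamma> (t + e n) - \<gamma> t) /\<^sub>R e n) - d x y = (L (\<gamma> t) (\<gamma> (t + e n) - \<gamma> t) - e n * d x y) / e n"
          using e(1)[of n] by (simp add: field_simps)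
        moreover have "\<bar>L (\<gamma> t) (\<gamma> (t + e n) - \<gamma> t) - e n * d x y\<bar> \<le> K * (e n)\<^sup>2"
          using K(2)[of t "t + e n"] e[of n] t by auto
        ultimately show ?thesis using e(1)[of n] by (simp add: abs_divide divide_le_eq power2_eq_square mult.assoc)
      qed
      then have ev: "\<forall>\<^sub>F n in sequentially. norm (L (\<gamma> t) ((\<gamma> (t + e n) - \<gamma> t) /\<^sub>R e n) - d x y) \<le> K * e n"
        by (intro always_eventually allI)
      have "(\<lambda>n. K * e n) \<longlonglongrightarrow> 0" using tendsto_mult[OF tendsto_const[of K] e0] by simp
      from Lim_null_comparison[OF ev this] show ?thesis by (rule LIM_zero_cancel)
    qed
    ultimately show ?thesis by (rule LIMSEQ_unique)
  qed note speed = this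
  show thesis
  proof (rule that)
    show "continuous_on {0<..<b} \<gamma>'" by (rule continuous_on_subset[OF g(1)]) auto
  qed (fact der, fact speed)
qed

context
  assumes straight: minimizers_straight
begin

text \<open>Constant speed gives the arc over \<open>[a,b]\<close> the length
  \<open>(b - a) * d x y\<close>, which is the distance of its ends. So it is a minimizer among the
  admissible curves.\<close>

lemma image_segment:
  assumes ab: "0 < a" "a < b" "b < 1"
  shows "\<exists>q r. \<gamma> ` {a..b} = closed_segment q r"
proof -
  obtain \<gamma>' where g: "continuous_on {0<..<(b+1)/2} \<gamma>'"
    "\<And>t. t \<in> {0<..<(b+1)/2} \<Longrightarrow> (\<gamma> has_vector_derivative \<gamma>' t) (at t)"
    "\<And>t. t \<in> {0<..<(b+1)/2} \<Longrightarrow> L (\<gamma> t) (\<gamma>' t) = d x y"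
    using \<gamma>_C1[of "(b+1)/2"] ab by auto
  have sub: "{a..b} \<subseteq> {0<..<(b+1)/2}" using ab by auto
  have c: "continuous_on {a..b} \<gamma>'" by (rule continuous_on_subset[OF g(1) sub])
  have v: "\<forall>t\<in>{a..b}. (\<gamma> has_vector_derivative \<gamma>' t) (at t)" using g(2) sub by blast
  have u: "\<gamma> ` {a..b} \<subseteq> U"
  proof (rule image_subsetI)
    fix t assume "t \<in> {a..b}"
    then have "t \<in> {0..1}" using ab by auto
    then show "\<gamma> t \<in> U" by (rule in_U[OF \<gamma>_balls(2)])
  qed
  have "integral {a..b} (\<lambda>t. L (\<gamma> t) (\<gamma>' t)) = integral {a..b} (\<lambda>t. d x y)"
    by (rule Henstock_Kurzweil_Integration.integral_cong) (use g(3) sub in blast)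
  also have "\<dots> = d (\<gamma> a) (\<gamma> b)" using \<gamma>_d[of a b] ab by simp
  finally have len: "integral {a..b} (\<lambda>t. L (\<gamma> t) (\<gamma>' t)) = d (\<gamma> a) (\<gamma> b)" .
  have "integral {a..b} (\<lambda>t. L (\<gamma> t) (\<gamma>' t)) \<le> integral {a..b} (\<lambda>t. L (\<delta> t) (\<delta>' t))"
    if "\<forall>t\<in>{a..b}. (\<delta> has_vector_derivative \<delta>' t) (at t)" "continuous_on {a..b} \<delta>'" "\<delta> ` {a..b} \<subseteq> U"
      "\<delta> a = \<gamma> a" "\<delta> b = \<gamma> b" for \<delta> \<delta>'
    unfolding len using d_le_C1_curve[of a b \<delta> \<delta>'] that ab by simp
  then have min: "\<forall>\<delta> \<delta>'. (\<forall>t\<in>{a..b}. (\<delta> has_vector_derivative \<delta>' t) (at t)) \<longrightarrow> continuous_on {a..b} \<delta>' \<longrightarrow> \<delta> ` {a..b} \<subseteq> U \<longrightarrow>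
        \<delta> a = \<gamma> a \<longrightarrow> \<delta> b = \<gamma> b \<longrightarrow> integral {a..b} (\<lambda>t. L (\<gamma> t) (\<gamma>' t)) \<le> integral {a..b} (\<lambda>t. L (\<delta> t) (\<delta>' t))"
    by (intro allI impI)
  from straight[unfolded minimizers_straight_def, THEN spec[of _ a], THEN spec[of _ b], THEN spec[of _ \<gamma>], THEN spec[of _ \<gamma>'],
      THEN mp[OF _ ab(2)], THEN mp[OF _ v], THEN mp[OF _ c], THEN mp[OF _ u], THEN mp[OF _ min]]
  show ?thesis .
qed

text \<open>Straightness is available on compact subintervals of \<open>(0,1)\<close> only. Equality
  in Cauchy-Schwarz is a closed condition, so collinearity survives the limit to the endpoints. The
  parameter \<open>\<tau>\<close> is not yet confined to \<open>[0,1]\<close>.\<close>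

lemma on_chord:
  assumes t: "t \<in> {0..1}" and xy: "x \<noteq> y"
  shows "\<exists>\<tau>. \<gamma> t = x + \<tau> *\<^sub>R (y - x)"
proof (cases "t = 0 \<or> t = 1")
  case True
  then show ?thesis using \<gamma>_ends by (auto intro: exI[of _ 0] exI[of _ 1])
next
  case False
  then have t: "0 < t" "t < 1" using t by auto
  define a where "a n = t / real (n + 2)" for n :: nat
  define b where "b n = 1 - (1 - t) / real (n + 2)" for n :: nat
  have ab: "0 < a n" "a n < t" "t < b n" "b n < 1" for n
  proof -
    show "0 < a n" "b n < 1" using t by (auto simp: a_def b_def)
    have "t / real (n + 2) < t / 1" using t by (intro divide_strict_left_mono) auto
    then show "a n < t" by (simp add: a_def)
    have "(1 - t) / real (n + 2) < (1 - t) / 1" using t by (intro divide_strict_left_mono) auto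
    then show "t < b n" by (simp add: b_def)
  qed
  have inv: "(\<lambda>n. inverse (real (n + 2))) \<longlonglongrightarrow> 0"
    using LIMSEQ_ignore_initial_segment[OF LIMSEQ_inverse_real_of_nat, of 1] by (simp add: add.commute)
  have "a \<longlonglongrightarrow> t * 0" "b \<longlonglongrightarrow> 1 - (1 - t) * 0"
    unfolding a_def b_def divide_inverse by (intro tendsto_intros inv)+
  then have "a \<longlonglongrightarrow> 0" "b \<longlonglongrightarrow> 1" by simp_all
  then have lim: "(\<lambda>n. \<gamma> (a n)) \<longlonglongrightarrow> x" "(\<lambda>n. \<gamma> (b n)) \<longlonglongrightarrow> y"
  proof -
    have "a n \<in> {0..1}" "b n \<in> {0..1}" for n using ab[of n] t by auto
    then have "\<forall>\<^sub>F n in sequentially. a n \<in> {0..1}" "\<forall>\<^sub>F n in sequentially. b n \<in> {0..1}" by auto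
    then show "(\<lambda>n. \<gamma> (a n)) \<longlonglongrightarrow> x" "(\<lambda>n. \<gamma> (b n)) \<longlonglongrightarrow> y"
      using continuous_on_tendsto_compose[OF \<gamma>_cont \<open>a \<longlonglongrightarrow> 0\<close>]
        continuous_on_tendsto_compose[OF \<gamma>_cont \<open>b \<longlonglongrightarrow> 1\<close>] \<gamma>_ends by auto
  qed
  have eq: "\<bar>(\<gamma> t - \<gamma> (a n)) \<bullet> (\<gamma> (b n) - \<gamma> (a n))\<bar> = norm (\<gamma> t - \<gamma> (a n)) * norm (\<gamma> (b n) - \<gamma> (a n))" for n
  proof -
    obtain q r where qr: "\<gamma> ` {a n..b n} = closed_segment q r" using image_segment[of "a n" "b n"] ab[of n] by auto
    have "{\<gamma> (a n), \<gamma> t, \<gamma> (b n)} \<subseteq> \<gamma> ` {a n..b n}" using ab[of n] by auto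
    then have "collinear {\<gamma> (a n), \<gamma> t, \<gamma> (b n)}"
      using collinear_subset[OF collinear_closed_segment] unfolding qr by blast
    then have "collinear {\<gamma> t, \<gamma> (a n), \<gamma> (b n)}" by (simp add: insert_commute)
    then have "collinear {0, \<gamma> t - \<gamma> (a n), \<gamma> (b n) - \<gamma> (a n)}"
      by (simp add: collinear_3[of "\<gamma> t"])
    then show ?thesis by (simp add: norm_cauchy_schwarz_equal)
  qed
  have "(\<lambda>n. \<bar>(\<gamma> t - \<gamma> (a n)) \<bullet> (\<gamma> (b n) - \<gamma> (a n))\<bar>) \<longlonglongrightarrow> \<bar>(\<gamma> t - x) \<bullet> (y - x)\<bar>"
    by (intro tendsto_intros lim)
  moreover have "(\<lambda>n. norm (\<gamma> t - \<gamma> (a n)) * norm (\<gamma> (b n) - \<gamma> (a n))) \<longlonglongrightarrow> norm (\<gamma> t - x) * norm (y - x)"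
    by (intro tendsto_intros lim)
  ultimately have "\<bar>(\<gamma> t - x) \<bullet> (y - x)\<bar> = norm (\<gamma> t - x) * norm (y - x)"
    unfolding eq using LIMSEQ_unique by blast
  then have "norm (y - x) *\<^sub>R (\<gamma> t - x) = norm (\<gamma> t - x) *\<^sub>R (y - x) \<or> norm (y - x) *\<^sub>R (\<gamma> t - x) = - norm (\<gamma> t - x) *\<^sub>R (y - x)"
    unfolding norm_cauchy_schwarz_abs_eq by (metis minus_minus scaleR_minus_left)
  then obtain s where s: "norm (y - x) *\<^sub>R (\<gamma> t - x) = s *\<^sub>R (y - x)" by blast
  have "\<gamma> t - x = (1 / norm (y - x)) *\<^sub>R (norm (y - x) *\<^sub>R (\<gamma> t - x))" using xy by simp
  then have "\<gamma> t - x = (s / norm (y - x)) *\<^sub>R (y - x)" unfolding s by simp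
  then have "\<gamma> t = x + (s / norm (y - x)) *\<^sub>R (y - x)" by (simp add: algebra_simps)
  then show ?thesis by blast
qed

text \<open>The position \<open>\<tau>\<close> on the line could move back and forth. A primitive
  \<open>\<Phi>\<close> of \<open>L\<close> along the line, evaluated at \<open>\<tau>\<close>, has
  derivative \<open>d x y\<close> in absolute value throughout, so the mean value theorem bounds its
  total increment by \<open>d x y\<close>.\<close>

lemma straight_le_d:
  assumes v: "y = x + T *\<^sub>R v" and T: "T > 0" "v \<noteq> 0"
  shows "integral {0..T} (\<lambda>s. L (x + s *\<^sub>R v) v) \<le> d x y"
proof -
  have xy: "x \<noteq> y" using v T by auto
  define \<tau> where "\<tau> t = ((\<gamma> t - x) \<bullet> v) / (v \<bullet> v)" for t
  have vv: "v \<bullet> v \<noteq> 0" using T by simp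
  have \<gamma>\<tau>: "\<gamma> t = x + \<tau> t *\<^sub>R v" if t: "t \<in> {0..1}" for t
  proof -
    obtain \<sigma> where \<sigma>: "\<gamma> t = x + \<sigma> *\<^sub>R (y - x)" using on_chord[OF t xy] by blast
    then have "\<gamma> t = x + (\<sigma> * T) *\<^sub>R v" using v by simp
    then show ?thesis using vv by (simp add: \<tau>_def)
  qed
  have c\<tau>: "continuous_on {0..1} \<tau>"
    unfolding \<tau>_def by (intro continuous_intros \<gamma>_cont) (use vv in auto)
  \<comment> \<open>The path may overshoot the chord, so \<open>\<Phi>\<close> is based at the
    smallest position reached. The line between the extreme positions stays in \<open>U\<close>
    because it joins two points of the ball.\<close>
  obtain t0 where t0: "t0 \<in> {0..1}" "\<And>t. t \<in> {0..1} \<Longrightarrow> \<tau> t0 \<le> \<tau> t"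
    using continuous_attains_inf[OF _ _ c\<tau>] by auto
  obtain t1 where t1: "t1 \<in> {0..1}" "\<And>t. t \<in> {0..1} \<Longrightarrow> \<tau> t \<le> \<tau> t1"
    using continuous_attains_sup[OF _ _ c\<tau>] by auto
  have line: "x + s *\<^sub>R v \<in> U" if s: "s \<in> {\<tau> t0..\<tau> t1}" for s
  proof -
    have "s \<in> closed_segment (\<tau> t0) (\<tau> t1)" using s by (auto simp: closed_segment_eq_real_ivl)
    then obtain u where u: "u \<in> {0..1}" "s = (1 - u) * \<tau> t0 + u * \<tau> t1" by (auto simp: closed_segment_def)
    have "x + s *\<^sub>R v = \<gamma> t0 + u *\<^sub>R (\<gamma> t1 - \<gamma> t0)"
      unfolding \<gamma>\<tau>[OF t0(1)] \<gamma>\<tau>[OF t1(1)] u(2) by (simp add: algebra_simps)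
    then show ?thesis using in_U[OF line_ball[OF \<gamma>_balls(2)[OF t0(1)] \<gamma>_balls(2)[OF t1(1)] u(1)]] by simp
  qed
  define f where "f s = L (x + s *\<^sub>R v) v" for s
  have cf: "continuous_on {\<tau> t0..\<tau> t1} f"
    unfolding f_def by (intro continuous_on_L continuous_intros line)
  define \<Phi> where "\<Phi> s = integral {\<tau> t0..s} f" for s
  have \<Phi>: "(\<Phi> has_vector_derivative f s) (at s within {\<tau> t0..\<tau> t1})" if "s \<in> {\<tau> t0..\<tau> t1}" for s
    unfolding \<Phi>_def by (rule integral_has_vector_derivative[OF cf that])
  have \<tau>_in: "\<tau> t \<in> {\<tau> t0..\<tau> t1}" if "t \<in> {0..1}" for t using t0(2)[OF that] t1(2)[OF that] by simp
  have \<tau>01: "\<tau> 0 = 0" "\<tau> 1 = T" using \<gamma>_ends v vv by (auto simp: \<tau>_def)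
  have deriv: "\<exists>D. ((\<lambda>t. \<Phi> (\<tau> t)) has_real_derivative D) (at t) \<and> \<bar>D\<bar> = d x y" if t: "0 < t" "t < 1" for t
  proof -
    obtain \<gamma>' where "continuous_on {0<..<(t+1)/2} \<gamma>'" and g: "\<And>s. s \<in> {0<..<(t+1)/2} \<Longrightarrow> (\<gamma> has_vector_derivative \<gamma>' s) (at s)"
      "\<And>s. s \<in> {0<..<(t+1)/2} \<Longrightarrow> L (\<gamma> s) (\<gamma>' s) = d x y"
      using \<gamma>_C1[of "(t+1)/2"] t by auto
    have tt: "t \<in> {0<..<(t+1)/2}" using t by auto
    have d\<gamma>: "(\<gamma> has_vector_derivative \<gamma>' t) (at t)" by (rule g(1)[OF tt])
    define \<tau>' where "\<tau>' = (\<gamma>' t \<bullet> v) / (v \<bullet> v)"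
    have d\<tau>: "(\<tau> has_vector_derivative \<tau>') (at t)"
    proof -
      have "((\<lambda>s. (\<gamma> s - x) \<bullet> v) has_derivative (\<lambda>h. (h *\<^sub>R \<gamma>' t) \<bullet> v)) (at t)"
        using d\<gamma> unfolding has_vector_derivative_def by (auto intro!: derivative_eq_intros)
      then have "((\<lambda>s. ((\<gamma> s - x) \<bullet> v) * inverse (v \<bullet> v)) has_derivative (\<lambda>h. ((h *\<^sub>R \<gamma>' t) \<bullet> v) * inverse (v \<bullet> v))) (at t)"
        by (rule has_derivative_mult_left)
      then show ?thesis by (simp add: has_vector_derivative_def \<tau>_def[abs_def] \<tau>'_def divide_inverse mult.assoc)
    qed
    have "((\<lambda>s. x + \<tau> s *\<^sub>R v) has_vector_derivative \<tau>' *\<^sub>R v) (at t)"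
      using d\<tau> by (auto intro!: derivative_eq_intros simp: has_real_derivative_iff_has_vector_derivative)
    then have "(\<gamma> has_vector_derivative \<tau>' *\<^sub>R v) (at t)"
      by (rule has_vector_derivative_transform_within_open[of _ _ _ "{0<..<1}"]) (use t \<gamma>\<tau> in auto)
    then have g': "\<gamma>' t = \<tau>' *\<^sub>R v" using vector_derivative_unique_at d\<gamma> by blast
    have t01: "t \<in> {0..1}" using t by simp
    have "(\<Phi> has_vector_derivative f (\<tau> t)) (at (\<tau> t) within \<tau> ` {0<..<1})"
      by (rule has_vector_derivative_within_subset[OF \<Phi>[OF \<tau>_in[OF t01]]]) (use \<tau>_in in force)
    moreover have "(\<tau> has_vector_derivative \<tau>') (at t within {0<..<1})" by (rule has_vector_derivative_at_within[OF d\<tau>])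
    ultimately have "((\<lambda>s. \<Phi> (\<tau> s)) has_vector_derivative \<tau>' *\<^sub>R f (\<tau> t)) (at t within {0<..<1})"
      using vector_diff_chain_within[of \<tau> \<tau>' t "{0<..<1}" \<Phi>] by (simp add: o_def)
    then have "((\<lambda>s. \<Phi> (\<tau> s)) has_real_derivative \<tau>' * f (\<tau> t)) (at t)"
      using at_within_open[of t "{0<..<1}"] t by (simp add: has_real_derivative_iff_has_vector_derivative)
    moreover have "\<bar>\<tau>' * f (\<tau> t)\<bar> = d x y"
    proof -
      have tU: "\<gamma> t \<in> U" by (rule in_U[OF \<gamma>_balls(2)[OF t01]])
      have "d x y = L (\<gamma> t) (\<tau>' *\<^sub>R v)" using g(2)[OF tt] g' by simp
      also have "\<dots> = \<bar>\<tau>'\<bar> * L (\<gamma> t) v" by (rule L_scale[OF tU])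
      also have "L (\<gamma> t) v = f (\<tau> t)" unfolding f_def using \<gamma>\<tau>[OF t01] by simp
      finally show ?thesis using L_nonneg[OF tU, of v] \<open>L (\<gamma> t) v = f (\<tau> t)\<close> by (simp add: abs_mult)
    qed
    ultimately show ?thesis by blast
  qed
  have "continuous_on {0..1} (\<lambda>t. \<Phi> (\<tau> t))"
  proof (rule continuous_on_compose2[OF _ c\<tau>])
    show "continuous_on {\<tau> t0..\<tau> t1} \<Phi>" by (rule continuous_on_vector_derivative[OF \<Phi>])
  qed (use \<tau>_in in blast)
  moreover have "(\<lambda>t. \<Phi> (\<tau> t)) differentiable (at t)" if "0 < t" "t < 1" for t
    using deriv[OF that] real_differentiable_def by blast
  ultimately obtain l z where z: "0 < z" "z < 1" "((\<lambda>t. \<Phi> (\<tau> t)) has_real_derivative l) (at z)" "\<Phi> (\<tau> 1) - \<Phi> (\<tau> 0) = (1 - 0) * l"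
    using MVT[of 0 1 "\<lambda>t. \<Phi> (\<tau> t)"] by auto
  obtain D where D: "((\<lambda>t. \<Phi> (\<tau> t)) has_real_derivative D) (at z)" "\<bar>D\<bar> = d x y" using deriv[OF z(1,2)] by blast
  have "l = D" by (rule DERIV_unique[OF z(3) D(1)])
  then have "\<Phi> T - \<Phi> 0 \<le> d x y" using z(4) D(2) \<tau>01 by auto
  moreover have "\<Phi> T - \<Phi> 0 = integral {0..T} f"
  proof -
    have b: "\<tau> t0 \<le> 0" "T \<le> \<tau> t1" using \<tau>_in[of 0] \<tau>_in[of 1] \<tau>01 by auto
    have "integral {\<tau> t0..0} f + integral {0..T} f = integral {\<tau> t0..T} f"
      by (rule Henstock_Kurzweil_Integration.integral_combine)
        (use b T in \<open>auto intro!: integrable_continuous_real continuous_on_subset[OF cf]\<close>)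
    then show ?thesis by (simp add: \<Phi>_def)
  qed
  ultimately show ?thesis by (simp add: f_def[abs_def])
qed

end

end

end

context metric_field begin

theorem segments_minimize:
  assumes straight: minimizers_straight and p: "p \<in> U"
  shows "\<exists>r>0. cball p r \<subseteq> U \<and> (\<forall>x v T. x \<in> cball p r \<longrightarrow> x + T *\<^sub>R v \<in> cball p r \<longrightarrow> T > 0 \<longrightarrow>
     integral {0..T} (\<lambda>s. L (x + s *\<^sub>R v) v) \<le> d x (x + T *\<^sub>R v))"
proof -
  obtain R m M C where b: "R > 0" "m > 0" "M > 0" "C \<ge> 0" "cball p R \<subseteq> U"
    "\<And>x v. x \<in> cball p R \<Longrightarrow> m * norm v \<le> L x v"
    "\<And>x v. x \<in> cball p R \<Longrightarrow> L x v \<le> M * norm v"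
    "\<And>x y v. x \<in> cball p R \<Longrightarrow> y \<in> cball p R \<Longrightarrow> \<bar>L x v - L y v\<bar> \<le> C * norm (x - y) * norm v"
    using local_bounds[OF p] by blast
  interpret metric_ball U g dg p R m M C by unfold_locales (use b in auto)
  \<comment> \<open>An upper bound for \<open>d x y\<close>: \<open>R/16\<close> ensures strict
    inequality below \<open>m * (R/8)\<close>, the other term is the second smallness condition. The
    radius \<open>r\<close> below makes \<open>M\<close> times the diameter of the small ball at
    most \<open>c\<close>.\<close>
  define c where "c = min (m * (R/16)) (m\<^sup>2 * R / (6 * M))"
  have c: "c > 0" "c < m * (R/8)" "6 * M * c \<le> m\<^sup>2 * R"
  proof -
    show "c > 0" using b by (simp add: c_def)
    have "m * (R/16) < m * (R/8)" using b by simp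
    then show "c < m * (R/8)" unfolding c_def by linarith
    have "c \<le> m\<^sup>2 * R / (6 * M)" by (simp add: c_def)
    then show "6 * M * c \<le> m\<^sup>2 * R" using b by (simp add: field_simps)
  qed
  define r where "r = min (R/8) (c / (2 * M))"
  have r: "r > 0" "r \<le> R/8" "2 * M * r \<le> c"
  proof -
    show "r > 0" "r \<le> R/8" using b c by (auto simp: r_def)
    have "r \<le> c / (2 * M)" by (simp add: r_def)
    then show "2 * M * r \<le> c" using b by (simp add: field_simps)
  qed
  show ?thesis
  proof (intro exI[of _ r] conjI allI impI r(1))
    show "cball p r \<subseteq> U" by (rule order.trans[OF subset_cball b(5)]) (use r b(1) in linarith)
    fix x v T assume xy: "x \<in> cball p r" "x + T *\<^sub>R v \<in> cball p r" and T: "(T::real) > 0"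
    define y where "y = x + T *\<^sub>R v"
    have x8: "x \<in> cball p (R/8)" and y8: "y \<in> cball p (R/8)"
      using cball_mono[OF xy(1) r(2)] cball_mono[OF xy(2) r(2)] by (auto simp: y_def)
    have xR: "x \<in> cball p R" and yR: "y \<in> cball p R"
      using cball_mono[OF x8, of R] cball_mono[OF y8, of R] b(1) by auto
    show "integral {0..T} (\<lambda>s. L (x + s *\<^sub>R v) v) \<le> d x (x + T *\<^sub>R v)"
    proof (cases "v = 0")
      case True
      then show ?thesis using L_zero[OF in_U[OF xR]] d_refl[OF xR] by simp
    next
      case False
      have "d x y \<le> M * norm (y - x)" by (rule d_upper[OF xR yR])
      also have "norm (y - x) \<le> 2 * r"
        using dist_triangle[of x y p] xy by (auto simp: y_def dist_norm norm_minus_commute)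
      finally have dc: "d x y \<le> c" using r(3) b(3) by (simp add: mult_left_mono)
      have s1: "d x y < m * (R/8)" using dc c by simp
      have "6 * M * d x y \<le> 6 * M * c" using dc b(3) by simp
      then have s2: "6 * M * d x y \<le> m\<^sup>2 * R" using c(3) by linarith
      obtain \<gamma> where g: "\<gamma> 0 = x" "\<gamma> 1 = y" "\<forall>t\<in>{0..1}. \<gamma> t \<in> cball p (R/4)"
        "\<forall>s t. 0 \<le> s \<longrightarrow> s \<le> t \<longrightarrow> t \<le> 1 \<longrightarrow> d (\<gamma> s) (\<gamma> t) = (t - s) * d x y"
        using geodesic_exists[OF x8 y8 s1] by blast
      show ?thesis using straight_le_d[where \<gamma> = \<gamma>, OF s1 s2 g straight y_def T False] by (simp add: y_def)
    qed
  qed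
qed

end

subsection \<open>The projective connection\<close>

context metric_field begin

text \<open>Straight segments are compared with the curves \<open>x + t v + s t (T - t) w\<close>. By the inequality
  \<open>2 L \<le> g / \<lambda> + \<lambda>\<close>, an equality at \<open>s = 0\<close>, the length may be replaced by a weighted energy.\<close>

lemma first_variation:
  assumes r: "cball p r \<subseteq> U" "r > 0"
    and min: "\<And>x v T. x \<in> cball p r \<Longrightarrow> x + T *\<^sub>R v \<in> cball p r \<Longrightarrow> T > 0 \<Longrightarrow>
       integral {0..T} (\<lambda>s. L (x + s *\<^sub>R v) v) \<le> d x (x + T *\<^sub>R v)"
    and T: "T > 0" and seg: "\<And>t. t \<in> {0..T} \<Longrightarrow> x + t *\<^sub>R v \<in> cball p (r/2)" and v: "v \<noteq> 0"
  shows "integral {0..T} (\<lambda>t. (t * (T - t) * dg (x + t *\<^sub>R v) w v v + 2 * (T - 2 * t) * g (x + t *\<^sub>R v) v w) / L (x + t *\<^sub>R v) v) = 0"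
proof -
  define c where "c s t = x + t *\<^sub>R v + (s * (t * (T - t))) *\<^sub>R w" for s t
  define e where "e t = (T - 2 * t) *\<^sub>R w" for t
  define lam where "lam t = L (x + t *\<^sub>R v) v" for t
  have segU: "x + t *\<^sub>R v \<in> U" if "t \<in> {0..T}" for t using seg[OF that] r by (auto simp: subset_eq)
  have lam_pos: "lam t > 0" if "t \<in> {0..T}" for t unfolding lam_def by (rule L_pos[OF segU[OF that] v])
  \<comment> \<open>On \<open>[0,T]\<close> the displacement is at most
    \<open>\<bar>s\<bar> * T * T * norm w\<close>, so this choice keeps it below
    \<open>r / 2\<close>; the \<open>+ 1\<close> covers \<open>w = 0\<close>.\<close>
  define s0 where "s0 = r / (2 * (T\<^sup>2 * norm w + 1))"
  have s0: "s0 > 0" using r(2) by (simp add: s0_def add_nonneg_pos)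
  define S where "S = ball (0::real) s0"
  have c_ball: "c s t \<in> cball p r" if s: "s \<in> S" and t: "t \<in> {0..T}" for s t
  proof -
    have "t * (T - t) \<le> T * T" using t by (intro mult_mono) auto
    then have "\<bar>s * (t * (T - t))\<bar> \<le> s0 * T\<^sup>2"
      using s t by (auto simp: abs_mult S_def power2_eq_square intro!: mult_mono)
    then have "norm ((s * (t * (T - t))) *\<^sub>R w) \<le> s0 * T\<^sup>2 * norm w"
      unfolding norm_scaleR by (rule mult_right_mono) simp
    also have "\<dots> \<le> s0 * (T\<^sup>2 * norm w + 1)" using s0 by (simp add: algebra_simps)
    also have "\<dots> = r / 2"
    proof -
      have "r / (2 * q) * q = r / 2" if "q > 0" for q :: real using that by simp
      from this[of "T\<^sup>2 * norm w + 1"] show ?thesis unfolding s0_def by (simp add: add_nonneg_pos)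
    qed
    finally have n: "norm ((s * (t * (T - t))) *\<^sub>R w) \<le> r / 2" .
    have "dist p (c s t) \<le> dist p (x + t *\<^sub>R v) + dist (x + t *\<^sub>R v) (c s t)" by (rule dist_triangle)
    also have "\<dots> \<le> r/2 + r/2" using seg[OF t] n by (intro add_mono) (auto simp: dist_norm c_def)
    finally show ?thesis by simp
  qed
  have cU: "c s t \<in> U" if "s \<in> S" "t \<in> {0..T}" for s t using c_ball[OF that] r(1) by blast
  define f where "f s t = g (c s t) (v + s *\<^sub>R e t) (v + s *\<^sub>R e t) / lam t" for s t
  define f' where "f' s t = (dg (c s t) ((t * (T - t)) *\<^sub>R w) (v + s *\<^sub>R e t) (v + s *\<^sub>R e t) + 2 * g (c s t) (v + s *\<^sub>R e t) (e t)) / lam t" for s t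
  have contlam: "continuous_on {0..T} lam" unfolding lam_def by (intro continuous_on_L continuous_intros segU)
  have contc: "continuous_on X (\<lambda>z. c (fst z) (snd z))" "continuous_on Y (c s)" for X Y s
    unfolding c_def by (intro continuous_intros)+
  have conte: "continuous_on X (\<lambda>z. e (snd z))" "continuous_on Y e" for X :: "(real \<times> real) set" and Y
    unfolding e_def by (intro continuous_intros)+
  have contlam2: "continuous_on (S \<times> {0..T}) (\<lambda>z. lam (snd z))"
    by (rule continuous_on_compose2[OF contlam]) (auto intro: continuous_intros)
  have contf: "continuous_on {0..T} (f s)" if s: "s \<in> S" for s
  proof -
    have 2: "continuous_on {0..T} (\<lambda>t. v + s *\<^sub>R e t)" by (intro continuous_intros conte)
    have "continuous_on {0..T} (\<lambda>t. g (c s t) (v + s *\<^sub>R e t) (v + s *\<^sub>R e t))"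
      by (rule continuous_on_g[OF contc(2) 2 2 cU[OF s]])
    then have "continuous_on {0..T} (\<lambda>t. g (c s t) (v + s *\<^sub>R e t) (v + s *\<^sub>R e t) / lam t)"
      by (intro continuous_on_divide contlam) (use lam_pos in \<open>auto simp: less_imp_neq[symmetric]\<close>)
    then show ?thesis by (simp add: f_def[abs_def])
  qed
  have contf': "continuous_on (S \<times> {0..T}) (\<lambda>(s, t). f' s t)"
  proof -
    let ?X = "S \<times> {0..T}"
    have 1: "continuous_on ?X (\<lambda>z. (snd z * (T - snd z)) *\<^sub>R w)" by (intro continuous_intros)
    have 2: "continuous_on ?X (\<lambda>z. v + fst z *\<^sub>R e (snd z))" by (intro continuous_intros conte)
    have 3: "c (fst z) (snd z) \<in> U" if "z \<in> ?X" for z using cU that by auto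
    have "continuous_on ?X (\<lambda>z. dg (c (fst z) (snd z)) ((snd z * (T - snd z)) *\<^sub>R w) (v + fst z *\<^sub>R e (snd z)) (v + fst z *\<^sub>R e (snd z)))"
      by (rule continuous_on_dg[OF contc(1) 1 2 2 3])
    moreover have "continuous_on ?X (\<lambda>z. g (c (fst z) (snd z)) (v + fst z *\<^sub>R e (snd z)) (e (snd z)))"
      by (rule continuous_on_g[OF contc(1) 2 conte(1) 3])
    ultimately have "continuous_on ?X (\<lambda>z. (dg (c (fst z) (snd z)) ((snd z * (T - snd z)) *\<^sub>R w) (v + fst z *\<^sub>R e (snd z)) (v + fst z *\<^sub>R e (snd z))
        + 2 * g (c (fst z) (snd z)) (v + fst z *\<^sub>R e (snd z)) (e (snd z))) / lam (snd z))"
      by (intro continuous_on_divide continuous_on_add continuous_on_mult continuous_on_const contlam2)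
        (use lam_pos in \<open>auto simp: less_imp_neq[symmetric]\<close>)
    then show ?thesis unfolding f'_def split_beta .
  qed
  have deriv: "((\<lambda>s. f s t) has_field_derivative f' s t) (at s within S)" if s: "s \<in> S" and t: "t \<in> {0..T}" for s t
  proof -
    note b = bilinear_g[OF cU[OF s t]]
    have dc: "((\<lambda>s. c s t) has_derivative (\<lambda>h. h *\<^sub>R ((t * (T - t)) *\<^sub>R w))) (at s within S)"
      unfolding c_def by (auto intro!: derivative_eq_intros simp: fun_eq_iff mult.commute)
    have dG: "((\<lambda>s. g (c s t) y z) has_real_derivative dg (c s t) ((t * (T - t)) *\<^sub>R w) y z) (at s within S)" for y z
    proof -
      have "((\<lambda>s. g (c s t) y z) has_derivative (\<lambda>h. dg (c s t) (h *\<^sub>R ((t * (T - t)) *\<^sub>R w)) y z)) (at s within S)"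
        by (rule has_derivative_compose[OF dc g_deriv[OF cU[OF s t]]])
      moreover have "(\<lambda>h. dg (c s t) (h *\<^sub>R ((t * (T - t)) *\<^sub>R w)) y z) = (*) (dg (c s t) ((t * (T - t)) *\<^sub>R w) y z)"
        by (simp only: linear_scale[OF linear_dg[OF cU[OF s t]]] real_scaleR_def fun_eq_iff mult.commute simp_thms)
      ultimately show ?thesis by (simp add: has_field_derivative_def)
    qed
    define D where "D = dg (c s t) ((t * (T - t)) *\<^sub>R w)"
    have bd: "bilinear D" unfolding D_def by (rule bilinear_dg[OF cU[OF s t]])
    have Dsym: "D (e t) v = D v (e t)" unfolding D_def by (rule dg_sym[OF cU[OF s t]])
    \<comment> \<open>The parameter enters through the base point and both arguments. Expanding the
      arguments first leaves derivatives of \<open>g\<close> at fixed vectors, which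
      \<open>dG\<close> provides.\<close>
    have "((\<lambda>s. (g (c s t) v v + 2 * s * g (c s t) v (e t) + s * s * g (c s t) (e t) (e t)) / lam t) has_real_derivative
        (D v v + (2 * s * D v (e t) + 2 * g (c s t) v (e t)) + (s * s * D (e t) (e t) + (s + s) * g (c s t) (e t) (e t))) / lam t) (at s within S)"
      by (rule DERIV_cdivide) (auto intro!: derivative_eq_intros dG simp: D_def)
    moreover have "(D v v + (2 * s * D v (e t) + 2 * g (c s t) v (e t)) + (s * s * D (e t) (e t) + (s + s) * g (c s t) (e t) (e t))) / lam t = f' s t"
      unfolding f'_def D_def[symmetric]
      by (simp add: bilinear_ladd[OF bd] bilinear_radd[OF bd] bilinear_lmul[OF bd] bilinear_rmul[OF bd]
          bilinear_ladd[OF b] bilinear_lmul[OF b] Dsym algebra_simps)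
    moreover have "f u t = (g (c u t) v v + 2 * u * g (c u t) v (e t) + u * u * g (c u t) (e t) (e t)) / lam t" if "u \<in> S" for u
      unfolding f_def using bilinear_g[OF cU[OF that t]]
      by (simp add: bilinear_ladd bilinear_radd bilinear_lmul bilinear_rmul g_sym[OF cU[OF that t], of "e t" v] algebra_simps)
    ultimately show ?thesis using s by (auto elim!: has_field_derivative_transform_within[where d = 1])
  qed
  define E where "E s = integral {0..T} (f s)" for s
  have E': "(E has_field_derivative integral {0..T} (f' 0)) (at 0)"
  proof -
    have "((\<lambda>s. integral (cbox 0 T) (f s)) has_field_derivative integral (cbox 0 T) (f' 0)) (at 0 within S)"
      by (rule leibniz_rule_field_derivative)
        (use deriv contf contf' s0 in \<open>auto simp: S_def intro!: integrable_continuous_real\<close>)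
    then show ?thesis using s0 at_within_open[of 0 S] by (simp add: E_def[abs_def] S_def)
  qed
  have lamint: "lam integrable_on {0..T}" by (rule integrable_continuous_real[OF contlam])
  have E_ge: "integral {0..T} lam \<le> E s" if s: "s \<in> S" for s
  proof -
    have xs: "c s 0 = x" "c s T = x + T *\<^sub>R v" by (auto simp: c_def)
    have 0: "x \<in> cball p r" "x + T *\<^sub>R v \<in> cball p r" using c_ball[OF s, of 0] c_ball[OF s, of T] T xs by auto
    have cc: "continuous_on {0..T} (\<lambda>t. L (c s t) (v + s *\<^sub>R e t))"
      by (intro continuous_on_L continuous_intros conte contc cU s)
    have "integral {0..T} lam \<le> d x (x + T *\<^sub>R v)" unfolding lam_def by (rule min[OF 0 T])
    also have "\<dots> \<le> integral {0..T} (\<lambda>t. L (c s t) (v + s *\<^sub>R e t))"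
    proof -
      have "d (c s 0) (c s T) \<le> integral {0..T} (\<lambda>t. L (c s t) (v + s *\<^sub>R e t))"
      proof (rule d_le_C1_curve)
        show "(c s has_vector_derivative v + s *\<^sub>R e t) (at t)" for t
          unfolding c_def e_def by (auto intro!: derivative_eq_intros simp: algebra_simps scaleR_2[symmetric])
        show "continuous_on {0..T} (\<lambda>t. v + s *\<^sub>R e t)" by (intro continuous_intros conte)
      qed (use T cU s in auto)
      then show ?thesis by (simp add: xs)
    qed
    also have "\<dots> \<le> integral {0..T} (\<lambda>t. (1/2) * f s t + (1/2) * lam t)"
    proof (rule integral_le)
      show "(\<lambda>t. L (c s t) (v + s *\<^sub>R e t)) integrable_on {0..T}" by (rule integrable_continuous_real[OF cc])
      show "(\<lambda>t. (1/2) * f s t + (1/2) * lam t) integrable_on {0..T}"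
        by (intro integrable_continuous_real continuous_intros contf contlam s)
      fix t assume t: "t \<in> {0..T}"
      have "0 \<le> (L (c s t) (v + s *\<^sub>R e t) - lam t)\<^sup>2" by simp
      then have "2 * L (c s t) (v + s *\<^sub>R e t) * lam t \<le> g (c s t) (v + s *\<^sub>R e t) (v + s *\<^sub>R e t) + lam t * lam t"
        unfolding L_sq[OF cU[OF s t], symmetric] by (simp add: power2_eq_square algebra_simps)
      then show "L (c s t) (v + s *\<^sub>R e t) \<le> (1/2) * f s t + (1/2) * lam t"
        using lam_pos[OF t] by (simp add: f_def field_simps)
    qed
    also have "\<dots> = (1/2) * E s + (1/2) * integral {0..T} lam"
      unfolding E_def using contf[OF s] lamint
      by (subst Henstock_Kurzweil_Integration.integral_add) (auto intro!: integrable_continuous_real continuous_intros contlam)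
    finally show ?thesis by simp
  qed
  have "f 0 t = lam t" if "t \<in> {0..T}" for t
    using lam_pos[OF that] L_sq[OF segU[OF that], of v] by (simp add: f_def c_def lam_def power2_eq_square divide_eq_eq)
  then have "E 0 = integral {0..T} lam" unfolding E_def by (intro Henstock_Kurzweil_Integration.integral_cong)
  then have "\<forall>y. \<bar>0 - y\<bar> < s0 \<longrightarrow> E 0 \<le> E y" using E_ge by (auto simp: S_def)
  from DERIV_local_min[OF E' s0 this] have "integral {0..T} (f' 0) = 0" .
  moreover have "f' 0 t = (t * (T - t) * dg (x + t *\<^sub>R v) w v v + 2 * (T - 2 * t) * g (x + t *\<^sub>R v) v w) / L (x + t *\<^sub>R v) v"
    if "t \<in> {0..T}" for t
    using linear_scale[OF linear_dg[OF segU[OF that]]] bilinear_rmul[OF bilinear_g[OF segU[OF that]]]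
    by (simp add: f'_def c_def e_def lam_def)
  then have "integral {0..T} (f' 0) = integral {0..T} (\<lambda>t. (t * (T - t) * dg (x + t *\<^sub>R v) w v v + 2 * (T - 2 * t) * g (x + t *\<^sub>R v) v w) / L (x + t *\<^sub>R v) v)"
    by (rule Henstock_Kurzweil_Integration.integral_cong)
  ultimately show ?thesis by simp
qed

text \<open>Integration by parts removes the derivative of the weight \<open>t * (T - t)\<close> and
  leaves \<open>A - 2 * B'\<close> tested against a positive weight on every short interval.
  Continuity gives \<open>A 0 = 2 * B' 0\<close>, and multiplication by the cube of
  \<open>L p v\<close> clears the denominators.\<close>

lemma euler_lagrange:
  assumes straight: minimizers_straight and p: "p \<in> U"
  shows "g p v v * dg p w v v = 2 * g p v v * dg p v v w - g p v w * dg p v v v"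
proof (cases "v = 0")
  case True
  then show ?thesis using bilinear_lzero[OF bilinear_g[OF p]] bilinear_lzero[OF bilinear_dg[OF p]] by simp
next
  case v: False
  obtain r where r: "r > 0" "cball p r \<subseteq> U" "\<And>x v T. x \<in> cball p r \<Longrightarrow> x + T *\<^sub>R v \<in> cball p r \<Longrightarrow> T > 0 \<Longrightarrow>
       integral {0..T} (\<lambda>s. L (x + s *\<^sub>R v) v) \<le> d x (x + T *\<^sub>R v)"
    using segments_minimize[OF straight p] by blast
  define T0 where "T0 = r / (2 * norm v)"
  have T0: "T0 > 0" using r v by (simp add: T0_def)
  have ball: "p + t *\<^sub>R v \<in> cball p (r/2)" if "t \<in> {0..T0}" for t
  proof -
    have "t * norm v \<le> T0 * norm v" using that by (intro mult_right_mono) auto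
    also have "\<dots> = r/2" using v by (simp add: T0_def)
    finally show ?thesis using that by (simp add: dist_norm)
  qed
  define W where "W = {t. p + t *\<^sub>R v \<in> U}"
  have segU: "t \<in> {0..T0} \<Longrightarrow> t \<in> W" for t using ball[of t] r by (auto simp: W_def subset_eq)
  have openW: "open W"
  proof -
    have "open ((\<lambda>t. p + t *\<^sub>R v) -` U)" by (intro open_vimage open_U continuous_intros)
    then show ?thesis by (simp add: W_def vimage_def)
  qed
  define lam where "lam t = L (p + t *\<^sub>R v) v" for t
  define A where "A t = dg (p + t *\<^sub>R v) w v v / lam t" for t
  define B where "B t = g (p + t *\<^sub>R v) v w / lam t" for t
  define B' where "B' t = dg (p + t *\<^sub>R v) v v w / lam t - g (p + t *\<^sub>R v) v w * dg (p + t *\<^sub>R v) v v v / (2 * lam t ^ 3)" for t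
  have lam_pos: "lam t > 0" if "t \<in> W" for t unfolding lam_def using that by (intro L_pos v) (auto simp: W_def)
  have cont: "continuous_on W A" "continuous_on W B'"
    unfolding A_def B'_def lam_def
    by (intro continuous_intros; use lam_pos in \<open>auto simp: W_def lam_def less_imp_neq[symmetric]\<close>)+
  have dB: "(B has_real_derivative B' t) (at t)" if t: "t \<in> W" for t
  proof -
    have tU: "p + t *\<^sub>R v \<in> U" using t by (simp add: W_def)
    have dG: "((\<lambda>t. g (p + t *\<^sub>R v) y z) has_real_derivative dg (p + t *\<^sub>R v) v y z) (at t)" for y z
    proof -
      have "((\<lambda>t. p + t *\<^sub>R v) has_derivative (\<lambda>h. h *\<^sub>R v)) (at t)" by (auto intro!: derivative_eq_intros)
      from has_derivative_compose[OF this g_deriv[OF tU]]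
      have "((\<lambda>t. g (p + t *\<^sub>R v) y z) has_derivative (\<lambda>h. dg (p + t *\<^sub>R v) (h *\<^sub>R v) y z)) (at t)" .
      moreover have "(\<lambda>h. dg (p + t *\<^sub>R v) (h *\<^sub>R v) y z) = (*) (dg (p + t *\<^sub>R v) v y z)"
        by (simp only: linear_scale[OF linear_dg[OF tU]] real_scaleR_def fun_eq_iff mult.commute simp_thms)
      ultimately show ?thesis by (simp add: has_field_derivative_def)
    qed
    have "((\<lambda>t. sqrt (g (p + t *\<^sub>R v) v v)) has_real_derivative dg (p + t *\<^sub>R v) v v v * (inverse (sqrt (g (p + t *\<^sub>R v) v v)) / 2)) (at t)"
      using DERIV_chain2[OF DERIV_real_sqrt dG[of v v]] g_pos[OF tU v] by (simp add: mult.commute)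
    note dsq = this
    have lam: "lam = (\<lambda>t. sqrt (g (p + t *\<^sub>R v) v v))" by (rule ext) (simp only: lam_def L_def)
    have "(lam has_real_derivative dg (p + t *\<^sub>R v) v v v / (2 * lam t)) (at t)"
      unfolding lam by (rule DERIV_cong[OF dsq]) (simp add: inverse_eq_divide mult.commute)
    from DERIV_divide[OF dG[of v w] this less_imp_neq[OF lam_pos[OF t], symmetric]]
    have "(B has_real_derivative (dg (p + t *\<^sub>R v) v v w * lam t - g (p + t *\<^sub>R v) v w * (dg (p + t *\<^sub>R v) v v v / (2 * lam t))) / (lam t * lam t)) (at t)"
      unfolding B_def[abs_def] .
    moreover have "(dg (p + t *\<^sub>R v) v v w * lam t - g (p + t *\<^sub>R v) v w * (dg (p + t *\<^sub>R v) v v v / (2 * lam t))) / (lam t * lam t) = B' t"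
      using lam_pos[OF t] by (simp add: B'_def field_simps power3_eq_cube)
    ultimately show ?thesis by simp
  qed
  have int0: "integral {0..T} (\<lambda>t. t * (T - t) * (A t - 2 * B' t)) = 0" if T: "0 < T" "T \<le> T0" for T
  proof -
    have sub: "{0..T} \<subseteq> W" using segU T by auto
    have cB: "continuous_on {0..T} B"
      using dB sub by (intro continuous_at_imp_continuous_on ballI DERIV_isCont[OF dB]) blast
    have "((\<lambda>t. t * (T - t) * B t) has_vector_derivative ((T - 2 * t) * B t + t * (T - t) * B' t)) (at t within {0..T})" if "t \<in> {0..T}" for t
      unfolding has_real_derivative_iff_has_vector_derivative[symmetric]
      using sub that by (auto intro!: derivative_eq_intros has_field_derivative_at_within[OF dB] simp: algebra_simps)
    from fundamental_theorem_of_calculus[OF _ this]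
    have I: "((\<lambda>t. (T - 2 * t) * B t + t * (T - t) * B' t) has_integral 0) {0..T}" using T by simp
    have "integral {0..T} (\<lambda>t. (t * (T - t) * dg (p + t *\<^sub>R v) w v v + 2 * (T - 2 * t) * g (p + t *\<^sub>R v) v w) / L (p + t *\<^sub>R v) v) = 0"
      by (rule first_variation[OF r(2,1,3) T(1) _ v]) (use ball T in auto)
    moreover have "(\<lambda>t. (t * (T - t) * dg (p + t *\<^sub>R v) w v v + 2 * (T - 2 * t) * g (p + t *\<^sub>R v) v w) / L (p + t *\<^sub>R v) v)
        = (\<lambda>t. t * (T - t) * (A t - 2 * B' t) + 2 * ((T - 2 * t) * B t + t * (T - t) * B' t))"
    proof -
      have "(a * D + 2 * b * G) / l = a * (D / l - 2 * c) + 2 * (b * (G / l) + a * c)" for a b c D G l :: real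
        by (simp add: add_divide_distrib right_diff_distrib distrib_left)
      then show ?thesis unfolding A_def B_def lam_def by (intro ext)
    qed
    ultimately have "integral {0..T} (\<lambda>t. t * (T - t) * (A t - 2 * B' t) + 2 * ((T - 2 * t) * B t + t * (T - t) * B' t)) = 0" by simp
    moreover have "((\<lambda>t. 2 * ((T - 2 * t) * B t + t * (T - t) * B' t)) has_integral 2 * 0) {0..T}"
      using I by (rule has_integral_mult_right)
    moreover have "(\<lambda>t. t * (T - t) * (A t - 2 * B' t)) integrable_on {0..T}"
      by (intro integrable_continuous_real continuous_intros continuous_on_subset[OF cont(1) sub] continuous_on_subset[OF cont(2) sub])
    ultimately show ?thesis
      by (subst (asm) Henstock_Kurzweil_Integration.integral_add) (auto simp: has_integral_integrable_integral)
  qed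
  \<comment> \<open>The factor \<open>\<sigma>\<close> treats both signs at once: a continuous
    integrand that is positive inside a short interval cannot have integral 0.\<close>
  have key: "\<not> 0 < \<sigma> * (A 0 - 2 * B' 0)" for \<sigma> :: real
  proof
    assume pos: "0 < \<sigma> * (A 0 - 2 * B' 0)"
    define F where "F t = \<sigma> * (A t - 2 * B' t)" for t
    have 0: "0 \<in> W" using segU T0 by auto
    have cF: "continuous_on W F" unfolding F_def by (intro continuous_intros cont)
    then have "isCont F 0" using continuous_on_eq_continuous_at[OF openW] 0 by blast
    then have "\<forall>\<^sub>F t in at 0. F t > 0" using pos unfolding isCont_def F_def by (rule order_tendstoD)
    then obtain e where e: "e > 0" "\<And>t. t \<noteq> 0 \<Longrightarrow> dist t 0 < e \<Longrightarrow> F t > 0" by (auto simp: eventually_at)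
    define T where "T = min T0 (e/2)"
    have T: "0 < T" "T \<le> T0" "T < e" using T0 e by (auto simp: T_def)
    have sub: "{0..T} \<subseteq> W" using segU T by auto
    have cont2: "continuous_on {0..T} (\<lambda>t. t * (T - t) * F t)"
      by (intro continuous_intros continuous_on_subset[OF cF sub])
    have "integral {0..T} (\<lambda>t. t * (T - t) * F t) = integral {0..T} (\<lambda>t. \<sigma> * (t * (T - t) * (A t - 2 * B' t)))"
      by (simp add: F_def mult_ac)
    also have "\<dots> = 0" using int0[OF T(1,2)] by simp
    finally have "((\<lambda>t. t * (T - t) * F t) has_integral 0) {0..T}"
      using integrable_continuous_real[OF cont2] by (simp add: has_integral_integrable_integral)
    moreover have "0 \<le> t * (T - t) * F t" if "t \<in> {0..T}" for t
      using that e(2)[of t] T by (cases "t = 0") (auto intro!: mult_nonneg_nonneg)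
    ultimately have "(T/2) * (T - T/2) * F (T/2) = 0"
      using has_integral_0_cbox_imp_0[of 0 T "\<lambda>t. t * (T - t) * F t" "T/2"] cont2 T by auto
    moreover have "F (T/2) > 0" using e(2)[of "T/2"] T by auto
    ultimately show False using T by simp
  qed
  have "A 0 - 2 * B' 0 \<le> 0" using key[of 1] by simp
  moreover have "0 \<le> A 0 - 2 * B' 0" using key[of "-1"] by simp
  ultimately have "A 0 = 2 * B' 0" by simp
  moreover have "lam 0 > 0" "lam 0 * lam 0 = g p v v" using lam_pos[OF segU[of 0]] T0 L_sq[OF p, of v] by (auto simp: lam_def power2_eq_square)
  ultimately have "dg p w v v * (lam 0 * lam 0) = 2 * dg p v v w * (lam 0 * lam 0) - g p v w * dg p v v v"
    using g_pos[OF p v] by (simp add: A_def B'_def field_simps power3_eq_cube)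
  then show ?thesis using \<open>lam 0 * lam 0 = g p v v\<close> by (simp add: mult_ac)
qed

text \<open>\<open>S v u w\<close> is twice the Christoffel symbol of the first kind; the equation says that the
  quadratic map \<open>v \<mapsto> S v v\<close> takes values in the line spanned by \<open>v\<close>, with factor \<open>4 \<psi> v\<close>, which forces
  \<open>\<psi>\<close> to be linear.\<close>

lemma projective_connection:
  assumes straight: minimizers_straight and p: "p \<in> U"
  shows "\<exists>\<phi>. linear \<phi> \<and> (\<forall>h v w. dg p h v w = 2 * \<phi> h * g p v w + \<phi> v * g p h w + \<phi> w * g p h v)"
proof -
  note EL = euler_lagrange[OF straight p]
  note b = bilinear_g[OF p] and bd = bilinear_dg[OF p] and sym = g_sym[OF p] and dsym = dg_sym[OF p]
  note g_simps = bilinear_ladd[OF b] bilinear_radd[OF b] bilinear_lsub[OF b] bilinear_rsub[OF b] bilinear_lmul[OF b] bilinear_rmul[OF b]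
  note dg_simps = bilinear_ladd[OF bd] bilinear_radd[OF bd] bilinear_lsub[OF bd] bilinear_rsub[OF bd] bilinear_lmul[OF bd] bilinear_rmul[OF bd]
    linear_add[OF linear_dg[OF p]] linear_diff[OF linear_dg[OF p]] linear_scale[OF linear_dg[OF p]]
  define \<psi> where "\<psi> v = dg p v v v / (4 * g p v v)" for v
  define S where "S v u w = dg p v u w + dg p u v w - dg p w u v" for v u w
  have Sdiag: "S v v w = 4 * \<psi> v * g p v w" for v w
  proof (cases "v = 0")
    case True
    then show ?thesis
      by (simp add: S_def \<psi>_def linear_0[OF linear_dg[OF p]] bilinear_lzero[OF bd] bilinear_lzero[OF b])
  next
    case False
    have pos: "g p v v > 0" by (rule g_pos[OF p False])
    have "g p v v * S v v w = g p v w * dg p v v v" using EL[of v w] by (simp add: S_def algebra_simps)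
    then show ?thesis using pos by (simp add: \<psi>_def field_simps)
  qed
  have scale: "\<psi> (c *\<^sub>R v) = c * \<psi> v" for c v
    by (cases "c = 0") (simp_all add: \<psi>_def g_simps dg_simps linear_0[OF linear_dg[OF p]] field_simps)
  have add: "\<psi> (v + u) = \<psi> v + \<psi> u" for v u
  proof (cases "v = 0 \<or> (\<exists>c. u = c *\<^sub>R v)")
    case True
    then show ?thesis
    proof
      assume "v = 0"
      then show ?thesis using scale[of 0 0] by simp
    next
      assume "\<exists>c. u = c *\<^sub>R v"
      then obtain c where "u = c *\<^sub>R v" by blast
      then show ?thesis using scale[of "1 + c" v] scale[of c v] by (simp add: scaleR_add_left distrib_right)
    qed
  next
    case False
    \<comment> \<open>\<open>S\<close> is quadratic on the diagonal, hence satisfies the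
      parallelogram identity; by \<open>Sdiag\<close> this says that \<open>z\<close> is orthogonal
      to everything. Its coefficients vanish by independence, and their sum expresses additivity of
      \<open>\<psi>\<close>.\<close>
    define z where "z = (\<psi> (v + u) + \<psi> (v - u) - 2 * \<psi> v) *\<^sub>R v + (\<psi> (v + u) - \<psi> (v - u) - 2 * \<psi> u) *\<^sub>R u"
    have "S (v + u) (v + u) w + S (v - u) (v - u) w = 2 * S v v w + 2 * S u u w" for w
      by (simp add: S_def dg_simps)
    moreover have "4 * g p z w = (S (v + u) (v + u) w + S (v - u) (v - u) w) - (2 * S v v w + 2 * S u u w)" for w
      unfolding Sdiag z_def g_simps by (simp add: algebra_simps)
    ultimately have "g p z w = 0" for w by simp
    then have "z = 0" using g_pos[OF p, of z] by fastforce
    moreover have indep: "a = 0 \<and> c = 0" if e: "a *\<^sub>R v + c *\<^sub>R u = 0" for a c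
    proof (cases "c = 0")
      case True
      then show ?thesis using e False by simp
    next
      case c: False
      have eq: "c *\<^sub>R u = - (a *\<^sub>R v)" using e by (simp add: eq_neg_iff_add_eq_0 add.commute)
      have "u = (1 / c) *\<^sub>R (c *\<^sub>R u)" using c by simp
      also have "\<dots> = (- a / c) *\<^sub>R v" unfolding eq by simp
      finally have "u = (- a / c) *\<^sub>R v" .
      then show ?thesis using False by blast
    qed
    ultimately have "\<psi> (v + u) + \<psi> (v - u) - 2 * \<psi> v = 0" "\<psi> (v + u) - \<psi> (v - u) - 2 * \<psi> u = 0"
      unfolding z_def by blast+
    then show ?thesis by simp
  qed
  have lin: "linear \<psi>" by (rule linearI) (simp_all add: add scale)
  have Spol: "S v u w = 2 * \<psi> v * g p u w + 2 * \<psi> u * g p v w" for v u w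
  proof -
    have "S (v + u) (v + u) w = S v v w + S u u w + 2 * S v u w"
      using dsym[of w u v] by (simp add: S_def dg_simps dsym[of _ u v])
    then show ?thesis unfolding Sdiag add g_simps by (simp add: algebra_simps)
  qed
  have "dg p h v w = 2 * \<psi> h * g p v w + \<psi> v * g p h w + \<psi> w * g p h v" for h v w
  proof -
    \<comment> \<open>Christoffel symbols of the first kind recover the derivative of the metric, so
      the polarized formula for \<open>S\<close> gives the claim with \<open>\<psi>\<close> as the
      covector.\<close>
    have "S h v w + S h w v = 2 * dg p h v w"
      using dsym[of h w v] dsym[of v w h] dsym[of w v h] by (simp add: S_def)
    then show ?thesis unfolding Spol by (simp add: sym[of w v] algebra_simps)
  qed
  with lin show ?thesis by blast
qed

end

subsection \<open>The weighted inverse metric\<close>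

text \<open>The Leibniz expansion is differentiated termwise and regrouped by the differentiated
  row, so that no inverse matrix enters.\<close>

lemma has_derivative_det:
  fixes A :: "'a::real_normed_vector \<Rightarrow> real^'n^'n"
  assumes "\<And>i j. ((\<lambda>x. A x $ i $ j) has_derivative (\<lambda>h. A' h $ i $ j)) (at x)"
  shows "((\<lambda>x. det (A x)) has_derivative (\<lambda>h. \<Sum>k\<in>UNIV. det (\<chi> i. if i = k then A' h $ i else A x $ i))) (at x)"
proof -
  let ?P = "{p. p permutes (UNIV::'n set)}"
  have "((\<lambda>x. det (A x)) has_derivative
     (\<lambda>h. \<Sum>p\<in>?P. of_int (sign p) * (\<Sum>k\<in>UNIV. A' h $ k $ p k * (\<Prod>i\<in>UNIV - {k}. A x $ i $ p i)))) (at x)"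
    unfolding det_def
    by (intro has_derivative_sum has_derivative_mult_right has_derivative_prod assms)
  moreover have "(\<Sum>p\<in>?P. of_int (sign p) * (\<Sum>k\<in>UNIV. A' h $ k $ p k * (\<Prod>i\<in>UNIV - {k}. A x $ i $ p i)))
     = (\<Sum>k\<in>UNIV. det (\<chi> i. if i = k then A' h $ i else A x $ i))" for h
  proof -
    have "(\<Prod>i\<in>UNIV. (\<chi> i. if i = k then A' h $ i else A x $ i) $ i $ p i) = A' h $ k $ p k * (\<Prod>i\<in>UNIV - {k}. A x $ i $ p i)" for k p
      by (subst prod.remove[of UNIV k]) (auto intro!: prod.cong)
    then show ?thesis
      unfolding det_def by (subst sum.swap) (simp add: sum_distrib_left)
  qed
  ultimately show ?thesis by simp
qed

locale projective_field = metric_field U g dg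
  for U :: "(real^'n) set" and g and dg +
  fixes \<phi> :: "real^'n \<Rightarrow> real^'n \<Rightarrow> real"
  assumes linear_\<phi>: "x \<in> U \<Longrightarrow> linear (\<phi> x)"
    and dg_eq: "x \<in> U \<Longrightarrow> dg x h v w = 2 * \<phi> x h * g x v w + \<phi> x v * g x h w + \<phi> x w * g x h v"
begin

definition G :: "real^'n \<Rightarrow> real^'n^'n" where "G x = (\<chi> i j. g x (axis i 1) (axis j 1))"

lemma G_mult: assumes x: "x \<in> U" shows "(G x *v w) $ i = g x (axis i 1) w"
proof -
  have "w = (\<Sum>j\<in>UNIV. w $ j *\<^sub>R axis j 1)"
    using basis_expansion[of w] by (simp add: scalar_mult_eq_scaleR)
  then have "g x (axis i 1) w = g x (axis i 1) (\<Sum>j\<in>UNIV. w $ j *\<^sub>R axis j 1)" by simp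
  also have "\<dots> = (\<Sum>j\<in>UNIV. w $ j * g x (axis i 1) (axis j 1))"
    using bilinear_g[OF x] by (simp add: bilinear_def linear_sum linear_scale)
  finally show ?thesis by (simp add: G_def matrix_vector_mult_def mult.commute)
qed

lemma sum_axis: assumes x: "x \<in> U" shows "g x v w = (\<Sum>i\<in>UNIV. v $ i * (G x *v w) $ i)"
proof -
  have "v = (\<Sum>j\<in>UNIV. v $ j *\<^sub>R axis j 1)"
    using basis_expansion[of v] by (simp add: scalar_mult_eq_scaleR)
  then have "g x v w = g x (\<Sum>j\<in>UNIV. v $ j *\<^sub>R axis j 1) w" by simp
  also have "\<dots> = (\<Sum>j\<in>UNIV. v $ j * g x (axis j 1) w)"
  proof -
    have l: "linear (\<lambda>v. g x v w)" using bilinear_g[OF x] by (simp add: bilinear_def)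
    show ?thesis by (simp add: linear_sum[OF l] linear_scale[OF l])
  qed
  finally show ?thesis by (simp add: G_mult[OF x])
qed

lemma g_eq_inner: "x \<in> U \<Longrightarrow> g x v w = v \<bullet> (G x *v w)"
  by (simp add: sum_axis inner_vec_def)

lemma det_G: assumes x: "x \<in> U" shows "det (G x) \<noteq> 0"
proof -
  have "w = 0" if "G x *v w = 0" for w
    using g_pos[OF x, of w] that g_eq_inner[OF x, of w w] by fastforce
  then have "invertible (G x)" using matrix_left_invertible_ker[of "G x"] by (simp add: invertible_left_inverse)
  then show ?thesis by (simp add: invertible_det_nz)
qed

text \<open>The inverse metric applied to the covector \<open>\<xi>\<close>, written by Cramer's
  rule so that differentiability in \<open>x\<close> reduces to that of determinants.\<close>

definition sharp :: "real^'n \<Rightarrow> real^'n \<Rightarrow> real^'n" where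
  "sharp x \<xi> = (\<chi> k. det (\<chi> i j. if j = k then \<xi> $ i else G x $ i $ j) / det (G x))"

lemma G_sharp: "x \<in> U \<Longrightarrow> G x *v sharp x \<xi> = \<xi>"
  using cramer[OF det_G, of x "sharp x \<xi>" \<xi>] by (simp add: sharp_def)

lemma g_sharp: "x \<in> U \<Longrightarrow> g x v (sharp x \<xi>) = \<xi> \<bullet> v" "x \<in> U \<Longrightarrow> g x (sharp x \<xi>) v = \<xi> \<bullet> v"
proof -
  show 1: "x \<in> U \<Longrightarrow> g x v (sharp x \<xi>) = \<xi> \<bullet> v" by (simp add: g_eq_inner G_sharp inner_commute)
  show "x \<in> U \<Longrightarrow> g x (sharp x \<xi>) v = \<xi> \<bullet> v" using 1 g_sym by metis
qed

lemma sharpI: assumes x: "x \<in> U" and "\<And>v. g x w v = \<xi> \<bullet> v" shows "w = sharp x \<xi>"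
proof -
  have "g x (w - sharp x \<xi>) (w - sharp x \<xi>) = 0"
    using assms g_sharp[OF x] by (simp add: bilinear_lsub[OF bilinear_g[OF x]])
  then show ?thesis using g_pos[OF x, of "w - sharp x \<xi>"] by fastforce
qed

lemma linear_sharp: "x \<in> U \<Longrightarrow> linear (sharp x)"
  by (intro linearI sharpI[symmetric])
    (auto simp: bilinear_ladd[OF bilinear_g] bilinear_lmul[OF bilinear_g] g_sharp inner_add_left)

lemma sharp_surj: "x \<in> U \<Longrightarrow> \<exists>\<xi>. sharp x \<xi> = w"
proof -
  assume x: "x \<in> U"
  have "g x w v = (G x *v w) \<bullet> v" for v using g_sym[OF x, of w v] g_eq_inner[OF x, of v w] by (simp add: inner_commute)
  from sharpI[OF x this] show ?thesis by metis
qed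

lemma has_derivative_G: "x \<in> U \<Longrightarrow> ((\<lambda>y. G y $ i $ j) has_derivative (\<lambda>h. (\<chi> i j. dg x h (axis i 1) (axis j 1)) $ i $ j)) (at x)"
  by (simp add: G_def g_deriv)

text \<open>By the connection formula, row \<open>k\<close> of the derivative of \<open>G\<close> is
  the combination of rows of \<open>G\<close> with coefficients \<open>c h k\<close>; substituting
  it for row \<open>k\<close> multiplies the determinant by \<open>c h k $ k\<close>. Summed over
  \<open>k\<close>, the three terms of \<open>c\<close> contribute \<open>2 * CARD('n)\<close>, 1
  and 1 times \<open>\<phi> x h\<close>.\<close>

lemma has_derivative_det_G:
  assumes x: "x \<in> U"
  shows "((\<lambda>y. det (G y)) has_derivative (\<lambda>h. 2 * (real CARD('n) + 1) * \<phi> x h * det (G x))) (at x)"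
proof -
  note b = bilinear_g[OF x]
  define f where "f = (\<chi> i. \<phi> x (axis i 1))"
  define a where "a = sharp x f"
  have f: "\<phi> x w = f \<bullet> w" for w
  proof -
    have "w = (\<Sum>j\<in>UNIV. w $ j *\<^sub>R axis j 1)"
      using basis_expansion[of w] by (simp add: scalar_mult_eq_scaleR)
    then have "\<phi> x w = \<phi> x (\<Sum>j\<in>UNIV. w $ j *\<^sub>R axis j 1)" by simp
    then show ?thesis
      by (simp add: linear_sum[OF linear_\<phi>[OF x]] linear_scale[OF linear_\<phi>[OF x]] f_def inner_vec_def mult.commute)
  qed
  have ga: "g x a w = \<phi> x w" for w unfolding a_def f by (rule g_sharp(2)[OF x])
  have row: "(\<Sum>i\<in>UNIV. c $ i *s row i (G x)) $ j = g x c (axis j 1)" for c j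
  proof -
    have "(\<Sum>i\<in>UNIV. c $ i *s row i (G x)) $ j = (\<Sum>i\<in>UNIV. c $ i * g x (axis i 1) (axis j 1))"
      by (simp add: sum_component row_def G_def)
    then show ?thesis by (simp add: sum_axis[OF x, of c] G_mult[OF x])
  qed
  define c where "c h k = (2 * \<phi> x h) *\<^sub>R axis k 1 + \<phi> x (axis k 1) *\<^sub>R h + g x h (axis k 1) *\<^sub>R a" for h k
  have "(\<chi> i j. dg x h (axis i 1) (axis j 1)) $ k = (\<Sum>i\<in>UNIV. c h k $ i *s row i (G x))" for h k
    unfolding vec_eq_iff row
    by (simp add: dg_eq[OF x] c_def bilinear_ladd[OF b] bilinear_lmul[OF b] ga algebra_simps)
  then have "(\<chi> i. if i = k then (\<chi> i j. dg x h (axis i 1) (axis j 1)) $ i else G x $ i)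
      = (\<chi> i. if i = k then \<Sum>i\<in>UNIV. c h k $ i *s row i (G x) else row i (G x))" for h k
    by (subst vec_eq_iff) (simp add: row_def)
  then have "det (\<chi> i. if i = k then (\<chi> i j. dg x h (axis i 1) (axis j 1)) $ i else G x $ i) = c h k $ k * det (G x)" for h k
    by (simp only: cramer_lemma_transpose)
  moreover have "(\<Sum>k\<in>UNIV. c h k $ k * det (G x)) = 2 * (real CARD('n) + 1) * \<phi> x h * det (G x)" for h
  proof -
    have "(\<Sum>k\<in>UNIV. c h k $ k) = 2 * \<phi> x h * CARD('n) + f \<bullet> h + g x a h"
      by (simp add: c_def sum.distrib f_def inner_vec_def sum_axis[OF x, of a] G_mult[OF x] g_sym[OF x, of h] mult_ac axis_def)
    then have "(\<Sum>k\<in>UNIV. c h k $ k) = 2 * (real CARD('n) + 1) * \<phi> x h" by (simp add: ga f[symmetric] algebra_simps)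
    then show ?thesis by (simp only: sum_distrib_right[symmetric])
  qed
  ultimately show ?thesis using has_derivative_det[OF has_derivative_G[OF x]] by simp
qed

lemma sharp_differentiable: "x \<in> U \<Longrightarrow> (\<lambda>y. sharp y \<xi>) differentiable (at x)"
proof -
  assume x: "x \<in> U"
  have "(\<lambda>y. sharp y \<xi> $ k) differentiable (at x)" for k
  proof -
    have "((\<lambda>y. (\<chi> i j. if j = k then \<xi> $ i else G y $ i $ j) $ i $ j) has_derivative
       (\<lambda>h. (\<chi> i j. if j = k then 0 else dg x h (axis i 1) (axis j 1)) $ i $ j)) (at x)" for i j
      using has_derivative_G[OF x, of i j] by (cases "j = k") auto
    from has_derivative_det[OF this]
    have "(\<lambda>y. det (\<chi> i j. if j = k then \<xi> $ i else G y $ i $ j)) differentiable (at x)"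
      unfolding differentiable_def by blast
    moreover have "(\<lambda>y. det (G y)) differentiable (at x)"
      using has_derivative_det_G[OF x] unfolding differentiable_def by blast
    ultimately show ?thesis unfolding sharp_def vec_lambda_beta using det_G[OF x] by (intro differentiable_divide)
  qed
  then show ?thesis
    by (subst differentiable_componentwise_within) (auto simp: Basis_vec_def inner_axis)
qed

text \<open>The square inside the logarithm replaces an absolute value and accounts for the 2 in the
  denominator of the exponent.\<close>

definition q :: "real^'n \<Rightarrow> real" where "q x = exp (- ln ((det (G x))\<^sup>2) / (2 * (real CARD('n) + 1)))"

lemma q_pos: "q x > 0" by (simp add: q_def)

lemma has_derivative_q: assumes x: "x \<in> U" shows "(q has_derivative (\<lambda>h. - 2 * \<phi> x h * q x)) (at x)"
proof -
  let ?N = "real CARD('n) + 1"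
  have N: "?N > 0" by simp
  have D: "(det (G x))\<^sup>2 > 0" using det_G[OF x] by simp
  have "((\<lambda>y. ln ((det (G y))\<^sup>2)) has_derivative (\<lambda>h. 4 * ?N * \<phi> x h)) (at x)"
    by (rule has_derivative_eq_rhs[OF has_derivative_ln[OF _ has_derivative_power[OF has_derivative_det_G[OF x]]]])
      (use D det_G[OF x] in \<open>auto simp: fun_eq_iff field_simps power2_eq_square\<close>)
  from has_derivative_mult_left[OF this, of "- 1 / (2 * ?N)"]
  have "((\<lambda>y. - ln ((det (G y))\<^sup>2) / (2 * ?N)) has_derivative (\<lambda>h. 4 * ?N * \<phi> x h * (- 1 / (2 * ?N)))) (at x)" by simp
  moreover have "4 * ?N * \<phi> x h * (- 1 / (2 * ?N)) = - 2 * \<phi> x h" for h using N by (simp add: field_simps)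
  ultimately have "((\<lambda>y. - ln ((det (G y))\<^sup>2) / (2 * ?N)) has_derivative (\<lambda>h. - 2 * \<phi> x h)) (at x)" by simp
  from has_derivative_exp[OF this] show ?thesis unfolding q_def[abs_def] by (simp add: mult.commute)
qed

end

lemma parallelI:
  fixes e k :: "'a::euclidean_space"
  assumes "\<And>\<xi>. \<xi> \<bullet> k = 0 \<Longrightarrow> e \<bullet> \<xi> = 0"
  shows "\<exists>c. e = c *\<^sub>R k"
proof (cases "k = 0")
  case True
  then have "e \<bullet> e = 0" using assms by simp
  then show ?thesis by auto
next
  case False
  define c where "c = (e \<bullet> k) / (k \<bullet> k)"
  have "(e - c *\<^sub>R k) \<bullet> k = 0" using False by (simp add: c_def inner_diff_left)
  moreover from assms[OF this] have "e \<bullet> (e - c *\<^sub>R k) = 0" .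
  ultimately have "(e - c *\<^sub>R k) \<bullet> (e - c *\<^sub>R k) = 0" by (simp add: inner_diff_left inner_diff_right inner_commute)
  then show ?thesis by auto
qed

text \<open>In a triangle with non-collinear vertices the three ratios agree.\<close>

lemma homothety_of_parallel_differences:
  fixes f :: "'a::euclidean_space \<Rightarrow> 'a"
  assumes par: "\<And>x y. x \<in> ball p r \<Longrightarrow> y \<in> ball p r \<Longrightarrow> \<exists>c. f y - f x = c *\<^sub>R (y - x)"
    and r: "r > 0" and dim: "DIM('a) \<ge> 2"
  shows "\<exists>\<gamma>. \<forall>y\<in>ball p r. f y = f p + \<gamma> *\<^sub>R (y - p)"
proof -
  define rat where "rat y = (SOME c. f y - f p = c *\<^sub>R (y - p))" for y
  have rat: "f y - f p = rat y *\<^sub>R (y - p)" if "y \<in> ball p r" for y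
    unfolding rat_def by (rule someI_ex) (use par[of p y] that r in auto)
  have same: "rat y = rat z" if yz: "y \<in> ball p r" "z \<in> ball p r"
    and ind: "\<And>a b. a *\<^sub>R (y - p) + b *\<^sub>R (z - p) = 0 \<Longrightarrow> a = 0 \<and> b = 0" for y z
  proof -
    obtain c where c: "f z - f y = c *\<^sub>R (z - y)" using par yz by blast
    have "f z - f y = (f z - f p) - (f y - f p)" by simp
    then have 1: "c *\<^sub>R (z - y) = rat z *\<^sub>R (z - p) - rat y *\<^sub>R (y - p)" by (simp only: c rat[OF yz(1)] rat[OF yz(2)])
    have "(c - rat y) *\<^sub>R Y + (rat z - c) *\<^sub>R Z = (rat z *\<^sub>R Z - rat y *\<^sub>R Y) - c *\<^sub>R (Z - Y)" for Y Z :: 'a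
      by (simp add: algebra_simps)
    from this[of "y - p" "z - p"] have "(c - rat y) *\<^sub>R (y - p) + (rat z - c) *\<^sub>R (z - p) = 0"
      unfolding 1[symmetric] by simp
    from ind[OF this] show ?thesis by simp
  qed
  have "\<not> card (Basis::'a set) \<le> Suc 0" using dim by simp
  then obtain i j :: 'a where ij: "i \<in> Basis" "j \<in> Basis" "i \<noteq> j"
    using card_le_Suc0_iff_eq[OF finite_Basis] by metis
  define yi where "yi = p + (r/2) *\<^sub>R i"
  define yj where "yj = p + (r/2) *\<^sub>R j"
  have yij: "yi \<in> ball p r" "yj \<in> ball p r" using r ij by (auto simp: yi_def yj_def dist_norm)
  have nonpar: "a = 0 \<and> b = 0" if e: "a *\<^sub>R v + b *\<^sub>R w = 0" and w: "w \<noteq> 0" and nv: "\<And>c. v \<noteq> c *\<^sub>R w" for a b and v w :: 'a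
  proof (cases "a = 0")
    case True then show ?thesis using e w by simp
  next
    case False
    have eq: "a *\<^sub>R v = - (b *\<^sub>R w)" using e by (simp add: eq_neg_iff_add_eq_0)
    have "v = (1 / a) *\<^sub>R (a *\<^sub>R v)" using False by simp
    also have "\<dots> = (- b / a) *\<^sub>R w" unfolding eq by simp
    finally show ?thesis using nv by blast
  qed
  have "rat yi = rat yj"
  proof (rule same[OF yij])
    fix a b assume "a *\<^sub>R (yi - p) + b *\<^sub>R (yj - p) = 0"
    then have "(a * (r/2)) *\<^sub>R i + (b * (r/2)) *\<^sub>R j = 0" by (simp add: yi_def yj_def)
    then have "((a * (r/2)) *\<^sub>R i + (b * (r/2)) *\<^sub>R j) \<bullet> i = 0" "((a * (r/2)) *\<^sub>R i + (b * (r/2)) *\<^sub>R j) \<bullet> j = 0" by simp_all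
    then show "a = 0 \<and> b = 0" using ij r by (simp add: inner_add_left inner_Basis)
  qed
  \<comment> \<open>Every \<open>y \<noteq> p\<close> is independent of at least one of the two
    reference directions and therefore has their common ratio.\<close>
  have "f y = f p + rat yi *\<^sub>R (y - p)" if y: "y \<in> ball p r" for y
  proof (cases "y = p")
    case False
    have "rat y = rat yi"
    proof (cases "\<exists>c. y - p = c *\<^sub>R (yi - p)")
      case True
      then obtain c where c: "y - p = c *\<^sub>R (yi - p)" by blast
      have "y - p \<noteq> e *\<^sub>R (yj - p)" for e
      proof
        assume "y - p = e *\<^sub>R (yj - p)"
        then have "(c * (r/2)) *\<^sub>R i = (e * (r/2)) *\<^sub>R j" using c by (simp add: yi_def yj_def)
        then have "((c * (r/2)) *\<^sub>R i) \<bullet> i = ((e * (r/2)) *\<^sub>R j) \<bullet> i" by simp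
        then have "c = 0" using ij r by (simp add: inner_Basis)
        then show False using c False by simp
      qed
      moreover have "yj - p \<noteq> 0" using ij r by (auto simp: yj_def)
      ultimately have "rat y = rat yj" using nonpar by (intro same[OF y yij(2)]) blast
      then show ?thesis using \<open>rat yi = rat yj\<close> by simp
    next
      case c: False
      moreover have "yi - p \<noteq> 0" using ij r by (auto simp: yi_def)
      ultimately show ?thesis using nonpar by (intro same[OF y yij(1)]) blast
    qed
    then show ?thesis using rat[OF y] by (simp add: algebra_simps)
  qed auto
  then show ?thesis by blast
qed

section \<open>The field \<beta> and integration of the weighted inverse metric\<close>

context projective_field begin

definition sig :: "real^'n \<Rightarrow> real^'n \<Rightarrow> real^'n" where "sig x \<xi> = sharp x \<xi> /\<^sub>R q x"

definition \<beta> :: "real^'n \<Rightarrow> real^'n" where "\<beta> x = (\<chi> i. - \<phi> x (sig x (axis i 1)))"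

lemma linear_sig: "x \<in> U \<Longrightarrow> linear (sig x)"
  unfolding sig_def[abs_def] by (intro linear_compose_scale_right linear_sharp)

lemma \<beta>_inner: assumes x: "x \<in> U" shows "\<beta> x \<bullet> \<xi> = - \<phi> x (sig x \<xi>)"
proof -
  have lin: "linear (\<lambda>\<xi>. \<phi> x (sig x \<xi>))"
    using linear_compose[OF linear_sig[OF x] linear_\<phi>[OF x]] by (simp add: o_def)
  have "\<xi> = (\<Sum>j\<in>UNIV. \<xi> $ j *\<^sub>R axis j 1)"
    using basis_expansion[of \<xi>] by (simp add: scalar_mult_eq_scaleR)
  then have "\<phi> x (sig x \<xi>) = \<phi> x (sig x (\<Sum>j\<in>UNIV. \<xi> $ j *\<^sub>R axis j 1))" by simp
  also have "\<dots> = (\<Sum>j\<in>UNIV. \<xi> $ j * \<phi> x (sig x (axis j 1)))"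
    by (simp add: linear_sum[OF lin] linear_scale[OF lin])
  finally show ?thesis by (simp add: \<beta>_def inner_vec_def sum_negf mult.commute)
qed

text \<open>Differentiate the identity \<open>g y a (sharp y \<eta>) = \<eta> \<bullet> a\<close>,
  whose right side is constant in \<open>y\<close>, with \<open>a = sharp x \<xi>\<close> held
  fixed.\<close>

lemma has_derivative_sharp:
  assumes x: "x \<in> U"
  shows "((\<lambda>y. sharp y \<eta> \<bullet> \<xi>) has_derivative (\<lambda>h. - dg x h (sharp x \<xi>) (sharp x \<eta>))) (at x)"
proof -
  obtain s' where s': "((\<lambda>y. sharp y \<eta>) has_derivative s') (at x)"
    using sharp_differentiable[OF x] unfolding differentiable_def by blast
  define a where "a = sharp x \<xi>"
  note b = bilinear_g[OF x] and bd = bilinear_dg[OF x]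
  have exp: "g y a w = (\<Sum>j\<in>UNIV. (w \<bullet> axis j 1) * g y a (axis j 1))" if "y \<in> U" for y w
    using sum_axis[OF that, of w a] by (simp add: G_mult[OF that] g_sym[OF that] inner_axis)
  have expd: "dg x h a w = (\<Sum>j\<in>UNIV. (w \<bullet> axis j 1) * dg x h a (axis j 1))" for h w
  proof -
    have l: "linear (dg x h a)" using bd by (simp add: bilinear_def)
    have "w = (\<Sum>j\<in>UNIV. w $ j *\<^sub>R axis j 1)"
      using basis_expansion[of w] by (simp add: scalar_mult_eq_scaleR)
    then have "dg x h a w = dg x h a (\<Sum>j\<in>UNIV. w $ j *\<^sub>R axis j 1)" by simp
    then show ?thesis by (simp add: linear_sum[OF l] linear_scale[OF l] inner_axis)
  qed
  have "((\<lambda>y. \<Sum>j\<in>UNIV. (sharp y \<eta> \<bullet> axis j 1) * g y a (axis j 1)) has_derivative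
      (\<lambda>h. \<Sum>j\<in>UNIV. (sharp x \<eta> \<bullet> axis j 1) * dg x h a (axis j 1) + (s' h \<bullet> axis j 1) * g x a (axis j 1))) (at x)"
    by (intro has_derivative_sum has_derivative_mult has_derivative_inner_left s' g_deriv x)
  moreover have "(\<Sum>j\<in>UNIV. (sharp x \<eta> \<bullet> axis j 1) * dg x h a (axis j 1) + (s' h \<bullet> axis j 1) * g x a (axis j 1))
     = dg x h a (sharp x \<eta>) + g x a (s' h)" for h
    by (simp add: sum.distrib exp[OF x, of "s' h"] expd[of h "sharp x \<eta>"])
  ultimately have "((\<lambda>y. \<Sum>j\<in>UNIV. (sharp y \<eta> \<bullet> axis j 1) * g y a (axis j 1)) has_derivative (\<lambda>h. dg x h a (sharp x \<eta>) + g x a (s' h))) (at x)"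
    by simp
  then have "((\<lambda>y. \<eta> \<bullet> a) has_derivative (\<lambda>h. dg x h a (sharp x \<eta>) + g x a (s' h))) (at x)"
    by (rule has_derivative_transform_within_open[OF _ open_U x]) (simp add: exp[symmetric] g_sharp)
  then have "(\<lambda>h. dg x h a (sharp x \<eta>) + g x a (s' h)) = (\<lambda>h. 0)"
    by (rule has_derivative_unique) (rule has_derivative_const)
  then have "\<xi> \<bullet> s' h = - dg x h a (sharp x \<eta>)" for h
    using g_sharp(2)[OF x, of \<xi> "s' h"] unfolding a_def[symmetric] by (metis add_eq_0_iff)
  moreover have "((\<lambda>y. sharp y \<eta> \<bullet> \<xi>) has_derivative (\<lambda>h. s' h \<bullet> \<xi>)) (at x)"
    by (rule has_derivative_inner_left[OF s'])
  ultimately show ?thesis by (simp add: a_def inner_commute)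
qed

text \<open>The term with factor \<open>2 * \<phi> x h\<close> in \<open>dg\<close> is cancelled by
  the derivative of \<open>1 / q\<close>; only the two mixed terms of the connection formula
  survive.\<close>

lemma has_derivative_sig:
  assumes x: "x \<in> U"
  shows "((\<lambda>y. sig y \<eta> \<bullet> \<xi>) has_derivative (\<lambda>h. (\<beta> x \<bullet> \<xi>) * (\<eta> \<bullet> h) + (\<beta> x \<bullet> \<eta>) * (\<xi> \<bullet> h))) (at x)"
proof -
  have q: "q x > 0" by (rule q_pos)
  have "((\<lambda>y. sharp y \<eta> \<bullet> \<xi> / q y) has_derivative
     (\<lambda>h. (- dg x h (sharp x \<xi>) (sharp x \<eta>) * q x - (sharp x \<eta> \<bullet> \<xi>) * (- 2 * \<phi> x h * q x)) / (q x * q x))) (at x)"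
    using q by (intro has_derivative_divide' has_derivative_sharp has_derivative_q x) auto
  moreover have "(- dg x h (sharp x \<xi>) (sharp x \<eta>) * q x - (sharp x \<eta> \<bullet> \<xi>) * (- 2 * \<phi> x h * q x)) / (q x * q x)
     = (\<beta> x \<bullet> \<xi>) * (\<eta> \<bullet> h) + (\<beta> x \<bullet> \<eta>) * (\<xi> \<bullet> h)" for h
  proof -
    have e: "\<beta> x \<bullet> \<zeta> = - \<phi> x (sharp x \<zeta>) / q x" for \<zeta>
      by (simp add: \<beta>_inner[OF x] sig_def linear_scale[OF linear_\<phi>[OF x]] divide_inverse_commute)
    have gs: "g x (sharp x \<xi>) (sharp x \<eta>) = sharp x \<eta> \<bullet> \<xi>" "g x h (sharp x \<eta>) = \<eta> \<bullet> h" "g x h (sharp x \<xi>) = \<xi> \<bullet> h"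
      by (simp add: g_sharp(2)[OF x] inner_commute) (simp_all add: g_sharp(1)[OF x])
    show ?thesis using q unfolding dg_eq[OF x] gs e by (simp add: field_simps)
  qed
  ultimately show ?thesis by (simp add: sig_def divide_inverse_commute inner_scaleR_left)
qed

text \<open>If \<open>\<xi>\<close> is orthogonal to \<open>y - x\<close>, then \<open>f\<close>
  agrees at \<open>x + t *\<^sub>R \<xi>\<close> and \<open>y + t *\<^sub>R \<xi>\<close> for small
  \<open>t\<close>. Differentiating in \<open>t\<close> at 0 yields
  \<open>\<beta> x \<bullet> \<xi> = \<beta> y \<bullet> \<xi>\<close>. This compares values of
  \<open>\<beta>\<close> at two points before anything is known about its derivative.\<close>

lemma \<beta>_parallel:
  assumes B: "ball p r \<subseteq> U" and xy: "x \<in> ball p r" "y \<in> ball p r"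
  shows "\<exists>c. \<beta> y - \<beta> x = c *\<^sub>R (y - x)"
proof (rule parallelI)
  fix \<xi> assume \<xi>: "\<xi> \<bullet> (y - x) = 0"
  show "(\<beta> y - \<beta> x) \<bullet> \<xi> = 0"
  proof (cases "\<xi> = 0")
    case False
    define f where "f z = sig z \<xi> \<bullet> \<xi>" for z
    have line: "((\<lambda>t. f (z + t *\<^sub>R k)) has_real_derivative 2 * (\<beta> (z + t *\<^sub>R k) \<bullet> \<xi>) * (\<xi> \<bullet> k)) (at t within T)"
      if "z + t *\<^sub>R k \<in> U" for z k t T
    proof -
      have 1: "((\<lambda>t. z + t *\<^sub>R k) has_derivative (\<lambda>s. s *\<^sub>R k)) (at t within T)" by (auto intro!: derivative_eq_intros)
      have "((\<lambda>t. f (z + t *\<^sub>R k)) has_derivative (\<lambda>s. (\<beta> (z + t *\<^sub>R k) \<bullet> \<xi>) * (\<xi> \<bullet> (s *\<^sub>R k)) + (\<beta> (z + t *\<^sub>R k) \<bullet> \<xi>) * (\<xi> \<bullet> (s *\<^sub>R k)))) (at t within T)"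
        unfolding f_def by (rule has_derivative_compose[OF 1 has_derivative_sig[OF that]])
      moreover have "(\<lambda>s. (\<beta> (z + t *\<^sub>R k) \<bullet> \<xi>) * (\<xi> \<bullet> (s *\<^sub>R k)) + (\<beta> (z + t *\<^sub>R k) \<bullet> \<xi>) * (\<xi> \<bullet> (s *\<^sub>R k)))
          = (*) (2 * (\<beta> (z + t *\<^sub>R k) \<bullet> \<xi>) * (\<xi> \<bullet> k))" by (rule ext) simp
      ultimately show ?thesis by (simp add: has_field_derivative_def)
    qed
    have const: "f a = f b" if ab: "a \<in> ball p r" "b \<in> ball p r" "\<xi> \<bullet> (b - a) = 0" for a b
    proof -
      have seg: "a + t *\<^sub>R (b - a) \<in> U" if "t \<in> {0..1}" for t
      proof -
        have "a + t *\<^sub>R (b - a) = (1 - t) *\<^sub>R a + t *\<^sub>R b" by (simp add: algebra_simps)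
        then show ?thesis using convexD_alt[OF convex_ball ab(1,2), of t] that B by auto
      qed
      have "((\<lambda>t. f (a + t *\<^sub>R (b - a))) has_real_derivative 0) (at t within {0..1})" if "t \<in> {0..1}" for t
        using line[OF seg[OF that]] ab(3) by simp
      from has_field_derivative_zero_constant[OF convex_real_interval(5) this]
      obtain c where c: "\<forall>t\<in>{0..1}. f (a + t *\<^sub>R (b - a)) = c" by blast
      show ?thesis using bspec[OF c, of 0] bspec[OF c, of 1] by simp
    qed
    define W where "W = {t. x + t *\<^sub>R \<xi> \<in> ball p r} \<inter> {t. y + t *\<^sub>R \<xi> \<in> ball p r}"
    have "open ((\<lambda>t. x + t *\<^sub>R \<xi>) -` ball p r \<inter> (\<lambda>t. y + t *\<^sub>R \<xi>) -` ball p r)"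
      by (intro open_Int open_vimage open_ball continuous_intros)
    then have W: "open W" by (simp add: W_def vimage_def)
    have W0: "0 \<in> W" using xy by (simp add: W_def)
    have U: "x + 0 *\<^sub>R \<xi> \<in> U" "y + 0 *\<^sub>R \<xi> \<in> U" using xy B by auto
    have "((\<lambda>t. f (x + t *\<^sub>R \<xi>)) has_real_derivative 2 * (\<beta> x \<bullet> \<xi>) * (\<xi> \<bullet> \<xi>)) (at 0)"
      using line[OF U(1), of UNIV] by simp
    moreover have "((\<lambda>t. f (x + t *\<^sub>R \<xi>)) has_real_derivative 2 * (\<beta> y \<bullet> \<xi>) * (\<xi> \<bullet> \<xi>)) (at 0)"
    proof (rule has_field_derivative_transform_within_open[OF _ W W0])
      show "((\<lambda>t. f (y + t *\<^sub>R \<xi>)) has_real_derivative 2 * (\<beta> y \<bullet> \<xi>) * (\<xi> \<bullet> \<xi>)) (at 0)"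
        using line[OF U(2), of UNIV] by simp
      show "f (y + t *\<^sub>R \<xi>) = f (x + t *\<^sub>R \<xi>)" if "t \<in> W" for t
        using that \<xi> by (intro const[symmetric]) (auto simp: W_def)
    qed
    ultimately have "2 * (\<beta> x \<bullet> \<xi>) * (\<xi> \<bullet> \<xi>) = 2 * (\<beta> y \<bullet> \<xi>) * (\<xi> \<bullet> \<xi>)" by (rule DERIV_unique)
    then show ?thesis using False by (simp add: inner_diff_left)
  qed simp
qed

text \<open>The ratio on a small ball is the derivative of \<open>\<beta>\<close> at each of its
  points, so it is locally constant, hence constant on the connected set \<open>U\<close>.\<close>

lemma \<beta>_affine:
  assumes conn: "connected U" and dim: "CARD('n) \<ge> 2" and p: "p \<in> U"
  shows "\<exists>\<gamma>. \<forall>x\<in>U. \<beta> x = \<beta> p + \<gamma> *\<^sub>R (x - p)"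
proof -
  have loc: "\<exists>\<gamma> r. r > 0 \<and> ball x r \<subseteq> U \<and> (\<forall>y\<in>ball x r. \<beta> y = \<beta> x + \<gamma> *\<^sub>R (y - x))" if x: "x \<in> U" for x
  proof -
    obtain r where r: "r > 0" "ball x r \<subseteq> U" using open_U x open_contains_ball by blast
    have "\<exists>\<gamma>. \<forall>y\<in>ball x r. \<beta> y = \<beta> x + \<gamma> *\<^sub>R (y - x)"
      by (rule homothety_of_parallel_differences) (use \<beta>_parallel[OF r(2)] r(1) dim in auto)
    with r show ?thesis by blast
  qed
  define c where "c x = (SOME \<gamma>. \<exists>r>0. ball x r \<subseteq> U \<and> (\<forall>y\<in>ball x r. \<beta> y = \<beta> x + \<gamma> *\<^sub>R (y - x)))" for x
  have c: "\<exists>r>0. ball x r \<subseteq> U \<and> (\<forall>y\<in>ball x r. \<beta> y = \<beta> x + c x *\<^sub>R (y - x))" if "x \<in> U" for x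
    unfolding c_def by (rule someI_ex) (use loc[OF that] in blast)
  have deriv: "(\<beta> has_derivative (\<lambda>h. \<gamma> *\<^sub>R h)) (at y)"
    if "\<forall>z\<in>ball x r. \<beta> z = \<beta> x + \<gamma> *\<^sub>R (z - x)" "y \<in> ball x r" for x y r \<gamma>
  proof (rule has_derivative_transform_within_open[OF _ open_ball that(2)])
    show "((\<lambda>z. \<beta> x + \<gamma> *\<^sub>R (z - x)) has_derivative (\<lambda>h. \<gamma> *\<^sub>R h)) (at y)"
      by (auto intro!: derivative_eq_intros)
  qed (use that in auto)
  have d\<beta>: "(\<beta> has_derivative (\<lambda>h. c x *\<^sub>R h)) (at x)" if "x \<in> U" for x
    using c[OF that] deriv[of x _ _ x] by (metis centre_in_ball)
  have dc: "(c has_derivative (\<lambda>h. 0)) (at x)" if x: "x \<in> U" for x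
  proof -
    obtain r where r: "r > 0" "ball x r \<subseteq> U" "\<forall>y\<in>ball x r. \<beta> y = \<beta> x + c x *\<^sub>R (y - x)" using c[OF x] by blast
    have "c y = c x" if y: "y \<in> ball x r" for y
    proof -
      have yU: "y \<in> U" using y r(2) by auto
      have "(\<lambda>h. c y *\<^sub>R h) = (\<lambda>h::real^'n. c x *\<^sub>R h)"
        by (rule has_derivative_unique[OF d\<beta>[OF yU] deriv[OF r(3) y]])
      from fun_cong[OF this, of "axis undefined 1"] show ?thesis by (simp add: axis_eq_0_iff)
    qed
    moreover have "((\<lambda>y. c x) has_derivative (\<lambda>h. 0)) (at x)" by (rule has_derivative_const)
    ultimately show ?thesis
      using r(1) by (metis centre_in_ball has_derivative_transform_within_open open_ball)
  qed
  have "c x = c p" if "x \<in> U" for x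
    by (rule has_derivative_zero_unique_connected[OF open_U conn dc that p])
  then have "((\<lambda>x. \<beta> x - c p *\<^sub>R (x - p)) has_derivative (\<lambda>h. 0)) (at x)" if "x \<in> U" for x
    using d\<beta>[OF that] that by (auto intro!: derivative_eq_intros)
  then have "\<beta> x - c p *\<^sub>R (x - p) = \<beta> p - c p *\<^sub>R (p - p)" if "x \<in> U" for x
    by (rule has_derivative_zero_unique_connected[OF open_U conn _ that p])
  then have "\<forall>x\<in>U. \<beta> x = \<beta> p + c p *\<^sub>R (x - p)" by (auto simp: algebra_simps)
  then show ?thesis by blast
qed

lemma sig_quadratic:
  assumes conn: "connected U" and p: "p \<in> U" and x: "x \<in> U"
    and \<gamma>: "\<And>x. x \<in> U \<Longrightarrow> \<beta> x = \<beta> p + \<gamma> *\<^sub>R (x - p)"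
  shows "sig x \<xi> = sig p \<xi> + (\<beta> p \<bullet> \<xi>) *\<^sub>R (x - p) + ((x - p) \<bullet> \<xi>) *\<^sub>R \<beta> p + (\<gamma> * ((x - p) \<bullet> \<xi>)) *\<^sub>R (x - p)"
proof -
  have "sig x \<xi> \<bullet> \<eta> = (sig p \<xi> + (\<beta> p \<bullet> \<xi>) *\<^sub>R (x - p) + ((x - p) \<bullet> \<xi>) *\<^sub>R \<beta> p + (\<gamma> * ((x - p) \<bullet> \<xi>)) *\<^sub>R (x - p)) \<bullet> \<eta>" for \<eta>
  proof -
    define F where "F y = sig y \<xi> \<bullet> \<eta> - (\<beta> p \<bullet> \<xi>) * ((y - p) \<bullet> \<eta>) - ((y - p) \<bullet> \<xi>) * (\<beta> p \<bullet> \<eta>) - \<gamma> * ((y - p) \<bullet> \<xi>) * ((y - p) \<bullet> \<eta>)" for y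
    have "(F has_derivative (\<lambda>h. 0)) (at y)" if y: "y \<in> U" for y
      unfolding F_def
      by (rule derivative_eq_intros has_derivative_sig[OF y] refl)+
        (simp add: fun_eq_iff \<gamma>[OF y] inner_add_left inner_commute[of _ \<xi>] inner_commute[of _ \<eta>] inner_add_right algebra_simps)
    from has_derivative_zero_unique_connected[OF open_U conn this x p]
    have "F x = F p" .
    then show ?thesis by (simp add: F_def inner_add_left)
  qed
  then show ?thesis using vector_eq_rdot by blast
qed

end

subsection \<open>Normal form of the metric\<close>

text \<open>Gram-Schmidt, indexed by subsets of \<open>Basis\<close>: while fewer than
  \<open>DIM('a)\<close> vectors have been chosen, some \<open>v\<close> lies outside their
  span.\<close>

lemma inner_product_isometry:
  fixes \<kappa> :: "'a::euclidean_space \<Rightarrow> 'a \<Rightarrow> real"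
  assumes bil: "bilinear \<kappa>" and sym: "\<And>v w. \<kappa> v w = \<kappa> w v" and pos: "\<And>v. v \<noteq> 0 \<Longrightarrow> \<kappa> v v > 0"
  obtains Q :: "'a \<Rightarrow> 'a" where "linear Q" "bij Q" "\<And>v w. \<kappa> v w = Q v \<bullet> Q w"
proof -
  have linr: "linear (\<kappa> v)" and linl: "linear (\<lambda>v. \<kappa> v w)" for v w using bil by (auto simp: bilinear_def)
  have "\<exists>f. \<forall>i\<in>B. \<forall>j\<in>B. \<kappa> (f i) (f j) = (if i = j then 1 else 0)" if "B \<subseteq> (Basis::'a set)" for B
    using finite_subset[OF that finite_Basis] that
  proof (induction B rule: finite_induct)
    case (insert b B)
    then obtain f where f: "\<And>i j. i \<in> B \<Longrightarrow> j \<in> B \<Longrightarrow> \<kappa> (f i) (f j) = (if i = j then 1 else 0)" by auto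
    have "dim (f ` B) \<le> card (f ` B)" using insert(1) by (intro dim_le_card') auto
    also have "\<dots> \<le> card B" using insert(1) by (rule card_image_le)
    also have "\<dots> < card (insert b B)" using insert by simp
    also have "\<dots> \<le> DIM('a)" using insert by (intro card_mono) auto
    finally have "span (f ` B) \<noteq> UNIV" by (metis dim_UNIV dim_span less_irrefl)
    then obtain v where v: "v \<notin> span (f ` B)" by blast
    define e where "e = v - (\<Sum>i\<in>B. \<kappa> v (f i) *\<^sub>R f i)"
    have "(\<Sum>i\<in>B. \<kappa> v (f i) *\<^sub>R f i) \<in> span (f ` B)"
      by (intro span_sum span_scale span_base) auto
    then have "e \<noteq> 0" using v by (auto simp: e_def)
    then have ee: "\<kappa> e e > 0" by (rule pos)
    have ef: "\<kappa> e (f j) = 0" if j: "j \<in> B" for j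
    proof -
      have "\<kappa> e (f j) = \<kappa> v (f j) - (\<Sum>i\<in>B. \<kappa> v (f i) * \<kappa> (f i) (f j))"
        by (simp add: e_def linear_diff[OF linl] linear_sum[OF linl] linear_scale[OF linl])
      also have "(\<Sum>i\<in>B. \<kappa> v (f i) * \<kappa> (f i) (f j)) = (\<Sum>i\<in>B. if i = j then \<kappa> v (f i) else 0)"
        by (intro sum.cong) (use f j in auto)
      finally show ?thesis using j insert(1) by simp
    qed
    define u where "u = (1 / sqrt (\<kappa> e e)) *\<^sub>R e"
    have "\<kappa> u u = 1" using ee by (simp add: u_def linear_scale[OF linl] linear_scale[OF linr])
    moreover have "\<kappa> u (f j) = 0" if "j \<in> B" for j using ef[OF that] by (simp add: u_def linear_scale[OF linl])
    ultimately show ?case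
      using f insert(2) sym by (intro exI[of _ "f(b := u)"]) auto
  qed simp
  from this[OF order_refl] obtain f :: "'a \<Rightarrow> 'a" where
    "\<forall>i\<in>Basis. \<forall>j\<in>Basis. \<kappa> (f i) (f j) = (if i = j then 1 else 0)" by blast
  then have f: "\<And>i j. i \<in> Basis \<Longrightarrow> j \<in> Basis \<Longrightarrow> \<kappa> (f i) (f j) = (if i = j then 1 else 0)" by simp
  define Q where "Q v = (\<Sum>i\<in>Basis. \<kappa> v (f i) *\<^sub>R i)" for v
  define P where "P x = (\<Sum>i\<in>Basis. (x \<bullet> i) *\<^sub>R f i)" for x
  have Q: "linear Q" unfolding Q_def
    by (intro linearI) (simp_all add: linear_add[OF linl] linear_scale[OF linl] scaleR_add_left sum.distrib scaleR_sum_right)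
  have QP: "Q (P x) = x" for x
  proof -
    have "\<kappa> (P x) (f j) = x \<bullet> j" if j: "j \<in> Basis" for j
    proof -
      have "\<kappa> (P x) (f j) = (\<Sum>i\<in>Basis. (x \<bullet> i) * \<kappa> (f i) (f j))"
        by (simp add: P_def linear_sum[OF linl] linear_scale[OF linl])
      also have "\<dots> = (\<Sum>i\<in>Basis. if i = j then x \<bullet> i else 0)" by (intro sum.cong) (use f j in auto)
      finally show ?thesis using j by simp
    qed
    then show ?thesis by (simp add: Q_def euclidean_representation)
  qed
  then have "surj Q" by (metis surjI)
  then have "inj Q" using linear_surjective_imp_injective[OF Q] by blast
  have PQ: "P (Q v) = v" for v using QP[of "Q v"] \<open>inj Q\<close> by (simp add: inj_eq)
  have "\<kappa> v w = Q v \<bullet> Q w" for v w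
  proof -
    have "\<kappa> v w = \<kappa> v (P (Q w))" by (simp add: PQ)
    also have "\<dots> = (\<Sum>i\<in>Basis. (Q w \<bullet> i) * \<kappa> v (f i))"
      by (simp add: P_def linear_sum[OF linr] linear_scale[OF linr])
    also have "\<dots> = Q v \<bullet> Q w"
    proof -
      have "(\<Sum>i\<in>Basis. (z \<bullet> i) * \<kappa> v (f i)) = Q v \<bullet> z" for z
        by (simp add: Q_def inner_sum_left inner_commute[of z] mult.commute)
      then show ?thesis .
    qed
    finally show ?thesis .
  qed
  with Q \<open>surj Q\<close> \<open>inj Q\<close> that show thesis by (simp add: bij_def)
qed

text \<open>In the coordinates \<open>y\<close> below, the weighted inverse metric is \<open>model_sig b \<gamma> y\<close>; the identities
  express its inverse and the gradient of its determinant \<open>model_q b \<epsilon> y\<close> for \<open>\<gamma> = \<epsilon> + b \<bullet> b\<close>.\<close>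

definition model_sig :: "'a::real_inner \<Rightarrow> real \<Rightarrow> 'a \<Rightarrow> 'a \<Rightarrow> 'a" where
  "model_sig b \<gamma> y \<eta> = \<eta> + (b \<bullet> \<eta>) *\<^sub>R y + (y \<bullet> \<eta>) *\<^sub>R b + (\<gamma> * (y \<bullet> \<eta>)) *\<^sub>R y"

definition model_q :: "'a::real_inner \<Rightarrow> real \<Rightarrow> 'a \<Rightarrow> real" where
  "model_q b \<epsilon> y = (1 + b \<bullet> y)\<^sup>2 + \<epsilon> * (y \<bullet> y)"

definition model_grad :: "'a::real_inner \<Rightarrow> real \<Rightarrow> 'a \<Rightarrow> 'a" where
  "model_grad b \<epsilon> y = (1 + b \<bullet> y) *\<^sub>R b + \<epsilon> *\<^sub>R y"

definition model_adj :: "'a::real_inner \<Rightarrow> real \<Rightarrow> 'a \<Rightarrow> 'a \<Rightarrow> 'a" where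
  "model_adj b \<epsilon> y v = model_q b \<epsilon> y *\<^sub>R v + ((y \<bullet> y) * (b \<bullet> v) - (1 + b \<bullet> y) * (y \<bullet> v)) *\<^sub>R b
     - ((1 + b \<bullet> y) * (b \<bullet> v) + \<epsilon> * (y \<bullet> v)) *\<^sub>R y"

lemma model_sig_sym: "model_sig b \<gamma> y \<eta> \<bullet> \<zeta> = \<eta> \<bullet> model_sig b \<gamma> y \<zeta>"
  by (simp add: model_sig_def inner_add_left inner_add_right inner_commute)

lemma model_sig_adj:
  fixes b y v :: "'a::real_inner"
  shows "model_sig b (\<epsilon> + b \<bullet> b) y (model_adj b \<epsilon> y v) = model_q b \<epsilon> y *\<^sub>R v"
proof -
  define s where "s = 1 + b \<bullet> y"
  define nb where "nb = (y \<bullet> y) * (b \<bullet> v) - s * (y \<bullet> v)"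
  define ny where "ny = - (s * (b \<bullet> v) + \<epsilon> * (y \<bullet> v))"
  have q: "model_q b \<epsilon> y = s\<^sup>2 + \<epsilon> * (y \<bullet> y)" by (simp add: model_q_def s_def)
  have N: "model_adj b \<epsilon> y v = model_q b \<epsilon> y *\<^sub>R v + nb *\<^sub>R b + ny *\<^sub>R y"
    unfolding model_adj_def nb_def ny_def s_def scaleR_minus_left by simp
  have b_y: "b \<bullet> y = s - 1" "y \<bullet> b = s - 1" by (auto simp: s_def inner_commute)
  \<comment> \<open>Applied to the adjugate, \<open>model_sig\<close> has coefficient
    \<open>nb + y \<bullet> model_adj b \<epsilon> y v\<close> at \<open>b\<close> and the left side
    of the next identity at \<open>y\<close>. Both vanish, and the multiple of \<open>v\<close>
    remains.\<close>
  have 1: "y \<bullet> model_adj b \<epsilon> y v = - nb"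
    unfolding N inner_add_right inner_scaleR_right b_y q nb_def ny_def by (simp add: algebra_simps power2_eq_square)
  have 2: "ny + b \<bullet> model_adj b \<epsilon> y v - (\<epsilon> + b \<bullet> b) * nb = 0"
    unfolding N inner_add_right inner_scaleR_right b_y q nb_def ny_def by (simp add: algebra_simps power2_eq_square)
  have "model_sig b (\<epsilon> + b \<bullet> b) y (model_adj b \<epsilon> y v) =
      model_q b \<epsilon> y *\<^sub>R v + (ny + b \<bullet> model_adj b \<epsilon> y v - (\<epsilon> + b \<bullet> b) * nb) *\<^sub>R y"
    unfolding model_sig_def 1 by (subst N) (simp add: algebra_simps)
  then show ?thesis by (simp add: 2)
qed

lemma model_sig_grad:
  fixes b y :: "'a::real_inner"
  shows "model_sig b (\<epsilon> + b \<bullet> b) y (model_grad b \<epsilon> y) = model_q b \<epsilon> y *\<^sub>R (b + (\<epsilon> + b \<bullet> b) *\<^sub>R y)"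
proof -
  define s where "s = 1 + b \<bullet> y"
  have b_y: "b \<bullet> y = s - 1" "y \<bullet> b = s - 1" by (auto simp: s_def inner_commute)
  have 1: "y \<bullet> model_grad b \<epsilon> y = model_q b \<epsilon> y - s"
    unfolding model_grad_def model_q_def inner_add_right inner_scaleR_right b_y by (simp add: algebra_simps power2_eq_square)
  have 2: "b \<bullet> model_grad b \<epsilon> y = s * (b \<bullet> b) + \<epsilon> * (s - 1)"
    unfolding model_grad_def inner_add_right inner_scaleR_right b_y by simp
  have 3: "model_grad b \<epsilon> y = s *\<^sub>R b + \<epsilon> *\<^sub>R y" by (simp add: model_grad_def s_def)
  show ?thesis unfolding model_sig_def 1 2 by (subst 3) (simp add: algebra_simps)
qed

lemma has_derivative_model_q:
  "((\<lambda>y. model_q b \<epsilon> y) has_derivative (\<lambda>h. 2 * (model_grad b \<epsilon> y \<bullet> h))) (at y)"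
  unfolding model_q_def model_grad_def
  by (auto intro!: derivative_eq_intros simp: fun_eq_iff inner_add_left inner_commute algebra_simps)

context projective_field begin

theorem normal_form:
  assumes conn: "connected U" and dim: "CARD('n) \<ge> 2" and p: "p \<in> U"
  shows "\<exists>(Q::real^'n \<Rightarrow> real^'n) b \<epsilon> c. linear Q \<and> bij Q \<and> c > 0 \<and> (\<forall>x\<in>U. model_q b \<epsilon> (Q (x - p)) > 0 \<and>
     (\<forall>v. g x v v = c * (model_adj b \<epsilon> (Q (x - p)) (Q v) \<bullet> Q v) / (model_q b \<epsilon> (Q (x - p)))\<^sup>2))"
proof -
  obtain \<gamma> where \<gamma>: "\<And>x. x \<in> U \<Longrightarrow> \<beta> x = \<beta> p + \<gamma> *\<^sub>R (x - p)" using \<beta>_affine[OF conn dim p] by blast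
  have qp: "q p > 0" by (rule q_pos)
  obtain Q :: "real^'n \<Rightarrow> real^'n" where Q: "linear Q" "bij Q" "\<And>v w. q p * g p v w = Q v \<bullet> Q w"
  proof (rule inner_product_isometry[of "\<lambda>v w. q p * g p v w"])
    show "bilinear (\<lambda>v w. q p * g p v w)"
      unfolding bilinear_def
      by (auto intro!: linearI simp: bilinear_ladd[OF bilinear_g[OF p]] bilinear_radd[OF bilinear_g[OF p]]
          bilinear_lmul[OF bilinear_g[OF p]] bilinear_rmul[OF bilinear_g[OF p]] algebra_simps)
  qed (use qp g_sym[OF p] g_pos[OF p] in auto)
  have surj: "surj Q" and inj: "inj Q" using Q(2) by (auto simp: bij_def)
  define b where "b = Q (\<beta> p)"
  define \<epsilon> where "\<epsilon> = \<gamma> - b \<bullet> b"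
  have \<gamma>\<epsilon>: "\<gamma> = \<epsilon> + b \<bullet> b" by (simp add: \<epsilon>_def)
  define A where "A = adjoint Q"
  have A: "x \<bullet> A \<eta> = Q x \<bullet> \<eta>" for x \<eta> unfolding A_def by (rule adjoint_works[OF Q(1)])
  have A': "A \<eta> \<bullet> x = \<eta> \<bullet> Q x" for x \<eta> using A[of x \<eta>] by (simp add: inner_commute)
  have Qp: "Q (sig p (A \<eta>)) = \<eta>" for \<eta>
  proof -
    have "Q (sig p (A \<eta>)) \<bullet> z = \<eta> \<bullet> z" for z
    proof -
      obtain u where u: "z = Q u" using surj by (metis surjD)
      have "Q (sig p (A \<eta>)) \<bullet> Q u = q p * g p (sig p (A \<eta>)) u" by (simp add: Q(3))
      also have "\<dots> = g p (sharp p (A \<eta>)) u" using qp by (simp add: sig_def bilinear_lmul[OF bilinear_g[OF p]])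
      finally show ?thesis by (simp add: u g_sharp(2)[OF p] A')
    qed
    then show ?thesis using vector_eq_rdot by blast
  qed
  define y where "y x = Q (x - p)" for x
  have Qsig: "Q (sig x (A \<eta>)) = model_sig b \<gamma> (y x) \<eta>" if x: "x \<in> U" for x \<eta>
    by (subst sig_quadratic[OF conn p x], erule \<gamma>)
      (simp add: linear_add[OF Q(1)] linear_scale[OF Q(1)] Qp A model_sig_def b_def y_def)
  have pos: "model_sig b \<gamma> (y x) \<eta> \<bullet> \<eta> > 0" if x: "x \<in> U" and \<eta>: "\<eta> \<noteq> 0" for x \<eta>
  proof -
    have "A \<eta> \<noteq> 0"
    proof
      assume "A \<eta> = 0"
      then have "\<eta> \<bullet> Q u = 0" for u using A'[of \<eta> u] by simp
      then have "\<eta> \<bullet> \<eta> = 0" using surj by (metis surjD)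
      then show False using \<eta> by simp
    qed
    then have "sharp x (A \<eta>) \<noteq> 0" using G_sharp[OF x, of "A \<eta>"] by auto
    then have "0 < g x (sharp x (A \<eta>)) (sharp x (A \<eta>)) / q x" using g_pos[OF x] q_pos by simp
    also have "\<dots> = sig x (A \<eta>) \<bullet> A \<eta>" by (simp add: g_sharp(2)[OF x] sig_def inner_commute divide_inverse_commute)
    finally show ?thesis by (simp add: A Qsig[OF x])
  qed
  \<comment> \<open>\<open>model_sig\<close> is positive definite on \<open>U\<close>, but at a zero
    of \<open>model_q\<close> it annihilates \<open>model_grad\<close>. So the gradient vanishes,
    which forces \<open>1 + b \<bullet> y x = 0\<close> and then \<open>\<epsilon> = 0\<close>. Now
    \<open>b\<close> is annihilated as well, and \<open>b = 0\<close> contradicts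
    \<open>1 + b \<bullet> y x = 0\<close>.\<close>
  have nz: "model_q b \<epsilon> (y x) \<noteq> 0" if x: "x \<in> U" for x
  proof
    assume q0: "model_q b \<epsilon> (y x) = 0"
    let ?y = "y x" and ?s = "1 + b \<bullet> y x"
    have "model_sig b \<gamma> ?y (model_grad b \<epsilon> ?y) = 0" unfolding \<gamma>\<epsilon> model_sig_grad q0 by simp
    then have r0: "model_grad b \<epsilon> ?y = 0" using pos[OF x, of "model_grad b \<epsilon> ?y"] by force
    then have "?y \<bullet> model_grad b \<epsilon> ?y = 0" by simp
    moreover have "?y \<bullet> model_grad b \<epsilon> ?y = model_q b \<epsilon> ?y - ?s"
      by (simp add: model_grad_def model_q_def inner_add_right inner_commute power2_eq_square algebra_simps)
    ultimately have s0: "?s = 0" using q0 by simp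
    then have "\<epsilon> *\<^sub>R ?y = 0" using r0 by (simp add: model_grad_def)
    moreover have "?y \<noteq> 0" using s0 by auto
    ultimately have e0: "\<epsilon> = 0" by simp
    have "b \<bullet> ?y = -1" "?y \<bullet> b = -1" using s0 by (auto simp: inner_commute)
    then have "model_sig b \<gamma> ?y b = 0" using e0 by (simp add: model_sig_def \<gamma>\<epsilon> algebra_simps)
    then have "b = 0" using pos[OF x, of b] by force
    then show False using s0 by simp
  qed
  have y_deriv: "(y has_derivative Q) (at x)" for x
  proof -
    have "y = (\<lambda>x. Q x - Q p)" by (auto simp: y_def linear_diff[OF Q(1)])
    then show ?thesis using linear_imp_has_derivative[OF Q(1)] by (auto intro!: derivative_eq_intros)
  qed
  \<comment> \<open>Instead of computing a determinant in the new coordinates, logarithmic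
    derivatives are compared: \<open>model_sig_grad\<close> shows that the one of
    \<open>model_q\<close> is also \<open>- 2 * \<phi> x h\<close>.\<close>
  have ratio: "((\<lambda>x. q x / model_q b \<epsilon> (y x)) has_derivative (\<lambda>h. 0)) (at x)" if x: "x \<in> U" for x
  proof -
    let ?mq = "model_q b \<epsilon> (y x)"
    have "((\<lambda>x. model_q b \<epsilon> (y x)) has_derivative (\<lambda>h. 2 * (model_grad b \<epsilon> (y x) \<bullet> Q h))) (at x)"
      by (rule has_derivative_compose[OF y_deriv has_derivative_model_q])
    from has_derivative_divide'[OF has_derivative_q[OF x] this nz[OF x]]
    have "((\<lambda>x. q x / model_q b \<epsilon> (y x)) has_derivative
       (\<lambda>h. (- 2 * \<phi> x h * q x * ?mq - q x * (2 * (model_grad b \<epsilon> (y x) \<bullet> Q h))) / (?mq * ?mq))) (at x)" .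
    moreover have "- 2 * \<phi> x h * q x * ?mq - q x * (2 * (model_grad b \<epsilon> (y x) \<bullet> Q h)) = 0" for h
    proof -
      obtain \<xi> where \<xi>: "sharp x \<xi> = q x *\<^sub>R h" using sharp_surj[OF x] by blast
      obtain u where u: "\<And>z. \<xi> \<bullet> z = u \<bullet> Q z"
      proof -
        have "\<xi> \<bullet> z = A (adjoint (inv Q) \<xi>) \<bullet> z" for z
        proof -
          have "linear (inv Q)" using inj_linear_imp_inv_linear[OF Q(1) inj] .
          then show ?thesis
            using adjoint_works[of "inv Q" "Q z" \<xi>] A'[of "adjoint (inv Q) \<xi>" z] inj by (simp add: inner_commute)
        qed
        then show thesis using that[of "adjoint (inv Q) \<xi>"] A' by metis
      qed
      have \<xi>A: "\<xi> = A u" using u A' by (metis vector_eq_rdot)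
      have sh: "sig x (A u) = h" using \<xi> q_pos[of x] by (simp add: sig_def \<xi>A)
      have Qh: "Q h = model_sig b \<gamma> (y x) u" using Qsig[OF x, of u] sh by simp
      have "\<phi> x h = - (\<beta> x \<bullet> A u)" using \<beta>_inner[OF x, of "A u"] sh by simp
      also have "\<beta> x \<bullet> A u = (b + \<gamma> *\<^sub>R y x) \<bullet> u"
        by (simp add: A \<gamma>[OF x] linear_add[OF Q(1)] linear_scale[OF Q(1)] b_def y_def)
      finally have \<phi>h: "\<phi> x h = - ((b + \<gamma> *\<^sub>R y x) \<bullet> u)" .
      have "model_grad b \<epsilon> (y x) \<bullet> Q h = model_sig b \<gamma> (y x) (model_grad b \<epsilon> (y x)) \<bullet> u"
        unfolding Qh model_sig_sym ..
      also have "\<dots> = ?mq * ((b + \<gamma> *\<^sub>R y x) \<bullet> u)" unfolding \<gamma>\<epsilon> model_sig_grad by simp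
      finally show ?thesis unfolding \<phi>h by (simp add: algebra_simps)
    qed
    ultimately show ?thesis by (simp only: div_0)
  qed
  have yp: "y p = 0" by (simp add: y_def linear_0[OF Q(1)])
  have q_eq: "q x = q p * model_q b \<epsilon> (y x)" if x: "x \<in> U" for x
  proof -
    have "q x / model_q b \<epsilon> (y x) = q p / model_q b \<epsilon> (y p)"
      by (rule has_derivative_zero_unique_connected[OF open_U conn ratio x p])
    then show ?thesis using nz[OF x] by (simp add: yp model_q_def[of _ _ 0] field_simps)
  qed
  have "g x v v = 1 / q p * (model_adj b \<epsilon> (y x) (Q v) \<bullet> Q v) / (model_q b \<epsilon> (y x))\<^sup>2" if x: "x \<in> U" for x v
  proof -
    let ?mq = "model_q b \<epsilon> (y x)"
    \<comment> \<open>By \<open>model_sig_adj\<close> this represents, in the coordinates of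
      \<open>Q\<close>, the covector whose \<open>sharp\<close> is \<open>v\<close>.\<close>
    define \<eta> where "\<eta> = (1 / (q x * ?mq)) *\<^sub>R model_adj b \<epsilon> (y x) (Q v)"
    have "model_sig b \<gamma> (y x) (c *\<^sub>R z) = c *\<^sub>R model_sig b \<gamma> (y x) z" for c z
      by (simp add: model_sig_def algebra_simps)
    then have \<eta>: "model_sig b \<gamma> (y x) \<eta> = (1 / (q x * ?mq)) *\<^sub>R model_sig b \<gamma> (y x) (model_adj b \<epsilon> (y x) (Q v))"
      unfolding \<eta>_def .
    have "sharp x (A \<eta>) = q x *\<^sub>R sig x (A \<eta>)" using q_pos[of x] by (simp add: sig_def)
    then have "Q (sharp x (A \<eta>)) = q x *\<^sub>R (1 / (q x * ?mq)) *\<^sub>R model_sig b \<gamma> (y x) (model_adj b \<epsilon> (y x) (Q v))"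
      by (simp only: linear_scale[OF Q(1)] Qsig[OF x] \<eta>)
    also have "\<dots> = Q v" unfolding \<gamma>\<epsilon> model_sig_adj using nz[OF x] q_pos[of x] by simp
    finally have "sharp x (A \<eta>) = v" using inj by (simp add: inj_eq)
    then have "g x v v = \<eta> \<bullet> Q v" using g_sharp(2)[OF x, of "A \<eta>" v] by (simp add: A')
    then show ?thesis using q_eq[OF x] by (simp add: \<eta>_def power2_eq_square)
  qed
  moreover have "model_q b \<epsilon> (y x) > 0" if "x \<in> U" for x
    using q_eq[OF that] q_pos[of x] qp by (simp add: zero_less_mult_iff)
  ultimately show ?thesis
    using Q(1,2) qp unfolding y_def by (intro exI[of _ Q] exI[of _ b] exI[of _ \<epsilon>] exI[of _ "1 / q p"]) auto
qed

end

subsection \<open>Smooth maps\<close>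

lemma Ck_on_cong:
  assumes S: "open S" and fg: "\<And>x. x \<in> S \<Longrightarrow> f x = g x"
  shows "Ck_on k S f \<longleftrightarrow> Ck_on k S g"
  using fg
proof (induction k arbitrary: f g)
  case 0 then show ?case by (simp cong: continuous_on_cong)
next
  case (Suc k)
  have iff: "(f has_derivative D) (at x) \<longleftrightarrow> (g has_derivative D) (at x)" if "x \<in> S" for x D
  proof
    show "(f has_derivative D) (at x) \<Longrightarrow> (g has_derivative D) (at x)"
      by (erule has_derivative_transform_within_open[OF _ S that]) (simp add: Suc.prems)
    show "(g has_derivative D) (at x) \<Longrightarrow> (f has_derivative D) (at x)"
      by (erule has_derivative_transform_within_open[OF _ S that]) (simp add: Suc.prems)
  qed
  then have "frechet_derivative f (at x) = frechet_derivative g (at x)" if "x \<in> S" for x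
    unfolding frechet_derivative_def using that by simp
  then have "Ck_on k S (\<lambda>x. frechet_derivative f (at x) v) \<longleftrightarrow> Ck_on k S (\<lambda>x. frechet_derivative g (at x) v)" for v
    by (intro Suc.IH) simp
  moreover have "f differentiable at x \<longleftrightarrow> g differentiable at x" if "x \<in> S" for x
    unfolding differentiable_def using iff[OF that] by simp
  ultimately show ?case by simp
qed

lemma Ck_on_SucI:
  assumes S: "open S" and d: "\<And>x. x \<in> S \<Longrightarrow> (f has_derivative f' x) (at x)" and C: "\<And>v. Ck_on k S (\<lambda>x. f' x v)"
  shows "Ck_on (Suc k) S f"
proof -
  have "frechet_derivative f (at x) = f' x" if "x \<in> S" for x
    using frechet_derivative_at[OF d[OF that]] by simp
  then have "Ck_on k S (\<lambda>x. frechet_derivative f (at x) v)" for v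
    using C[of v] by (subst Ck_on_cong[OF S]) auto
  then show ?thesis using d by (auto simp: differentiable_def)
qed

lemma Ck_on_SucD:
  assumes "Ck_on (Suc k) S f"
  shows "x \<in> S \<Longrightarrow> (f has_derivative frechet_derivative f (at x)) (at x)" "Ck_on k S (\<lambda>x. frechet_derivative f (at x) v)"
  using assms by (auto simp: frechet_derivative_works)

lemma Ck_on_decrease: "Ck_on (Suc k) S f \<Longrightarrow> Ck_on k S f"
proof (induction k arbitrary: f)
  case 0
  then show ?case
    by (auto intro!: continuous_at_imp_continuous_on differentiable_imp_continuous_within)
next
  case (Suc k)
  then show ?case by (auto simp del: Ck_on.simps simp: Ck_on.simps(2)[of "Suc k"] Ck_on.simps(2)[of k])
qed

lemma Ck_on_const: "open S \<Longrightarrow> Ck_on k S (\<lambda>x. c)"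
proof (induction k arbitrary: c)
  case (Suc k)
  then show ?case by (intro Ck_on_SucI[where f' = "\<lambda>x h. 0"]) auto
qed simp

lemma Ck_on_affine:
  assumes "open S" "linear f" shows "Ck_on k S (\<lambda>x. c + f x)"
proof (cases k)
  case 0
  then show ?thesis using assms by (auto intro!: continuous_intros simp: linear_continuous_on linear_conv_bounded_linear)
next
  case (Suc j)
  show ?thesis unfolding Suc
    by (rule Ck_on_SucI[OF assms(1), where f' = "\<lambda>x. f"])
      (auto intro!: derivative_eq_intros linear_imp_has_derivative assms Ck_on_const)
qed

lemma Ck_on_add:
  assumes "open S" "Ck_on k S f" "Ck_on k S g" shows "Ck_on k S (\<lambda>x. f x + g x)"
  using assms(2,3)
proof (induction k arbitrary: f g)
  case 0 then show ?case by (auto intro: continuous_intros)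
next
  case (Suc k)
  show ?case
  proof (rule Ck_on_SucI[OF assms(1)])
    show "((\<lambda>x. f x + g x) has_derivative (\<lambda>h. frechet_derivative f (at x) h + frechet_derivative g (at x) h)) (at x)" if "x \<in> S" for x
      using Suc.prems that by (intro has_derivative_add Ck_on_SucD(1))
    show "Ck_on k S (\<lambda>x. frechet_derivative f (at x) v + frechet_derivative g (at x) v)" for v
      using Suc.prems by (intro Suc.IH Ck_on_SucD(2))
  qed
qed

lemma Ck_on_bilinear:
  assumes S: "open S" and bil: "bounded_bilinear mul" and "Ck_on k S f" "Ck_on k S g"
  shows "Ck_on k S (\<lambda>x. mul (f x) (g x))"
  using assms(3,4)
proof (induction k arbitrary: f g)
  case 0 then show ?case using bounded_bilinear.continuous_on[OF bil] by auto
next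
  case (Suc k)
  show ?case
  proof (rule Ck_on_SucI[OF S])
    show "((\<lambda>x. mul (f x) (g x)) has_derivative (\<lambda>h. mul (f x) (frechet_derivative g (at x) h) + mul (frechet_derivative f (at x) h) (g x))) (at x)" if "x \<in> S" for x
      using Suc.prems that by (intro bounded_bilinear.FDERIV[OF bil] Ck_on_SucD(1))
    show "Ck_on k S (\<lambda>x. mul (f x) (frechet_derivative g (at x) v) + mul (frechet_derivative f (at x) v) (g x))" for v
      by (rule Ck_on_add[OF S Suc.IH[OF Ck_on_decrease[OF Suc.prems(1)] Ck_on_SucD(2)[OF Suc.prems(2)]]
            Suc.IH[OF Ck_on_SucD(2)[OF Suc.prems(1)] Ck_on_decrease[OF Suc.prems(2)]]])
  qed
qed

text \<open>The exponent is generalized in the induction because differentiation lowers it by one.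
  Reciprocals and inverse square roots of positive functions are the instances used.\<close>

lemma Ck_on_powr:
  fixes f :: "'a::euclidean_space \<Rightarrow> real"
  assumes S: "open S" and f: "Ck_on k S f" and pos: "\<And>x. x \<in> S \<Longrightarrow> f x > 0"
  shows "Ck_on k S (\<lambda>x. f x powr a)"
  using f
proof (induction k arbitrary: a)
  case 0 then show ?case using pos by (auto intro!: continuous_intros simp: less_imp_neq[symmetric])
next
  case (Suc k)
  show ?case
  proof (rule Ck_on_SucI[OF S])
    show "((\<lambda>x. f x powr a) has_derivative (\<lambda>h. (a * f x powr (a - 1)) * frechet_derivative f (at x) h)) (at x)" if x: "x \<in> S" for x
    proof -
      have "((\<lambda>y. y powr a) has_derivative (\<lambda>h. (a * f x powr (a - 1)) * h)) (at (f x))"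
        using has_real_derivative_powr[OF pos[OF x], of a] by (simp add: has_field_derivative_def)
      from has_derivative_compose[OF Ck_on_SucD(1)[OF Suc.prems x] this] show ?thesis .
    qed
    show "Ck_on k S (\<lambda>x. (a * f x powr (a - 1)) * frechet_derivative f (at x) v)" for v
    proof (intro Ck_on_bilinear[OF S bounded_bilinear_mult] Ck_on_const S)
      show "Ck_on k S (\<lambda>x. f x powr (a - 1))" by (rule Suc.IH[OF Ck_on_decrease[OF Suc.prems]])
      show "Ck_on k S (\<lambda>x. frechet_derivative f (at x) v)" by (rule Ck_on_SucD(2)[OF Suc.prems])
    qed
  qed
qed

text \<open>For an affine inner map each directional derivative is again a composition with the same
  map, so the induction closes on itself.\<close>

lemma Ck_on_compose_affine:
  assumes S: "open S" and T: "open T" and f: "linear f" and fS: "\<And>x. x \<in> S \<Longrightarrow> c + f x \<in> T"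
    and F: "Ck_on k T F"
  shows "Ck_on k S (\<lambda>x. F (c + f x))"
  using F
proof (induction k arbitrary: F)
  case 0
  have "continuous_on S (\<lambda>x. c + f x)" using f by (auto intro!: continuous_intros simp: linear_continuous_on linear_conv_bounded_linear)
  then show ?case using 0 fS by (auto intro: continuous_on_compose2[of T])
next
  case (Suc k)
  show ?case
  proof (rule Ck_on_SucI[OF S])
    show "((\<lambda>x. F (c + f x)) has_derivative (\<lambda>h. frechet_derivative F (at (c + f x)) (f h))) (at x)" if x: "x \<in> S" for x
    proof -
      have "((\<lambda>x. c + f x) has_derivative f) (at x)" by (auto intro!: derivative_eq_intros linear_imp_has_derivative f)
      from has_derivative_compose[OF this Ck_on_SucD(1)[OF Suc.prems fS[OF x]]] show ?thesis .
    qed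
    show "Ck_on k S (\<lambda>x. frechet_derivative F (at (c + f x)) (f v))" for v
      by (rule Suc.IH[OF Ck_on_SucD(2)[OF Suc.prems]])
  qed
qed

subsection \<open>The isometries\<close>

lemma model_adj_inner:
  "model_adj b \<epsilon> y v \<bullet> v = model_q b \<epsilon> y * (v \<bullet> v) + (y \<bullet> y) * (b \<bullet> v)\<^sup>2
     - 2 * (1 + b \<bullet> y) * (b \<bullet> v) * (y \<bullet> v) - \<epsilon> * (y \<bullet> v)\<^sup>2"
  by (simp add: model_adj_def inner_add_left inner_diff_left power2_eq_square algebra_simps)

text \<open>For \<open>\<epsilon> \<noteq> 0\<close> this is the shape of a quadratic form pulled
  back by a central projection; the square of the gradient stems from the normalizing
  factor.\<close>

lemma model_adj_grad:
  "\<epsilon> * (model_adj b \<epsilon> y v \<bullet> v) = model_q b \<epsilon> y * (\<epsilon> * (v \<bullet> v) + (b \<bullet> v)\<^sup>2) - (model_grad b \<epsilon> y \<bullet> v)\<^sup>2"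
  unfolding model_adj_inner
  by (simp add: model_grad_def model_q_def inner_add_left power2_eq_square algebra_simps)

context
  fixes U :: "'a::euclidean_space set" and Q :: "'a \<Rightarrow> 'a" and p b :: 'a and \<epsilon> :: real
  assumes open_U: "open U" and conn: "connected U" and Q: "linear Q" "bij Q"
    and pos: "\<And>x. x \<in> U \<Longrightarrow> model_q b \<epsilon> (Q (x - p)) > 0"
begin

private definition y :: "'a \<Rightarrow> 'a" where "y x = Q (x - p)"
private definition s :: "'a \<Rightarrow> real" where "s x = 1 + b \<bullet> y x"

private lemma y_eq: "y x = - Q p + Q x" by (simp add: y_def linear_diff[OF Q(1)])

private lemma s_eq: "s x = (1 - b \<bullet> Q p) + b \<bullet> Q x" by (simp add: s_def y_eq inner_diff_right inner_add_right)

private lemma y_deriv: "(y has_derivative Q) (at x)"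
  unfolding y_eq[abs_def] by (auto intro!: derivative_eq_intros linear_imp_has_derivative Q)

private lemma s_deriv: "(s has_derivative (\<lambda>h. b \<bullet> Q h)) (at x)"
  unfolding s_def[abs_def] by (auto intro!: derivative_eq_intros y_deriv)

private lemma y_smooth: "Ck_on k U y"
  unfolding y_eq[abs_def] by (rule Ck_on_affine[OF open_U Q(1)])

private lemma linear_bQ: "linear (\<lambda>x. b \<bullet> Q x)"
  by (intro linearI) (simp_all add: linear_add[OF Q(1)] linear_scale[OF Q(1)] inner_add_right)

private lemma s_smooth: "Ck_on k U s"
  unfolding s_eq[abs_def] by (rule Ck_on_affine[OF open_U linear_bQ])

private lemma q_smooth: "Ck_on k U (\<lambda>x. model_q b \<epsilon> (y x))"
  unfolding model_q_def power2_eq_square s_def[symmetric]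
  by (intro Ck_on_add[OF open_U] Ck_on_bilinear[OF open_U bounded_bilinear_mult] Ck_on_const[OF open_U]
      Ck_on_bilinear[OF open_U bounded_bilinear_inner] s_smooth y_smooth)

private lemma inv_Q: "linear (inv Q)" "Q (inv Q z) = z" "inv Q (Q z) = z"
  using inj_linear_imp_inv_linear[OF Q(1)] Q(2) by (auto simp: bij_def surj_f_inv_f)

private lemma cont: "continuous_on X y" "continuous_on X s" "continuous_on X (inv Q)"
proof -
  show "continuous_on X y" by (rule has_derivative_continuous_on) (rule has_derivative_at_withinI[OF y_deriv])
  show "continuous_on X s" by (rule has_derivative_continuous_on) (rule has_derivative_at_withinI[OF s_deriv])
  show "continuous_on X (inv Q)" using inv_Q(1) by (simp add: linear_continuous_on linear_conv_bounded_linear)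
qed

text \<open>The affine function \<open>s\<close> is 1 at \<open>p\<close>. On the connected set
  \<open>U\<close> it could become nonpositive only by passing through 0, where
  \<open>\<epsilon> \<le> 0\<close> would make \<open>model_q\<close> nonpositive.\<close>

lemma normal_form_denominator_pos:
  assumes eps: "\<epsilon> \<le> 0" and p: "p \<in> U" and x: "x \<in> U"
  shows "1 + b \<bullet> Q (x - p) > 0"
proof (rule ccontr)
  assume "\<not> ?thesis"
  then have "s x \<le> 0" by (simp add: s_def y_def)
  moreover have "s p = 1" by (simp add: s_def y_def linear_0[OF Q(1)])
  moreover have "connected (s ` U)" by (rule connected_continuous_image[OF cont(2) conn])
  ultimately have "0 \<in> s ` U" using p x connected_contains_Icc[of "s ` U" "s x" "s p"] by auto
  then obtain z where z: "z \<in> U" "s z = 0" by auto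
  then have "model_q b \<epsilon> (y z) = \<epsilon> * (y z \<bullet> y z)" by (simp add: model_q_def s_def)
  also have "\<dots> \<le> 0" using eps by (simp add: mult_nonpos_nonneg)
  finally show False using pos[OF z(1)] by (simp add: y_def)
qed

text \<open>Central projection from the graph of \<open>s\<close> over the coordinates \<open>e y\<close> to the quadric
  \<open>\<tau>\<^sup>2 + \<sigma> |a|\<^sup>2 = 1\<close>.\<close>

lemma curved_isometry:
  fixes e \<sigma> :: real and M :: "('a \<times> real) set" and nrm :: "'a \<times> real \<Rightarrow> real"
  assumes e: "e > 0" and \<sigma>: "\<sigma>\<^sup>2 = 1" and \<epsilon>: "\<epsilon> = \<sigma> * e\<^sup>2"
    and M: "\<And>a t. (a, t) \<in> M \<Longrightarrow> t\<^sup>2 + \<sigma> * (a \<bullet> a) = 1"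
      "\<And>x. x \<in> U \<Longrightarrow> (1 / sqrt (model_q b \<epsilon> (Q (x - p)))) *\<^sub>R (e *\<^sub>R Q (x - p), 1 + b \<bullet> Q (x - p)) \<in> M"
    and nrm: "\<And>a t. nrm (a, t) = sqrt (a \<bullet> a + \<sigma> * t\<^sup>2)"
    and N: "\<And>x v. x \<in> U \<Longrightarrow> N x v = sqrt (e\<^sup>2 * (model_adj b \<epsilon> (Q (x - p)) (Q v) \<bullet> Q v) / (model_q b \<epsilon> (Q (x - p)))\<^sup>2)"
  shows "isometric_to_domain_in U N M (\<lambda>_ w. nrm w)"
proof -
  define mq where "mq x = model_q b \<epsilon> (y x)" for x
  have mq: "mq x > 0" if "x \<in> U" for x using pos[OF that] by (simp add: mq_def y_def)
  define Y where "Y x = (e *\<^sub>R y x, s x)" for x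
  define \<Phi> where "\<Phi> x = (1 / sqrt (mq x)) *\<^sub>R Y x" for x
  \<comment> \<open>The points \<open>(e *\<^sub>R y x, s x)\<close> fill part of the hyperplane
    where \<open>\<delta>\<close> equals \<open>e\<close>. Dividing by \<open>\<delta>\<close>
    undoes the normalization, which gives the inverse \<open>\<Psi>\<close> on the half-space
    \<open>\<delta> z > 0\<close>.\<close>
  define \<delta> where "\<delta> z = e * snd z - b \<bullet> fst z" for z :: "'a \<times> real"
  define \<Psi> where "\<Psi> z = p + inv Q ((1 / \<delta> z) *\<^sub>R fst z)" for z :: "'a \<times> real"
  define D where "D = \<Phi> ` U"
  have \<delta>\<Phi>: "\<delta> (\<Phi> x) = e / sqrt (mq x)" for x
    by (simp add: \<delta>_def \<Phi>_def Y_def s_def algebra_simps)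
  have \<Psi>\<Phi>: "\<Psi> (\<Phi> x) = x" if x: "x \<in> U" for x
  proof -
    have "(1 / \<delta> (\<Phi> x)) *\<^sub>R fst (\<Phi> x) = y x" unfolding \<delta>\<Phi> using mq[OF x] e by (simp add: \<Phi>_def Y_def)
    then show ?thesis by (simp add: \<Psi>_def y_def inv_Q(3))
  qed
  have \<Phi>\<Psi>: "\<Phi> (\<Psi> z) = z" if z: "z \<in> M" "\<delta> z > 0" for z
  proof -
    obtain a t where at: "z = (a, t)" by (cases z)
    have \<delta>at: "\<delta> z = e * t - b \<bullet> a" by (simp add: \<delta>_def at)
    have y\<Psi>: "y (\<Psi> z) = (1 / \<delta> z) *\<^sub>R a" by (simp add: y_def \<Psi>_def inv_Q(2) at)
    have s\<Psi>: "s (\<Psi> z) = e * t / \<delta> z" using z(2) by (simp add: s_def y\<Psi> field_simps) (simp add: \<delta>at)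
    have "mq (\<Psi> z) = (s (\<Psi> z))\<^sup>2 + \<epsilon> * (y (\<Psi> z) \<bullet> y (\<Psi> z))" by (simp add: mq_def model_q_def s_def)
    also have "\<dots> = (e / \<delta> z)\<^sup>2 * (t\<^sup>2 + \<sigma> * (a \<bullet> a))"
      unfolding y\<Psi> s\<Psi> \<epsilon> by (simp add: power2_eq_square distrib_left add_divide_distrib mult_ac)
    also have "\<dots> = (e / \<delta> z)\<^sup>2" using M(1) z(1) by (simp add: at)
    finally have "sqrt (mq (\<Psi> z)) = e / \<delta> z" using e z(2) by simp
    then have "\<Phi> (\<Psi> z) = (1 / (e / \<delta> z)) *\<^sub>R (e *\<^sub>R (1 / \<delta> z) *\<^sub>R a, e * t / \<delta> z)"
      by (simp only: \<Phi>_def Y_def y\<Psi> s\<Psi>)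
    also have "\<dots> = (a, t)" using e z(2) by simp
    finally show ?thesis using at by simp
  qed
  have \<Phi>M: "\<Phi> x \<in> M" if "x \<in> U" for x using M(2)[OF that] by (simp add: \<Phi>_def Y_def mq_def y_def s_def)
  \<comment> \<open>Openness in \<open>M\<close> is read off from this description: the second
    factor is open in the ambient space, since \<open>\<Psi>\<close> is continuous on the
    half-space.\<close>
  have D_eq: "D = M \<inter> ({z. \<delta> z > 0} \<inter> \<Psi> -` U)"
  proof (intro set_eqI iffI)
    fix z assume "z \<in> D"
    then obtain x where x: "x \<in> U" "z = \<Phi> x" by (auto simp: D_def)
    then show "z \<in> M \<inter> ({z. \<delta> z > 0} \<inter> \<Psi> -` U)" using \<Phi>M \<Psi>\<Phi> \<delta>\<Phi> mq e by auto
  next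
    fix z assume "z \<in> M \<inter> ({z. \<delta> z > 0} \<inter> \<Psi> -` U)"
    then show "z \<in> D" unfolding D_def using \<Phi>\<Psi>[of z] by (intro image_eqI[of _ _ "\<Psi> z"]) auto
  qed
  have c\<delta>: "continuous_on X \<delta>" for X unfolding \<delta>_def[abs_def] by (intro continuous_intros)
  have "open ({z. \<delta> z > 0} \<inter> \<Psi> -` U)"
  proof (rule continuous_open_preimage[OF _ _ open_U])
    show "open {z. \<delta> z > 0}" by (intro open_Collect_less c\<delta> continuous_intros)
    show "continuous_on {z. \<delta> z > 0} \<Psi>" unfolding \<Psi>_def[abs_def]
      by (intro continuous_intros continuous_on_compose2[OF cont(3)[of UNIV]] c\<delta>) auto
  qed
  then have openD: "openin (top_of_set M) D" unfolding D_eq by (rule openin_open_Int)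
  have Y_eq: "Y x = (- e *\<^sub>R Q p, 1 - b \<bullet> Q p) + (e *\<^sub>R Q x, b \<bullet> Q x)" for x
    by (simp add: Y_def y_eq s_eq algebra_simps)
  have linY: "linear (\<lambda>x. (e *\<^sub>R Q x, b \<bullet> Q x))"
    by (intro linearI) (simp_all add: linear_add[OF Q(1)] linear_scale[OF Q(1)] inner_add_right algebra_simps)
  have "Ck_on k U \<Phi>" for k
  proof -
    have "Ck_on k U Y" unfolding Y_eq[abs_def] by (rule Ck_on_affine[OF open_U linY])
    moreover have "Ck_on k U (\<lambda>x. mq x powr (- 1 / 2))"
      unfolding mq_def by (rule Ck_on_powr[OF open_U q_smooth]) (use mq in \<open>simp add: mq_def\<close>)
    ultimately have "Ck_on k U (\<lambda>x. mq x powr (- 1 / 2) *\<^sub>R Y x)"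
      by (intro Ck_on_bilinear[OF open_U bounded_bilinear_scaleR])
    then show ?thesis
      by (subst Ck_on_cong[OF open_U]) (use mq in \<open>auto simp: \<Phi>_def powr_minus_divide powr_half_sqrt less_imp_le\<close>)
  qed
  then have smooth: "smooth_on U \<Phi>" by (simp add: smooth_on_def)
  have iso: "nrm (frechet_derivative \<Phi> (at x) v) = N x v" if x: "x \<in> U" for x v
  proof -
    define V where "V = Q v"
    define m where "m = model_grad b \<epsilon> (y x) \<bullet> V"
    let ?r = "sqrt (mq x)"
    have r: "?r > 0" "?r\<^sup>2 = mq x" using mq[OF x] by auto
    have dY: "(Y has_derivative (\<lambda>h. (e *\<^sub>R Q h, b \<bullet> Q h))) (at x)"
      unfolding Y_def[abs_def] by (intro has_derivative_Pair has_derivative_scaleR_right y_deriv s_deriv)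
    have dmq: "(mq has_derivative (\<lambda>h. 2 * (model_grad b \<epsilon> (y x) \<bullet> Q h))) (at x)"
      unfolding mq_def[abs_def] by (rule has_derivative_compose[OF y_deriv has_derivative_model_q])
    have "((\<lambda>u. 1 / sqrt u) has_real_derivative - (1 / (2 * mq x * ?r))) (at (mq x))"
      using mq[OF x] by (auto intro!: derivative_eq_intros simp: field_simps)
    then have "((\<lambda>u. 1 / sqrt u) has_derivative (*) (- (1 / (2 * mq x * ?r)))) (at (mq x))"
      by (simp add: has_field_derivative_def)
    from has_derivative_compose[OF dmq this]
    have dr: "((\<lambda>x. 1 / sqrt (mq x)) has_derivative (\<lambda>h. - (1 / (2 * mq x * ?r)) * (2 * (model_grad b \<epsilon> (y x) \<bullet> Q h)))) (at x)" .
    have "(\<Phi> has_derivative (\<lambda>h. (1 / ?r) *\<^sub>R (e *\<^sub>R Q h, b \<bullet> Q h) + (- (1 / (2 * mq x * ?r)) * (2 * (model_grad b \<epsilon> (y x) \<bullet> Q h))) *\<^sub>R Y x)) (at x)"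
      unfolding \<Phi>_def[abs_def] by (rule has_derivative_scaleR[OF dr dY])
    from fun_cong[OF frechet_derivative_at[OF this], of v]
    have "frechet_derivative \<Phi> (at x) v = (1 / ?r) *\<^sub>R (e *\<^sub>R V, b \<bullet> V) + (- (1 / (2 * mq x * ?r)) * (2 * m)) *\<^sub>R Y x"
      unfolding V_def m_def by (rule sym)
    moreover have "- (1 / (2 * mq x * ?r)) * (2 * m) = - m / (mq x * ?r)" by simp
    ultimately have fd: "frechet_derivative \<Phi> (at x) v = (1 / ?r) *\<^sub>R (e *\<^sub>R V, b \<bullet> V) + (- m / (mq x * ?r)) *\<^sub>R Y x"
      by (simp only:)
    define A where "A = (e / ?r) *\<^sub>R V + (- m * e / (mq x * ?r)) *\<^sub>R y x"
    define T where "T = (b \<bullet> V) / ?r + (- m / (mq x * ?r)) * s x"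
    have fd2: "frechet_derivative \<Phi> (at x) v = (A, T)"
      unfolding fd A_def T_def Y_def by simp
    have m: "m = s x * (b \<bullet> V) + \<epsilon> * (y x \<bullet> V)" by (simp add: m_def model_grad_def inner_add_left s_def)
    have mqx: "mq x = (s x)\<^sup>2 + \<epsilon> * (y x \<bullet> y x)" by (simp add: mq_def model_q_def s_def)
    have "\<sigma> * (A \<bullet> A + \<sigma> * T\<^sup>2) * (mq x)\<^sup>2 = (\<epsilon> * (V \<bullet> V) + (b \<bullet> V)\<^sup>2) * mq x - m\<^sup>2"
    proof -
      have ee: "\<sigma> * e\<^sup>2 = \<epsilon>" by (simp add: \<epsilon>)
      \<comment> \<open>\<open>u\<close> is the radial part removed by the normalization: the
        derivative equals \<open>(e *\<^sub>R V, b \<bullet> V) - u *\<^sub>R Y x\<close> divided by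
        \<open>?r\<close>.\<close>
      define u where "u = m / mq x"
      have A: "A = (e / ?r) *\<^sub>R (V - u *\<^sub>R y x)" using r mq[OF x] by (simp add: A_def u_def algebra_simps)
      have T: "T = (1 / ?r) * (b \<bullet> V - u * s x)" using r mq[OF x] by (simp add: T_def u_def field_simps)
      have "\<sigma> * (A \<bullet> A + \<sigma> * T\<^sup>2) = (1 / ?r)\<^sup>2 * ((\<sigma> * e\<^sup>2) * ((V - u *\<^sub>R y x) \<bullet> (V - u *\<^sub>R y x)) + \<sigma>\<^sup>2 * (b \<bullet> V - u * s x)\<^sup>2)"
        unfolding A T by (simp add: power2_eq_square algebra_simps)
      also have "\<dots> = (\<epsilon> * ((V - u *\<^sub>R y x) \<bullet> (V - u *\<^sub>R y x)) + (b \<bullet> V - u * s x)\<^sup>2) / mq x"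
        unfolding ee \<sigma> power_divide r(2) by simp
      also have "\<epsilon> * ((V - u *\<^sub>R y x) \<bullet> (V - u *\<^sub>R y x)) + (b \<bullet> V - u * s x)\<^sup>2
          = (\<epsilon> * (V \<bullet> V) + (b \<bullet> V)\<^sup>2) - 2 * u * m + u\<^sup>2 * mq x"
        unfolding m mqx by (simp add: inner_diff_left inner_diff_right inner_commute power2_eq_square algebra_simps)
      also have "\<dots> = (\<epsilon> * (V \<bullet> V) + (b \<bullet> V)\<^sup>2) - m\<^sup>2 / mq x"
        using mq[OF x] by (simp add: u_def power2_eq_square)
      finally show ?thesis using mq[OF x] by (simp add: power2_eq_square field_simps)
    qed
    also have "\<dots> = \<epsilon> * (model_adj b \<epsilon> (y x) V \<bullet> V)"
      unfolding model_adj_grad m_def mq_def by (simp add: mult.commute)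
    finally have "\<sigma> * (\<sigma> * (A \<bullet> A + \<sigma> * T\<^sup>2) * (mq x)\<^sup>2) = \<sigma> * (\<epsilon> * (model_adj b \<epsilon> (y x) V \<bullet> V))" by simp
    then have "\<sigma>\<^sup>2 * (A \<bullet> A + \<sigma> * T\<^sup>2) * (mq x)\<^sup>2 = \<sigma>\<^sup>2 * e\<^sup>2 * (model_adj b \<epsilon> (y x) V \<bullet> V)"
      by (simp add: \<epsilon> power2_eq_square mult_ac)
    then have "A \<bullet> A + \<sigma> * T\<^sup>2 = e\<^sup>2 * (model_adj b \<epsilon> (y x) V \<bullet> V) / (mq x)\<^sup>2"
      using mq[OF x] \<sigma> by (simp add: field_simps)
    then show ?thesis unfolding fd2 nrm N[OF x] by (simp add: V_def mq_def y_def)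
  qed
  have "connected D" unfolding D_def
  proof (rule connected_continuous_image[OF _ conn])
    have "Ck_on 0 U \<Phi>" using smooth unfolding smooth_on_def by blast
    then show "continuous_on U \<Phi>" by simp
  qed
  moreover have "bij_betw \<Phi> U D" unfolding D_def using \<Psi>\<Phi> by (intro inj_on_imp_bij_betw inj_on_inverseI)
  ultimately show ?thesis unfolding isometric_to_domain_in_def using openD smooth iso by blast
qed

lemma flat_isometry:
  assumes \<epsilon>: "\<epsilon> = 0" and spos: "\<And>x. x \<in> U \<Longrightarrow> 1 + b \<bullet> Q (x - p) > 0"
    and N: "\<And>x v. x \<in> U \<Longrightarrow> N x v = sqrt ((model_adj b \<epsilon> (Q (x - p)) (Q v) \<bullet> Q v) / (model_q b \<epsilon> (Q (x - p)))\<^sup>2)"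
  shows "isometric_to_domain_in U N (UNIV :: 'a set) (\<lambda>_ w. norm w)"
proof -
  have s: "s x > 0" if "x \<in> U" for x using spos[OF that] by (simp add: s_def y_def)
  define \<Phi> where "\<Phi> x = (1 / s x) *\<^sub>R y x" for x
  have dy: "(\<Phi> has_derivative (\<lambda>h. (1 / s x) *\<^sub>R Q h + (- (b \<bullet> Q h) / (s x)\<^sup>2) *\<^sub>R y x)) (at x)" if x: "x \<in> U" for x
  proof -
    have "((\<lambda>x. 1 / s x) has_derivative (\<lambda>h. - (b \<bullet> Q h) / (s x)\<^sup>2)) (at x)"
      using s[OF x] by (auto intro!: derivative_eq_intros s_deriv simp: fun_eq_iff power2_eq_square field_simps)
    from has_derivative_scaleR[OF this y_deriv] show ?thesis unfolding \<Phi>_def[abs_def] .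
  qed
  have inj: "inj_on \<Phi> U"
  proof (rule inj_on_inverseI)
    fix x assume x: "x \<in> U"
    \<comment> \<open>This recovers the denominator of the projective map from its value, and with
      it the inverse.\<close>
    have "1 - b \<bullet> \<Phi> x = 1 / s x" using s[OF x] by (simp add: \<Phi>_def field_simps) (simp add: s_def)
    then have "(1 / (1 - b \<bullet> \<Phi> x)) *\<^sub>R \<Phi> x = y x" using s[OF x] by (simp add: \<Phi>_def)
    then show "p + inv Q ((1 / (1 - b \<bullet> \<Phi> x)) *\<^sub>R \<Phi> x) = x" by (simp add: y_def inv_Q(3))
  qed
  have "Ck_on k U \<Phi>" for k
  proof -
    have "Ck_on k U (\<lambda>x. s x powr (- 1) *\<^sub>R y x)"
      by (intro Ck_on_bilinear[OF open_U bounded_bilinear_scaleR] y_smooth Ck_on_powr[OF open_U s_smooth] s)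
    then show ?thesis
      by (subst Ck_on_cong[OF open_U]) (use s in \<open>auto simp: \<Phi>_def powr_minus_divide less_imp_le\<close>)
  qed
  then have smooth: "smooth_on U \<Phi>" by (simp add: smooth_on_def)
  have c: "continuous_on U \<Phi>"
  proof -
    have "Ck_on 0 U \<Phi>" using smooth unfolding smooth_on_def by blast
    then show ?thesis by simp
  qed
  have "open (\<Phi> ` U)" by (rule invariance_of_domain[OF c open_U inj])
  then have "openin (top_of_set UNIV) (\<Phi> ` U)" by simp
  moreover have "connected (\<Phi> ` U)" by (rule connected_continuous_image[OF c conn])
  moreover have "bij_betw \<Phi> U (\<Phi> ` U)" by (rule inj_on_imp_bij_betw[OF inj])
  moreover have "norm (frechet_derivative \<Phi> (at x) v) = N x v" if x: "x \<in> U" for x v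
  proof -
    define V where "V = Q v"
    have "frechet_derivative \<Phi> (at x) v = (1 / s x) *\<^sub>R V + (- (b \<bullet> V) / (s x)\<^sup>2) *\<^sub>R y x"
      unfolding V_def using fun_cong[OF frechet_derivative_at[OF dy[OF x]], of v] by (rule sym)
    also have "\<dots> = (1 / (s x)\<^sup>2) *\<^sub>R (s x *\<^sub>R V - (b \<bullet> V) *\<^sub>R y x)"
      using s[OF x] by (simp add: scaleR_diff_right power2_eq_square)
    finally have "norm (frechet_derivative \<Phi> (at x) v) = sqrt ((1 / (s x)\<^sup>2)\<^sup>2 * ((s x *\<^sub>R V - (b \<bullet> V) *\<^sub>R y x) \<bullet> (s x *\<^sub>R V - (b \<bullet> V) *\<^sub>R y x)))"
      by (simp add: norm_eq_sqrt_inner power2_eq_square)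
    also have "(s x *\<^sub>R V - (b \<bullet> V) *\<^sub>R y x) \<bullet> (s x *\<^sub>R V - (b \<bullet> V) *\<^sub>R y x) = model_adj b \<epsilon> (y x) V \<bullet> V"
      unfolding model_adj_inner \<epsilon>
      by (simp add: model_q_def s_def[symmetric] inner_diff_left inner_diff_right inner_commute power2_eq_square algebra_simps)
    also have "(1 / (s x)\<^sup>2)\<^sup>2 * (model_adj b \<epsilon> (y x) V \<bullet> V) = (model_adj b \<epsilon> (y x) V \<bullet> V) / (model_q b \<epsilon> (y x))\<^sup>2"
      by (simp add: model_q_def \<epsilon> s_def power_divide)
    finally show ?thesis by (simp add: N[OF x] y_def V_def)
  qed
  ultimately show ?thesis unfolding isometric_to_domain_in_def using smooth by blast
qed

end

section \<open>The one-dimensional case\<close>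

lemma antiderivative_on_open_interval:
  fixes f :: "real \<Rightarrow> real"
  assumes J: "open J" "connected J" and f: "continuous_on J f"
  shows "\<exists>F. \<forall>t\<in>J. (F has_real_derivative f t) (at t)"
proof (cases "J = {}")
  case False
  then obtain c where c: "c \<in> J" by auto
  \<comment> \<open>One of the two intervals is empty or a point, so this is the signed integral
    from \<open>c\<close> to \<open>t\<close>.\<close>
  define F where "F t = integral {c..t} f - integral {t..c} f" for t
  have "(F has_real_derivative f t) (at t)" if t: "t \<in> J" for t
  proof -
    obtain a b where ab: "a \<in> J" "b \<in> J" "a < c" "a < t" "c < b" "t < b"
    proof -
      have "min c t \<in> J" "max c t \<in> J" using c t by (auto simp: min_def max_def)
      then obtain d d' where d: "d > 0" "ball (min c t) d \<subseteq> J" "d' > 0" "ball (max c t) d' \<subseteq> J"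
        using J(1) open_contains_ball by meson
      show thesis
        by (rule that[of "min c t - d/2" "max c t + d'/2"]) (use d in \<open>auto simp: subset_eq dist_real_def\<close>)
    qed
    have sub: "{a..b} \<subseteq> J" using J(2) ab connected_contains_Icc by blast
    have int: "f integrable_on {u..v}" if "a \<le> u" "v \<le> b" for u v
      using that sub by (intro integrable_continuous_real continuous_on_subset[OF f]) auto
    have F: "F u = integral {a..u} f - integral {a..c} f" if u: "u \<in> {a..b}" for u
    proof (cases "c \<le> u")
      case True
      then have "integral {a..c} f + integral {c..u} f = integral {a..u} f"
        using ab u by (intro Henstock_Kurzweil_Integration.integral_combine int) auto
      moreover have "integral {u..c} f = 0"
        using True by (cases "u = c") (auto simp: integral_empty)
      ultimately show ?thesis by (simp add: F_def)
    next
      case False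
      then have "integral {a..u} f + integral {u..c} f = integral {a..c} f"
        using ab u by (intro Henstock_Kurzweil_Integration.integral_combine int) auto
      then show ?thesis using False by (simp add: F_def)
    qed
    have "((\<lambda>u. integral {a..u} f) has_vector_derivative f t) (at t within {a..b})"
      by (rule integral_has_vector_derivative[OF continuous_on_subset[OF f sub]]) (use ab in auto)
    then have "((\<lambda>u. integral {a..u} f) has_real_derivative f t) (at t)"
      using ab at_within_interior[of t "{a..b}"] by (simp add: has_real_derivative_iff_has_vector_derivative)
    from DERIV_diff[OF this DERIV_const]
    have "((\<lambda>u. integral {a..u} f - integral {a..c} f) has_real_derivative f t) (at t)" by simp
    then show ?thesis
      by (rule has_field_derivative_transform_within_open[of _ _ _ "{a<..<b}"]) (use ab F in auto)
  qed
  then show ?thesis by blast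
qed auto

text \<open>On a line the norm is a positive density times the absolute value. Its antiderivative,
  arc length, is an isometry onto an open interval.\<close>

lemma isometry_dim_1:
  fixes U :: "'a::euclidean_space set" and N :: "'a \<Rightarrow> 'a \<Rightarrow> real"
  assumes dim: "DIM('a) = 1" and U: "open U" "connected U"
    and smooth: "\<And>k v. v \<noteq> 0 \<Longrightarrow> Ck_on k U (\<lambda>x. N x v)"
    and hom: "\<And>x c v. x \<in> U \<Longrightarrow> N x (c *\<^sub>R v) = \<bar>c\<bar> * N x v"
    and pos: "\<And>x v. x \<in> U \<Longrightarrow> v \<noteq> 0 \<Longrightarrow> N x v > 0"
  shows "isometric_to_domain_in U N (UNIV :: 'a set) (\<lambda>_ w. norm w)"
proof -
  obtain e :: 'a where e: "Basis = {e}" using dim card_1_singletonE by metis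
  have eB: "e \<in> Basis" unfolding e by (rule singletonI)
  have e1: "e \<bullet> e = 1" "norm e = 1" "e \<noteq> 0"
    using inner_Basis[OF eB eB] norm_Basis[OF eB] nonzero_Basis[OF eB] by auto
  have rep: "x = (x \<bullet> e) *\<^sub>R e" for x :: 'a using euclidean_representation[of x] unfolding e by simp
  define J where "J = (\<lambda>t. t *\<^sub>R e) -` U"
  have "open J" unfolding J_def by (intro open_vimage U continuous_intros)
  moreover have "J = (\<lambda>x. x \<bullet> e) ` U"
  proof (intro set_eqI iffI)
    fix t assume "t \<in> J"
    then show "t \<in> (\<lambda>x. x \<bullet> e) ` U" using e1 by (intro image_eqI[of _ _ "t *\<^sub>R e"]) (auto simp: J_def)
  next
    fix t assume "t \<in> (\<lambda>x. x \<bullet> e) ` U"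
    then show "t \<in> J" using rep unfolding J_def by (metis imageE vimageI)
  qed
  then have "connected J" using connected_continuous_image[OF _ U(2), of "\<lambda>x. x \<bullet> e"] by (simp add: continuous_on_inner)
  moreover have "continuous_on J (\<lambda>t. N (t *\<^sub>R e) e)"
    using smooth[OF e1(3), of 0] by (intro continuous_on_compose2[of U "\<lambda>x. N x e" J "\<lambda>t. t *\<^sub>R e"] continuous_intros) (auto simp: J_def)
  ultimately obtain F where F: "\<And>t. t \<in> J \<Longrightarrow> (F has_real_derivative N (t *\<^sub>R e) e) (at t)"
    using antiderivative_on_open_interval[of J "\<lambda>t. N (t *\<^sub>R e) e"] by blast
  define \<Phi> where "\<Phi> x = F (x \<bullet> e) *\<^sub>R e" for x
  have inJ: "x \<bullet> e \<in> J" if "x \<in> U" for x using that rep[of x] by (simp add: J_def)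
  have d: "(\<Phi> has_derivative (\<lambda>h. (N x e * (h \<bullet> e)) *\<^sub>R e)) (at x)" if x: "x \<in> U" for x
  proof -
    have "((\<lambda>x. x \<bullet> e) has_derivative (\<lambda>h. h \<bullet> e)) (at x)" by (auto intro!: derivative_eq_intros)
    moreover have "(F has_derivative (*) (N x e)) (at (x \<bullet> e))"
      using F[OF inJ[OF x]] rep[of x] by (simp add: has_field_derivative_def)
    ultimately have "((\<lambda>x. F (x \<bullet> e)) has_derivative (\<lambda>h. N x e * (h \<bullet> e))) (at x)"
      by (rule has_derivative_compose)
    then show ?thesis unfolding \<Phi>_def[abs_def] by (rule has_derivative_scaleR_left)
  qed
  have "Ck_on (Suc k) U \<Phi>" for k
  proof (rule Ck_on_SucI[OF U(1) d])
    show "Ck_on k U (\<lambda>x. (N x e * (v \<bullet> e)) *\<^sub>R e)" for v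
      by (intro Ck_on_bilinear[OF U(1) bounded_bilinear_scaleR] Ck_on_bilinear[OF U(1) bounded_bilinear_mult] Ck_on_const U smooth e1(3))
  qed
  then have "Ck_on k U \<Phi>" for k by (rule Ck_on_decrease)
  then have sm: "smooth_on U \<Phi>" by (simp add: smooth_on_def)
  have inj: "inj_on \<Phi> U"
  proof (rule inj_onI, rule ccontr)
    fix x y assume xy: "x \<in> U" "y \<in> U" "\<Phi> x = \<Phi> y" "x \<noteq> y"
    have FF: "F (x \<bullet> e) = F (y \<bullet> e)" using xy(3) e1 by (simp add: \<Phi>_def)
    have ne: "x \<bullet> e \<noteq> y \<bullet> e" using xy(4) rep by metis
    have False if st: "s \<in> J" "t \<in> J" "s < t" "F s = F t" for s t
    proof -
      have sub: "{s..t} \<subseteq> J" using \<open>connected J\<close> st connected_contains_Icc by blast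
      have "\<exists>z. s < z \<and> z < t \<and> F t - F s = (t - s) * N (z *\<^sub>R e) e"
        by (rule MVT2[OF st(3)]) (use F sub in auto)
      then obtain z where z0: "s < z" "z < t" "F t - F s = (t - s) * N (z *\<^sub>R e) e" by blast
      then have z: "z \<in> J" "(t - s) * N (z *\<^sub>R e) e = 0" using subsetD[OF sub, of z] st(4) by auto
      moreover have "N (z *\<^sub>R e) e > 0" using z(1) e1 by (intro pos) (auto simp: J_def)
      ultimately show False using st(3) by simp
    qed
    then show False using inJ[OF xy(1)] inJ[OF xy(2)] FF ne by (metis linorder_neq_iff)
  qed
  have "Ck_on 0 U \<Phi>" using sm unfolding smooth_on_def by blast
  then have c: "continuous_on U \<Phi>" by simp
  have "openin (top_of_set UNIV) (\<Phi> ` U)" using invariance_of_domain[OF c U(1) inj] by simp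
  moreover have "norm (frechet_derivative \<Phi> (at x) v) = N x v" if x: "x \<in> U" for x v
  proof -
    have "frechet_derivative \<Phi> (at x) v = (N x e * (v \<bullet> e)) *\<^sub>R e"
      using fun_cong[OF frechet_derivative_at[OF d[OF x]], of v] by (rule sym)
    moreover have "N x v = \<bar>v \<bullet> e\<bar> * N x e" using hom[OF x, of "v \<bullet> e" e] rep[of v] by simp
    ultimately show ?thesis using e1 pos[OF x e1(3)] by (simp add: abs_mult)
  qed
  ultimately show ?thesis
    unfolding isometric_to_domain_in_def
    using sm inj_on_imp_bij_betw[OF inj] connected_continuous_image[OF c U(2)] by blast
qed

subsection \<open>Finsler structures with projective reflection law\<close>

locale reflective_finsler =
  fixes U :: "(real^'n) set" and I :: "real^'n \<Rightarrow> (real^'n) set"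
  assumes open_U: "open U" and finsler: "finsler_structure U I"
    and law: "projective_reflection_law U I"
begin

abbreviation N :: "real^'n \<Rightarrow> real^'n \<Rightarrow> real" where "N \<equiv> finsler_norm I"

lemma smooth_N: "Ck_on k (U \<times> - {0}) (\<lambda>z. N (fst z) (snd z))"
  using finsler unfolding finsler_structure_def smooth_on_def case_prod_beta by blast

lemma open_slit: "open (U \<times> (- {0::real^'n}))" by (intro open_Times open_U) auto

lemma smooth_N_left: "v \<noteq> 0 \<Longrightarrow> Ck_on k U (\<lambda>x. N x v)"
proof -
  assume v: "v \<noteq> 0"
  have "linear (\<lambda>x::real^'n. (x, 0::real^'n))" by (intro linearI) auto
  from Ck_on_compose_affine[OF open_U open_slit this _ smooth_N, of "(0, v)"] v show ?thesis by simp
qed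

lemma smooth_N_right: "x \<in> U \<Longrightarrow> Ck_on k (- {0}) (N x)"
proof -
  assume x: "x \<in> U"
  have "linear (\<lambda>v::real^'n. (0::real^'n, v))" by (intro linearI) auto
  moreover have "open (- {0::real^'n})" by auto
  ultimately show ?thesis using Ck_on_compose_affine[OF _ open_slit _ _ smooth_N, of "- {0}" "\<lambda>v. (0, v)" "(x, 0)"] x by simp
qed

lemma smooth_indicatrix: "x \<in> U \<Longrightarrow> smooth_indicatrix (I x) (N x)"
proof unfold_locales
  assume x: "x \<in> U"
  show "strictly_convex_closed_hypersurface (I x)" using finsler x unfolding finsler_structure_def by blast
  show "v \<in> I x \<Longrightarrow> - v \<in> I x" for v using finsler x unfolding finsler_structure_def by blast
  show "N x v = (if v = 0 then 0 else THE r. r > 0 \<and> v /\<^sub>R r \<in> I x)" for v by (simp add: finsler_norm_def)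
  show "N x differentiable at v" if "v \<noteq> 0" for v
    using smooth_N_right[OF x, of 1] that by simp
qed

lemma N_quadratic:
  assumes x: "x \<in> U"
  obtains B where "bilinear B" "\<And>v w. B v w = B w v" "\<And>v. v \<noteq> 0 \<Longrightarrow> B v v > 0" "\<And>v. (N x v)\<^sup>2 = B v v"
proof -
  interpret smooth_indicatrix "I x" "N x" by (rule smooth_indicatrix[OF x])
  have "\<exists>n. a \<bullet> n \<noteq> 0 \<and> (\<forall>u. N x (linear_reflection a n u) = N x u)" if "a \<noteq> 0" for a
    by (rule finsler_norm_reflection[OF smooth_indicatrix[OF x] that])
      (use law x in \<open>unfold projective_reflection_law_def, blast\<close>)
  then obtain c where c: "c > 0" "\<And>v. (N x v)\<^sup>2 = c * inertia v v" using N_quadratic by blast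
  show thesis
  proof (rule that[of "\<lambda>v w. c * inertia v w"])
    show "bilinear (\<lambda>v w. c * inertia v w)" unfolding bilinear_def
      by (auto intro!: linearI simp: bilinear_ladd[OF inertia_bilinear] bilinear_radd[OF inertia_bilinear]
          bilinear_lmul[OF inertia_bilinear] bilinear_rmul[OF inertia_bilinear] algebra_simps)
  qed (use c inertia_sym inertia_pos in auto)
qed

text \<open>Polarization of the square of the norm; the reflection law makes it bilinear at the
  points of \<open>U\<close>.\<close>

definition g :: "real^'n \<Rightarrow> real^'n \<Rightarrow> real^'n \<Rightarrow> real" where
  "g x v w = ((N x (v + w))\<^sup>2 - (N x (v - w))\<^sup>2) / 4"

definition dg :: "real^'n \<Rightarrow> real^'n \<Rightarrow> real^'n \<Rightarrow> real^'n \<Rightarrow> real" where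
  "dg x h v w = frechet_derivative (\<lambda>y. g y v w) (at x) h"

lemma g_eq: "bilinear B \<Longrightarrow> (\<And>v w. B v w = B w v) \<Longrightarrow> (\<And>v. (N x v)\<^sup>2 = B v v) \<Longrightarrow> g x v w = B v w"
  by (simp add: g_def bilinear_ladd bilinear_radd bilinear_lsub bilinear_rsub)

text \<open>\<open>N\<close> is smooth off the zero section only; when \<open>v + w\<close> or
  \<open>v - w\<close> vanishes, the corresponding square is constantly 0.\<close>

lemma smooth_g: "Ck_on k U (\<lambda>x. g x v w)"
proof -
  have sq: "Ck_on k U (\<lambda>x. N x v * N x v)" for v
  proof (cases "v = 0")
    case True
    then show ?thesis using Ck_on_const[OF open_U, of k 0] by (simp add: finsler_norm_def)
  next
    case False
    then show ?thesis by (intro Ck_on_bilinear[OF open_U bounded_bilinear_mult] smooth_N_left)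
  qed
  have "Ck_on k U (\<lambda>x. (1/4) * (N x (v + w) * N x (v + w)) + (- (1/4)) * (N x (v - w) * N x (v - w)))"
    by (intro Ck_on_add[OF open_U] Ck_on_bilinear[OF open_U bounded_bilinear_mult, of _ "\<lambda>x. c" for c] Ck_on_const[OF open_U] sq)
  then show ?thesis by (simp add: g_def power2_eq_square diff_divide_distrib)
qed

lemma metric_field: "metric_field U g dg"
proof
  show "open U" by (rule open_U)
  fix x v w assume x: "x \<in> U"
  obtain B where B: "bilinear B" "\<And>v w. B v w = B w v" "\<And>v. v \<noteq> 0 \<Longrightarrow> B v v > 0" "\<And>v. (N x v)\<^sup>2 = B v v"
    using N_quadratic[OF x] by blast
  have gB: "g x = B" using g_eq[OF B(1,2,4)] by (intro ext)
  show "bilinear (g x)" "g x v w = g x w v" "v \<noteq> 0 \<Longrightarrow> 0 < g x v v" unfolding gB using B by auto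
  show "((\<lambda>y. g y v w) has_derivative (\<lambda>h. dg x h v w)) (at x)"
    unfolding dg_def using Ck_on_SucD(1)[OF smooth_g x] by simp
next
  show "continuous_on U (\<lambda>x. dg x h v w)" for h v w
    unfolding dg_def using Ck_on_SucD(2)[OF smooth_g, of 0 v w h] by simp
qed

sublocale metric_field U g dg by (rule metric_field)

lemma L_eq_N: "x \<in> U \<Longrightarrow> L x v = N x v"
proof -
  assume x: "x \<in> U"
  obtain B where B: "bilinear B" "\<And>v w. B v w = B w v" "\<And>v. v \<noteq> 0 \<Longrightarrow> B v v > 0" "\<And>v. (N x v)\<^sup>2 = B v v"
    using N_quadratic[OF x] by blast
  interpret I: smooth_indicatrix "I x" "N x" by (rule smooth_indicatrix[OF x])
  show ?thesis unfolding L_def g_eq[OF B(1,2,4)] B(4)[symmetric] using I.N_nonneg[of v] by simp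
qed

lemma minimizers_straight: "projectively_flat U I \<Longrightarrow> minimizers_straight"
  unfolding minimizers_straight_def
proof (intro allI impI)
  fix a b :: real and \<gamma> \<gamma>'
  assume flat: "projectively_flat U I" and ab: "a < b" and der: "\<forall>t\<in>{a..b}. (\<gamma> has_vector_derivative \<gamma>' t) (at t)"
    and cont: "continuous_on {a..b} \<gamma>'" and img: "\<gamma> ` {a..b} \<subseteq> U"
    and min: "\<forall>\<delta> \<delta>'. (\<forall>t\<in>{a..b}. (\<delta> has_vector_derivative \<delta>' t) (at t)) \<longrightarrow> continuous_on {a..b} \<delta>' \<longrightarrow> \<delta> ` {a..b} \<subseteq> U \<longrightarrow>
        \<delta> a = \<gamma> a \<longrightarrow> \<delta> b = \<gamma> b \<longrightarrow> integral {a..b} (\<lambda>t. L (\<gamma> t) (\<gamma>' t)) \<le> integral {a..b} (\<lambda>t. L (\<delta> t) (\<delta>' t))"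
  have len: "finsler_length I a b \<delta> = integral {a..b} (\<lambda>t. L (\<delta> t) (\<delta>' t))"
    if "\<forall>t\<in>{a..b}. (\<delta> has_vector_derivative \<delta>' t) (at t)" "\<delta> ` {a..b} \<subseteq> U" for \<delta> \<delta>'
    unfolding finsler_length_def
  proof (rule Henstock_Kurzweil_Integration.integral_cong)
    fix t assume t: "t \<in> {a..b}"
    have "vector_derivative \<delta> (at t) = \<delta>' t" by (rule vector_derivative_at) (use that t in blast)
    moreover have "\<delta> t \<in> U" using that(2) t by blast
    ultimately show "N (\<delta> t) (vector_derivative \<delta> (at t)) = L (\<delta> t) (\<delta>' t)" by (simp add: L_eq_N)
  qed
  have "finsler_geodesic U I a b \<gamma>"
    unfolding finsler_geodesic_def
  proof (intro conjI allI impI ab)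
    show "curve_in U a b \<gamma>" unfolding curve_in_def C1_differentiable_on_def using der cont img by blast
    fix \<delta> assume \<delta>: "curve_in U a b \<delta> \<and> \<delta> a = \<gamma> a \<and> \<delta> b = \<gamma> b"
    then obtain \<delta>' where \<delta>': "\<forall>t\<in>{a..b}. (\<delta> has_vector_derivative \<delta>' t) (at t)" "continuous_on {a..b} \<delta>'" "\<delta> ` {a..b} \<subseteq> U"
      unfolding curve_in_def C1_differentiable_on_def by blast
    show "finsler_length I a b \<gamma> \<le> finsler_length I a b \<delta>"
      unfolding len[OF der img] len[OF \<delta>'(1,3)] using min \<delta>' \<delta> by blast
  qed
  then show "\<exists>q r. \<gamma> ` {a..b} = closed_segment q r" using flat unfolding projectively_flat_def by blast
qed

lemma projective_field:
  assumes "projectively_flat U I"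
  obtains \<phi> where "projective_field U g dg \<phi>"
proof -
  have "\<forall>x\<in>U. \<exists>\<phi>. linear \<phi> \<and> (\<forall>h v w. dg x h v w = 2 * \<phi> h * g x v w + \<phi> v * g x h w + \<phi> w * g x h v)"
    using projective_connection[OF minimizers_straight[OF assms]] by blast
  then obtain \<phi> where "\<forall>x\<in>U. linear (\<phi> x) \<and> (\<forall>h v w. dg x h v w = 2 * \<phi> x h * g x v w + \<phi> x v * g x h w + \<phi> x w * g x h v)"
    by (rule bchoice[THEN exE])
  then have "projective_field U g dg \<phi>"
    by (intro projective_field.intro metric_field projective_field_axioms.intro) auto
  then show thesis by (rule that)
qed

end

theorem corollary1p18:
  fixes U :: "(real ^ 'n) set" and I :: "real ^ 'n \<Rightarrow> (real ^ 'n) set"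
  assumes "open U" and "connected U" and "U \<noteq> {}" and "simply_connected U"
    and "finsler_structure U I"
    and "projectively_flat U I"
    and "projective_reflection_law U I"
  shows "\<exists>c>0.
    isometric_to_domain_in U (\<lambda>x v. c * finsler_norm I x v)
      (UNIV :: (real ^ 'n) set) (\<lambda>p w. norm w) \<or>
    isometric_to_domain_in U (\<lambda>x v. c * finsler_norm I x v)
      (sphere 0 1 :: ((real ^ 'n) \<times> real) set) (\<lambda>p w. norm w) \<or>
    isometric_to_domain_in U (\<lambda>x v. c * finsler_norm I x v)
      (hyperbolic_space :: ((real ^ 'n) \<times> real) set) (\<lambda>p w. lorentz_norm w)"
proof -
  interpret reflective_finsler U I using assms by unfold_locales
  show ?thesis
  proof (cases "CARD('n) \<ge> 2")
    case False
    moreover have "CARD('n) > 0" by simp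
    ultimately have "CARD('n) = 1" by linarith
    have "isometric_to_domain_in U N (UNIV :: (real ^ 'n) set) (\<lambda>_ w. norm w)"
    proof (rule isometry_dim_1)
      show "open U" "connected U" using assms by auto
      show "Ck_on k U (\<lambda>x. N x v)" if "v \<noteq> 0" for k v using that by (rule smooth_N_left)
      show "DIM(real^'n) = 1" using \<open>CARD('n) = 1\<close> by simp
      show "N x (c *\<^sub>R v) = \<bar>c\<bar> * N x v" if "x \<in> U" for x c v
        using L_scale[OF that, of c v] by (simp add: L_eq_N[OF that])
      show "N x v > 0" if "x \<in> U" "v \<noteq> 0" for x v
        using L_pos[OF that] by (simp add: L_eq_N[OF that(1)])
    qed
    then show ?thesis by (intro exI[of _ 1]) simp
  next
    case True
    obtain p where p: "p \<in> U" using assms(3) by blast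
    obtain \<phi> where "projective_field U g dg \<phi>" using projective_field[OF assms(6)] by blast
    then interpret P: projective_field U g dg \<phi> .
    obtain Q :: "real^'n \<Rightarrow> real^'n" and b \<epsilon> c where Q: "linear Q" "bij Q" and c: "c > 0" and
      pos: "\<And>x. x \<in> U \<Longrightarrow> model_q b \<epsilon> (Q (x - p)) > 0" and
      nf: "\<And>x v. x \<in> U \<Longrightarrow> g x v v = c * (model_adj b \<epsilon> (Q (x - p)) (Q v) \<bullet> Q v) / (model_q b \<epsilon> (Q (x - p)))\<^sup>2"
      using P.normal_form[OF assms(2) True p] by blast
    note ctx = assms(1,2) Q pos
    \<comment> \<open>The normal form up to a free factor \<open>k\<close>, chosen below as the
      absolute value of \<open>\<epsilon>\<close>, or 1 in the flat case;
      \<open>sqrt (k / c)\<close> is the rescaling constant of the theorem.\<close>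
    have scaled: "sqrt (k / c) * N x v = sqrt (k * (model_adj b \<epsilon> (Q (x - p)) (Q v) \<bullet> Q v) / (model_q b \<epsilon> (Q (x - p)))\<^sup>2)"
      if "x \<in> U" for k x v
      using c by (simp add: L_eq_N[OF that, symmetric] L_def nf[OF that] real_sqrt_mult[symmetric])
    consider "\<epsilon> > 0" | "\<epsilon> < 0" | "\<epsilon> = 0" by linarith
    then show ?thesis
    proof cases
      case 1
      have "isometric_to_domain_in U (\<lambda>x v. sqrt (\<epsilon> / c) * N x v) (sphere 0 1 :: ((real ^ 'n) \<times> real) set) (\<lambda>_ w. norm w)"
      proof (rule curved_isometry[where e = "sqrt \<epsilon>" and \<sigma> = 1])
        fix x assume x: "x \<in> U"
        let ?y = "Q (x - p)"
        have "norm (sqrt \<epsilon> *\<^sub>R ?y, 1 + b \<bullet> ?y) = sqrt (model_q b \<epsilon> ?y)"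
          using 1 by (simp add: norm_Pair model_q_def power_mult_distrib power2_norm_eq_inner add.commute)
        then have "norm ((1 / sqrt (model_q b \<epsilon> ?y)) *\<^sub>R (sqrt \<epsilon> *\<^sub>R ?y, 1 + b \<bullet> ?y)) = 1"
          unfolding norm_scaleR using pos[OF x] by simp
        then show "(1 / sqrt (model_q b \<epsilon> ?y)) *\<^sub>R (sqrt \<epsilon> *\<^sub>R ?y, 1 + b \<bullet> ?y) \<in> sphere 0 1"
          by (simp only: mem_sphere dist_0_norm)
      qed (use ctx 1 scaled in \<open>auto simp: norm_Pair power2_norm_eq_inner add.commute\<close>)
      moreover have "sqrt (\<epsilon> / c) > 0" using 1 c by simp
      ultimately show ?thesis by blast
    next
      case 2
      \<comment> \<open>The quadric has two sheets in this case; positivity of the last coordinate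
        places the image on the upper one.\<close>
      have spos: "1 + b \<bullet> Q (x - p) > 0" if "x \<in> U" for x
        by (rule normal_form_denominator_pos[OF ctx _ p that]) (use 2 in auto)
      have "isometric_to_domain_in U (\<lambda>x v. sqrt (- \<epsilon> / c) * N x v) (hyperbolic_space :: ((real ^ 'n) \<times> real) set) (\<lambda>_ w. lorentz_norm w)"
      proof (rule curved_isometry[where e = "sqrt (- \<epsilon>)" and \<sigma> = "- 1"])
        fix x assume x: "x \<in> U"
        let ?y = "Q (x - p)"
        let ?r = "sqrt (model_q b \<epsilon> ?y)"
        have r: "?r > 0" "?r\<^sup>2 = model_q b \<epsilon> ?y" using pos[OF x] by auto
        have "((1 / ?r) * sqrt (- \<epsilon>)) * ((1 / ?r) * sqrt (- \<epsilon>)) * (?y \<bullet> ?y) - ((1 / ?r) * (1 + b \<bullet> ?y))\<^sup>2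
            = (1 / ?r)\<^sup>2 * ((sqrt (- \<epsilon>))\<^sup>2 * (?y \<bullet> ?y) - (1 + b \<bullet> ?y)\<^sup>2)"
        proof -
          have "(i * t) * (i * t) * Y - (i * s)\<^sup>2 = i\<^sup>2 * (t\<^sup>2 * Y - s\<^sup>2)" for i t Y s :: real
            by (simp add: power2_eq_square algebra_simps)
          then show ?thesis .
        qed
        also have "(sqrt (- \<epsilon>))\<^sup>2 * (?y \<bullet> ?y) - (1 + b \<bullet> ?y)\<^sup>2 = - (?r\<^sup>2)"
          unfolding r(2) using 2 by (simp add: model_q_def)
        also have "(1 / ?r)\<^sup>2 * - (?r\<^sup>2) = - 1" using r(1) by (simp add: power_divide)
        finally have eq: "((1 / ?r) * sqrt (- \<epsilon>)) * ((1 / ?r) * sqrt (- \<epsilon>)) * (?y \<bullet> ?y) - ((1 / ?r) * (1 + b \<bullet> ?y))\<^sup>2 = - 1" .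
        have "0 < (1 / ?r) * (1 + b \<bullet> ?y)" using spos[OF x] r(1) by simp
        moreover have "(k *\<^sub>R z, u) \<in> hyperbolic_space" if "k * k * (z \<bullet> z) - u\<^sup>2 = - 1" "0 < u" for k u :: real and z :: "real^'n"
          using that by (simp add: hyperbolic_space_def mult.assoc)
        ultimately have "(((1 / ?r) * sqrt (- \<epsilon>)) *\<^sub>R ?y, (1 / ?r) * (1 + b \<bullet> ?y)) \<in> hyperbolic_space" using eq by blast
        then show "(1 / ?r) *\<^sub>R (sqrt (- \<epsilon>) *\<^sub>R ?y, 1 + b \<bullet> ?y) \<in> hyperbolic_space" by simp
      qed (use ctx 2 scaled[of _ "- \<epsilon>"] in \<open>auto simp: hyperbolic_space_def lorentz_norm_def\<close>)
      moreover have "sqrt (- \<epsilon> / c) > 0" using 2 c by (simp add: divide_neg_pos)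
      ultimately show ?thesis by blast
    next
      case 3
      have "isometric_to_domain_in U (\<lambda>x v. sqrt (1 / c) * N x v) (UNIV :: (real ^ 'n) set) (\<lambda>_ w. norm w)"
      proof (rule flat_isometry[OF ctx 3])
        show "1 + b \<bullet> Q (x - p) > 0" if "x \<in> U" for x
          by (rule normal_form_denominator_pos[OF ctx _ p that]) (use 3 in auto)
      qed (use scaled[of _ 1] in auto)
      moreover have "sqrt (1 / c) > 0" using c by simp
      ultimately show ?thesis by blast
    qed
  qed
qed

end
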